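(* Let $A,B\in\mathbb C^{n,n}$ be such that $A-\lambda B$ is a singular pencil of normal rank $n-k$ with left minimal indices $n_1,\dots,n_k$ and right minimal indices $m_1,\dots,m_k$. Let $U,V\in\mathbb C^{n,k}$ have full column rank and let $D_A=\operatorname{diag}(a_1,\dots,a_k)$, $D_B=\operatorname{diag}(b_1,\dots,b_k)\in\mathbb C^{k,k}$ be such that $D_A-\lambda D_B$ is regular and such that all (not necessarily pairwise distinct) values $\gamma_i:=\frac{a_i}{b_i}$, $i=1,\dots,k$, are different from the eigenvalues of $A-\lambda B$ (here $\frac{a_i}{b_i}$ is interpreted as the infinite eigenvalue if $b_i=0$). Let $N:=n_1+\cdots+n_k$ and $M:=m_1+\cdots+m_k$. For $\tau\in\mathbb C\setminus\{0\}$ put $$\widetilde A-\lambda\widetilde B:=A-\lambda B+\tau\,(UD_AV^*-\lambda\,UD_BV^* ).$$ Then, generically with respect to the entries of $U$ and $V^*$, the following statements hold: 1. The pencil $\widetilde A-\lambda\widetilde B$ has $M$ simple eigenvalues $\alpha_1,\dots,\alpha_M$ which are independent of $\tau\neq0$, so that for each of these eigenvalues its right eigenvector $x_i$ is constant in $\tau\ne0$ (up to scaling) and satisfies $V^*x_i=0$, while the left eigenvector $y_i$ is a linear function of $\tau$ (up to scaling) and satisfies $U^*y_i\neq0$ for all $\tau\neq0$. 2. The pencil $\widetilde A-\lambda\widetilde B$ has $N$ simple eigenvalues $\beta_1,\dots,\beta_N$ which are independent of $\tau\neq0$, so that for each of these eigenvalues its left eigenvector $y_i$ is constant for $\tau\ne0$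 (up to scaling) and satisfies $U^*y_i=0$, while the right eigenvector $x_i$ is a linear function of $\tau$ (up to scaling) and satisfies $V^*x_i\neq0$ for all $\tau\neq0$. 3. For each $\tau\neq0$ each $\gamma_i$ is an eigenvalue of $\widetilde A-\lambda\widetilde B$ with the same algebraic multiplicity as for the pencil $D_A-\lambda D_B$. Furthermore, the left and right null spaces $\mathcal N_l(\gamma_i)$ and $\mathcal N_r(\gamma_i)$ of $\widetilde A-\lambda\widetilde B$ associated with $\gamma_i$ are constant in $\tau$. In addition: (a) $\mathcal N_r(\gamma_i)\cap\ker(V^* )=\{0\}$, i.e., for each right eigenvector $x$ of $\widetilde A-\lambda\widetilde B$ associated with $\gamma_i$ we have $V^*x\neq0$; (b) $\mathcal N_l(\gamma_i)\cap\ker(U^* )=\{0\}$, i.e., for each left eigenvector $y$ of $\widetilde A-\lambda\widetilde B$ associated with $\gamma_i$ we have $U^*y\neq0$. (The simplicity of the eigenvalues $\alpha_1,\dots,\alpha_M,\beta_1,\dots,\beta_N$ implies that they are all different from the eigenvalues of $A-\lambda B$ and from $\gamma_1,\dots,\gamma_k$.)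
   Context: $\mathbb C^{n,m}$ is the set of complex $n\times m$ matrices and $X^*$ is the conjugate transpose. The normal rank of a pencil is $\operatorname{nrank}(A,B):=\max_{\zeta\in\mathbb C}\operatorname{rank}(A-\zeta B)$. A square pencil is singular if $\det(A-\lambda B)\equiv0$, and regular otherwise. A finite eigenvalue of a (possibly singular) pencil is $\lambda_0\in\mathbb C$ with $\operatorname{rank}(A-\lambda_0B)<\operatorname{nrank}(A,B)$; $\infty$ is an eigenvalue if $\operatorname{rank}(B)<\operatorname{nrank}(A,B)$. For a regular pencil $\widetilde A-\lambda\widetilde B$ and a finite eigenvalue $\mu$, $\mathcal N_r(\mu)=\ker(\widetilde A-\mu\widetilde B)$ and $\mathcal N_l(\mu)=\ker((\widetilde A-\mu\widetilde B)^* )$; for $\mu=\infty$, $\mathcal N_r(\infty)=\ker(\widetilde B)$ and $\mathcal N_l(\infty)=\ker(\widetilde B^* )$. Right (left) eigenvectors associated with $\mu$ are the nonzero elements of $\mathcal N_r(\mu)$ (resp. $\mathcal N_l(\mu)$). An eigenvalue of a regular pencil is simple if its algebraic multiplicity is one. A vector is called a linear function of $\tau$ if it has the form $w+\tau z$ with vectors $w,z\in\mathbb C^n$ independent of $\tau$ (a constant term is allowed). Minimal indices come from the Kronecker canonical form: for every complex pencil $A-\lambda B$ there are nonsingular $P,Q$ with $P(A-\lambda B)Q=\operatorname{diag}(R(\lambda),S(\lambda))$, where $R(\lambda)=\operatorname{diag}(J-\lambda I,\,I-\lambda N_0)$ with $J,N_0$ in Jordan normal form and $N_0$ nilpotent,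 and $S(\lambda)=\operatorname{diag}(L_{m_1}(\lambda),\dots,L_{m_p}(\lambda),L_{n_1}(\lambda)^\top,\dots,L_{n_q}(\lambda)^\top)$ with $L_j(\lambda)=[0\ \ I_j]-\lambda[I_j\ \ 0]$ of size $j\times(j+1)$, $j\ge0$. The $m_i$ are the right and the $n_i$ the left minimal indices; for an $n\times n$ pencil of normal rank $n-k$ there are exactly $k$ of each. Genericity: a subset of $\mathbb C^m$ is algebraic if it is the set of common zeros of finitely many complex polynomials in $m$ variables, and proper if it is not all of $\mathbb C^m$. A set $\Omega\subseteq\mathbb C^m$ is generic if its complement is contained in a proper algebraic set. A property holds generically with respect to the entries of $U$ and $V^*$ if there is a generic set $\Omega\subseteq\mathbb C^{2nk}$ (identified with pairs $(U,V^* )$, $U\in\mathbb C^{n,k}$, $V^*\in\mathbb C^{k,n}$) such that the property holds whenever $(U,V^* )\in\Omega$; here $A,B,D_A,D_B$ are fixed.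
   Formalization: In item 1, with complex τ and left eigenvectors defined by the conjugate transpose, y_i itself cannot be linear in τ; the formal statement says that the conjugate of y_i (the row vector y_i^* ) is a linear function of τ, which agrees with the text for real τ. *)

theory Defs
  imports
    "HOL-Library.Poly_Mapping"
    "Jordan_Normal_Form.Schur_Decomposition"
    "Jordan_Normal_Form.Jordan_Normal_Form"
    "Jordan_Normal_Form.Matrix_Kernel"
    "Jordan_Normal_Form.DL_Rank"
begin

section \<open>Matrix pencils\<close>

text \<open>A pencil \<open>A - \<lambda> B\<close> is represented by the pair of its coefficient matrices
  \<open>A\<close>, \<open>B\<close>.\<close>

definition mat_rank :: "complex mat \<Rightarrow> nat" where
  "mat_rank A = vec_space.rank (dim_row A) A"

definition nrank :: "complex mat \<Rightarrow> complex mat \<Rightarrow> nat" where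
  "nrank A B = Max (range (\<lambda>\<zeta>. mat_rank (A - \<zeta> \<cdot>\<^sub>m B)))"

definition pencil_det :: "complex mat \<Rightarrow> complex mat \<Rightarrow> complex poly" where
  "pencil_det A B = det (map_mat (\<lambda>a. [:a:]) A - map_mat (\<lambda>b. [:0, b:]) B)"

text \<open>The next two notions are used for square pencils only.\<close>

definition singular_pencil :: "complex mat \<Rightarrow> complex mat \<Rightarrow> bool" where
  "singular_pencil A B \<longleftrightarrow> pencil_det A B = 0"

definition regular_pencil :: "complex mat \<Rightarrow> complex mat \<Rightarrow> bool" where
  "regular_pencil A B \<longleftrightarrow> \<not> singular_pencil A B"

section \<open>Finite and infinite eigenvalues\<close>

datatype ext_complex = Fin_ev complex | Inf_ev

fun pencil_at :: "complex mat \<Rightarrow> complex mat \<Rightarrow> ext_complex \<Rightarrow> complex mat" where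
  "pencil_at A B (Fin_ev \<mu>) = A - \<mu> \<cdot>\<^sub>m B"
| "pencil_at A B Inf_ev = B"

definition pencil_eigenvalue :: "complex mat \<Rightarrow> complex mat \<Rightarrow> ext_complex \<Rightarrow> bool" where
  "pencil_eigenvalue A B \<mu> \<longleftrightarrow> mat_rank (pencil_at A B \<mu>) < nrank A B"

text \<open>The algebraic multiplicity is meaningful for regular pencils only. At infinity it is the
  multiplicity of \<open>0\<close> for the reversed pencil \<open>B - \<lambda> A\<close>.\<close>

fun alg_mult :: "complex mat \<Rightarrow> complex mat \<Rightarrow> ext_complex \<Rightarrow> nat" where
  "alg_mult A B (Fin_ev \<mu>) = order \<mu> (pencil_det A B)"
| "alg_mult A B Inf_ev = order 0 (pencil_det B A)"

definition simple_eigenvalue :: "complex mat \<Rightarrow> complex mat \<Rightarrow> ext_complex \<Rightarrow> bool" where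
  "simple_eigenvalue A B \<mu> \<longleftrightarrow>
     regular_pencil A B \<and> pencil_eigenvalue A B \<mu> \<and> alg_mult A B \<mu> = 1"

definition right_nullspace :: "complex mat \<Rightarrow> complex mat \<Rightarrow> ext_complex \<Rightarrow> complex vec set" where
  "right_nullspace A B \<mu> = mat_kernel (pencil_at A B \<mu>)"

definition left_nullspace :: "complex mat \<Rightarrow> complex mat \<Rightarrow> ext_complex \<Rightarrow> complex vec set" where
  "left_nullspace A B \<mu> = mat_kernel (mat_adjoint (pencil_at A B \<mu>))"

definition right_eigenvector ::
  "complex mat \<Rightarrow> complex mat \<Rightarrow> ext_complex \<Rightarrow> complex vec \<Rightarrow> bool" where
  "right_eigenvector A B \<mu> x \<longleftrightarrow> x \<in> right_nullspace A B \<mu> \<and> x \<noteq> 0\<^sub>v (dim_col A)"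

definition left_eigenvector ::
  "complex mat \<Rightarrow> complex mat \<Rightarrow> ext_complex \<Rightarrow> complex vec \<Rightarrow> bool" where
  "left_eigenvector A B \<mu> y \<longleftrightarrow> y \<in> left_nullspace A B \<mu> \<and> y \<noteq> 0\<^sub>v (dim_row A)"

definition ev_quotient :: "complex \<Rightarrow> complex \<Rightarrow> ext_complex" where
  "ev_quotient a b = (if b = 0 then Inf_ev else Fin_ev (a / b))"

text \<open>Left eigenvectors \<open>y\<close> satisfy \<open>y\<^sup>* (A - \<mu> B) = 0\<close>, so for a pencil depending linearly on a
  complex parameter \<open>\<tau>\<close> it is the row vector \<open>y\<^sup>*\<close>, i.e. the conjugate of \<open>y\<close>, that can be
  linear in \<open>\<tau>\<close>; \<open>y\<close> itself is then linear in the conjugate of \<open>\<tau>\<close>.\<close>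

definition linear_function :: "nat \<Rightarrow> (complex \<Rightarrow> complex vec) \<Rightarrow> bool" where
  "linear_function n f \<longleftrightarrow>
     (\<exists>w \<in> carrier_vec n. \<exists>z \<in> carrier_vec n. \<forall>\<tau>. f \<tau> = w + \<tau> \<cdot>\<^sub>v z)"

section \<open>Kronecker canonical form and minimal indices\<close>

definition L_block :: "nat \<Rightarrow> complex \<Rightarrow> complex mat" where
  "L_block j \<zeta> =
     mat j (j + 1) (\<lambda>(r, c). if c = r + 1 then 1 else 0)
     - \<zeta> \<cdot>\<^sub>m mat j (j + 1) (\<lambda>(r, c). if c = r then 1 else 0)"

definition in_jordan_form :: "complex mat \<Rightarrow> bool" where
  "in_jordan_form J \<longleftrightarrow> (\<exists>n_as. 0 \<notin> fst ` set n_as \<and> J = jordan_matrix n_as)"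

definition nilpotent_mat :: "complex mat \<Rightarrow> bool" where
  "nilpotent_mat X \<longleftrightarrow> (\<exists>r. X ^\<^sub>m r = 0\<^sub>m (dim_row X) (dim_row X))"

text \<open>The \<open>n \<times> n\<close> pencil \<open>A - \<lambda> B\<close> has left minimal indices \<open>ns\<close> and right minimal
  indices \<open>ms\<close>, each list in some order. Blocks with \<open>0\<close> rows or \<open>0\<close> columns
  (minimal index zero) contribute a zero column or a zero row.\<close>

definition has_minimal_indices ::
  "nat \<Rightarrow> complex mat \<Rightarrow> complex mat \<Rightarrow> nat list \<Rightarrow> nat list \<Rightarrow> bool" where
  "has_minimal_indices n A B ns ms \<longleftrightarrow>
     (\<exists>P Q J N0.
        P \<in> carrier_mat n n \<and> Q \<in> carrier_mat n n \<and> invertible_mat P \<and> invertible_mat Q \<and>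
        in_jordan_form J \<and> in_jordan_form N0 \<and> nilpotent_mat N0 \<and>
        (\<forall>\<zeta>. P * (A - \<zeta> \<cdot>\<^sub>m B) * Q =
           diag_block_mat
             ([J - \<zeta> \<cdot>\<^sub>m 1\<^sub>m (dim_row J), 1\<^sub>m (dim_row N0) - \<zeta> \<cdot>\<^sub>m N0]
              @ map (\<lambda>j. L_block j \<zeta>) ms
              @ map (\<lambda>j. transpose_mat (L_block j \<zeta>)) ns)))"

section \<open>Genericity\<close>

text \<open>A complex polynomial in the variables \<open>x\<^sub>i\<close>, \<open>i < m\<close>, is a finitely supported map from
  monomials (finitely supported exponent maps) to coefficients.\<close>

type_synonym cpoly = "(nat \<Rightarrow>\<^sub>0 nat) \<Rightarrow>\<^sub>0 complex"

definition poly_in :: "nat \<Rightarrow> cpoly \<Rightarrow> bool" where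
  "poly_in m p \<longleftrightarrow> (\<forall>e \<in> Poly_Mapping.keys p. Poly_Mapping.keys e \<subseteq> {..<m})"

definition poly_value :: "cpoly \<Rightarrow> complex vec \<Rightarrow> complex" where
  "poly_value p x = (\<Sum>e\<in>Poly_Mapping.keys p. Poly_Mapping.lookup p e * (\<Prod>i\<in>Poly_Mapping.keys e. (x $ i) ^ Poly_Mapping.lookup e i))"

definition algebraic_set :: "nat \<Rightarrow> complex vec set \<Rightarrow> bool" where
  "algebraic_set m S \<longleftrightarrow>
     (\<exists>F. finite F \<and> (\<forall>p\<in>F. poly_in m p) \<and>
          S = {x \<in> carrier_vec m. \<forall>p\<in>F. poly_value p x = 0})"

definition generic_set :: "nat \<Rightarrow> complex vec set \<Rightarrow> bool" where
  "generic_set m \<Omega> \<longleftrightarrow>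
     \<Omega> \<subseteq> carrier_vec m \<and>
     (\<exists>S. algebraic_set m S \<and> S \<noteq> carrier_vec m \<and> carrier_vec m - \<Omega> \<subseteq> S)"

text \<open>The vector of all entries of \<open>U\<close>, followed by those of \<open>W\<close>, both row by row.\<close>

definition entries_vec :: "complex mat \<Rightarrow> complex mat \<Rightarrow> complex vec" where
  "entries_vec U W =
     vec (dim_row U * dim_col U) (\<lambda>i. U $$ (i div dim_col U, i mod dim_col U))
     @\<^sub>v vec (dim_row W * dim_col W) (\<lambda>i. W $$ (i div dim_col W, i mod dim_col W))"

end

theory Submission
  imports Defs "Subresultants.Subresultant_Gcd" "HOL-Computational_Algebra.Field_as_Ring"
    "HOL-Library.Nat_Bijection"
begin

text \<open>
  The Kronecker form yields matrices \<open>X\<close>, \<open>Y\<close> with \<open>k\<close> columns, polynomial in the parameter, whose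
  columns span the right and left kernel of \<open>S = A - \<lambda> B\<close>, and constant matrices \<open>U0\<close>, \<open>W0\<close> dual to
  \<open>Y\<close> and \<open>X\<close>. With \<open>W\<^sup>T = V\<^sup>*\<close>, the identity
  \<open>S + U W\<^sup>T = (I + (U - U0) Y\<^sup>T) (S + U0 W0\<^sup>T) (I + X (W - W0)\<^sup>T)\<close> gives
  \<open>det (S + \<tau> U D W\<^sup>T) = \<tau>\<^sup>k \<rho> det (Y\<^sup>T U) det D det (W\<^sup>T X)\<close>, where \<open>\<rho> = det (S + U0 W0\<^sup>T)\<close> vanishes
  exactly at the eigenvalues of the singular pencil. Hence the eigenvalues of the perturbed pencil
  are those of \<open>A - \<lambda> B\<close>, the \<open>\<gamma>\<^sub>i\<close>, the roots \<open>\<alpha>\<^sub>i\<close> of \<open>det (W\<^sup>T X)\<close> and the roots \<open>\<beta>\<^sub>i\<close> of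
  \<open>det (Y\<^sup>T U)\<close>, none of which depends on \<open>\<tau>\<close>. Generically the last two polynomials have degrees \<open>M\<close>
  and \<open>N\<close>, and their product is square-free and coprime to everything else; this is the
  nonvanishing of a leading coefficient, a discriminant and finitely many values, and one choice of
  \<open>U\<close> and \<open>W\<close> makes the two polynomials products of prescribed distinct linear factors. Statements
  about left eigenvectors follow by transposing the pencil.
\<close>

section \<open>Rank updates of a matrix with known kernels\<close>

text \<open>Multiplicities need an identity between polynomials, kernels need matrices over a field.
  The factorisation behind the determinant formula therefore avoids inverses, so that it holds over
  polynomials and can then be evaluated at a point. The constant dual matrices survive evaluation,
  which keeps the kernel columns independent at every point, eigenvalues included. Some of the
  prescribed quotients may be infinite. Hence the kernel polynomials are homogenised and everything
  is done in a finite and an infinite chart, each with its own dual matrices. The eigenvalues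
  \<alpha> and \<beta> stay finite because the two determinants are forced to have full degree. In
  \<open>\<tau> U D W\<^sup>T\<close> the scalar and \<open>D\<close> are attached to
  \<open>U\<close>, so \<tau> enters the determinant only through a unit. Conjugation is not
  polynomial. So \<open>V\<close> enters only through its adjoint \<open>W\<^sup>T\<close>, and left
  eigenvectors only through their conjugates, which are right eigenvectors of the transposed
  pencil.\<close>

lemma det_one_plus_mult_commute:
  fixes A :: "'a::idom mat"
  assumes A: "A \<in> carrier_mat n k" and B: "B \<in> carrier_mat k n"
  shows "det (1\<^sub>m n + A * B) = det (1\<^sub>m k + B * A)"
proof -
  define M where "M = four_block_mat (1\<^sub>m n) (- A) B (1\<^sub>m k)"
  define E where "E = four_block_mat (1\<^sub>m n) A (0\<^sub>m k n) (1\<^sub>m k)"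
  have M: "M \<in> carrier_mat (n + k) (n + k)" and E: "E \<in> carrier_mat (n + k) (n + k)"
    using A B by (auto simp: M_def E_def)
  have AA: "- A + A = 0\<^sub>m n k" using A by auto
  \<comment> \<open>Sylvester's identity without inverses: the unipotent \<open>E\<close> clears the
    upper right block of \<open>M\<close> from either side, and each time one block determinant is
    left.\<close>
  have "M * E = four_block_mat (1\<^sub>m n) (0\<^sub>m n k) B (1\<^sub>m k + B * A)"
    unfolding M_def E_def
    by (subst mult_four_block_mat[where ?nr1.0 = n and ?n1.0 = n and ?n2.0 = k and ?nr2.0 = k and ?nc1.0 = n and ?nc2.0 = k])
      (use A B in \<open>auto simp: comm_add_mat[of B k n] comm_add_mat[of _ k k]\<close>)
  moreover have "E * M = four_block_mat (1\<^sub>m n + A * B) (0\<^sub>m n k) B (1\<^sub>m k)"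
    unfolding M_def E_def
    by (subst mult_four_block_mat[where ?nr1.0 = n and ?n1.0 = n and ?n2.0 = k and ?nr2.0 = k and ?nc1.0 = n and ?nc2.0 = k])
      (use A B AA in auto)
  moreover have "det (M * E) = det (E * M)"
    using det_mult[OF M E] det_mult[OF E M] by (simp add: mult.commute)
  moreover have "det (four_block_mat (1\<^sub>m n) (0\<^sub>m n k) B (1\<^sub>m k + B * A)) = det (1\<^sub>m k + B * A)"
    by (subst det_four_block_mat_upper_right_zero[of _ n _ k]) (use A B in auto)
  moreover have "det (four_block_mat (1\<^sub>m n + A * B) (0\<^sub>m n k) B (1\<^sub>m k)) = det (1\<^sub>m n + A * B)"
    by (subst det_four_block_mat_upper_right_zero[of _ n _ k]) (use A B in auto)
  ultimately show ?thesis by simp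
qed

text \<open>An integral domain is enough, so the frame serves polynomial matrices as well as their
  values at a point. \<open>YU0\<close> and \<open>WX0\<close> exhibit one-sided inverses, so the
  kernel columns stay independent after any evaluation.\<close>

locale null_frame =
  fixes n k :: nat and S X Y U0 W0 :: "'a::idom mat"
  assumes S [simp, intro]: "S \<in> carrier_mat n n"
    and X [simp, intro]: "X \<in> carrier_mat n k" and Y [simp, intro]: "Y \<in> carrier_mat n k"
    and U0 [simp, intro]: "U0 \<in> carrier_mat n k" and W0 [simp, intro]: "W0 \<in> carrier_mat n k"
    and SX: "S * X = 0\<^sub>m n k" and SY: "S\<^sup>T * Y = 0\<^sub>m n k"
    and YU0: "Y\<^sup>T * U0 = 1\<^sub>m k" and WX0: "W0\<^sup>T * X = 1\<^sub>m k"
begin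

lemmas carriers = S X Y U0 W0

lemmas dims [simp] = carriers[THEN carrier_matD(1)] carriers[THEN carrier_matD(2)]

lemmas mult_vec_carrier [simp, intro] = carriers(1,2)[THEN mult_mat_vec_carrier]

lemma YS: "Y\<^sup>T * S = 0\<^sub>m k n"
proof -
  have "(S\<^sup>T * Y)\<^sup>T = Y\<^sup>T * S"
    by (subst transpose_mult[of _ n n _ k]) auto
  then show ?thesis unfolding SY by (metis zero_transpose_mat)
qed

text \<open>The border fills in the \<open>k\<close> kernel directions; over a field the result is
  invertible exactly if the rank of \<open>S\<close> reaches \<open>n - k\<close>, see
  \<open>rank_ge_iff\<close>.\<close>

definition "bordered = S + U0 * W0\<^sup>T"

lemma bordered_carrier [simp, intro]: "bordered \<in> carrier_mat n n"
  unfolding bordered_def by auto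

lemma YB: "Y\<^sup>T * bordered = W0\<^sup>T"
proof -
  have "Y\<^sup>T * bordered = Y\<^sup>T * S + Y\<^sup>T * (U0 * W0\<^sup>T)"
    unfolding bordered_def by (rule mult_add_distrib_mat[of _ k n _ n]) auto
  also have "Y\<^sup>T * (U0 * W0\<^sup>T) = Y\<^sup>T * U0 * W0\<^sup>T"
    by (rule assoc_mult_mat[symmetric, of _ k n _ k _ n]) auto
  finally show ?thesis by (simp add: YS YU0)
qed

text \<open>Since \<open>S\<close> kills \<open>X\<close> and is killed by \<open>Y\<^sup>T\<close>, replacing \<open>U0\<close> by \<open>U\<close> and \<open>W0\<close> by \<open>W\<close> amounts to
  multiplying with rank \<open>k\<close> modifications of the identity on both sides.\<close>

lemma det_rank_update:
  assumes U: "U \<in> carrier_mat n k" and W: "W \<in> carrier_mat n k"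
  shows "det (S + U * W\<^sup>T) = det bordered * det (Y\<^sup>T * U) * det (W\<^sup>T * X)"
proof -
  define C where "C = U - U0"
  define D where "D = W\<^sup>T - W0\<^sup>T"
  have C: "C \<in> carrier_mat n k" and D: "D \<in> carrier_mat k n"
    using U W by (auto simp: C_def D_def)
  note c = U W C D
  have CD: "U0 + C = U" "W0\<^sup>T + D = W\<^sup>T"
    by (rule eq_matI; use c in \<open>auto simp: C_def D_def\<close>)+
  have 1: "(1\<^sub>m n + C * Y\<^sup>T) * bordered = S + U * W0\<^sup>T"
  proof -
    have "(1\<^sub>m n + C * Y\<^sup>T) * bordered = 1\<^sub>m n * bordered + C * Y\<^sup>T * bordered"
      by (rule add_mult_distrib_mat[of _ n n _ _ n]) (use c in auto)
    also have "C * Y\<^sup>T * bordered = C * W0\<^sup>T"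
      by (subst assoc_mult_mat[of _ n k _ n _ n]) (use c in \<open>auto simp: YB\<close>)
    also have "1\<^sub>m n * bordered = S + U0 * W0\<^sup>T" by (simp add: bordered_def)
    also have "S + U0 * W0\<^sup>T + C * W0\<^sup>T = S + (U0 * W0\<^sup>T + C * W0\<^sup>T)"
      by (rule assoc_add_mat[of _ n n]) (use c in auto)
    also have "U0 * W0\<^sup>T + C * W0\<^sup>T = (U0 + C) * W0\<^sup>T"
      by (rule add_mult_distrib_mat[symmetric, of _ n k _ _ n]) (use c in auto)
    finally show ?thesis unfolding CD .
  qed
  have 2: "(S + U * W0\<^sup>T) * (1\<^sub>m n + X * D) = S + U * W\<^sup>T"
  proof -
    have "(S + U * W0\<^sup>T) * X = S * X + U * W0\<^sup>T * X"
      by (rule add_mult_distrib_mat[of _ n n _ _ k]) (use c in auto)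
    also have "U * W0\<^sup>T * X = U * (W0\<^sup>T * X)"
      by (rule assoc_mult_mat[of _ n k _ n _ k]) (use c in auto)
    finally have SUX: "(S + U * W0\<^sup>T) * X = U" using U by (simp add: SX WX0)
    have "(S + U * W0\<^sup>T) * (1\<^sub>m n + X * D)
        = (S + U * W0\<^sup>T) * 1\<^sub>m n + (S + U * W0\<^sup>T) * (X * D)"
      by (rule mult_add_distrib_mat[of _ n n _ n]) (use c in auto)
    also have "(S + U * W0\<^sup>T) * (X * D) = (S + U * W0\<^sup>T) * X * D"
      by (rule assoc_mult_mat[symmetric, of _ n n _ k _ n]) (use c in auto)
    also have "\<dots> = U * D" unfolding SUX ..
    also have "(S + U * W0\<^sup>T) * 1\<^sub>m n = S + U * W0\<^sup>T" using U by auto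
    also have "S + U * W0\<^sup>T + U * D = S + (U * W0\<^sup>T + U * D)"
      by (rule assoc_add_mat[of _ n n]) (use c in auto)
    also have "U * W0\<^sup>T + U * D = U * (W0\<^sup>T + D)"
      by (rule mult_add_distrib_mat[symmetric, of _ n k _ n]) (use c in auto)
    finally show ?thesis unfolding CD .
  qed
  have "1\<^sub>m n + C * Y\<^sup>T \<in> carrier_mat n n" "1\<^sub>m n + X * D \<in> carrier_mat n n"
    using c by auto
  then have "det (S + U * W\<^sup>T) = det (1\<^sub>m n + C * Y\<^sup>T) * det bordered * det (1\<^sub>m n + X * D)"
    unfolding 2[symmetric] 1[symmetric]
    by (metis det_mult mult_carrier_mat bordered_carrier)
  also have "det (1\<^sub>m n + C * Y\<^sup>T) = det (1\<^sub>m k + Y\<^sup>T * C)"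
    by (rule det_one_plus_mult_commute) (use c in auto)
  also have "1\<^sub>m k + Y\<^sup>T * C = Y\<^sup>T * U"
    by (subst CD(1)[symmetric], subst mult_add_distrib_mat[of _ k n _ k]) (use c in \<open>auto simp: YU0\<close>)
  also have "det (1\<^sub>m n + X * D) = det (1\<^sub>m k + D * X)"
    by (rule det_one_plus_mult_commute) (use c in auto)
  also have "1\<^sub>m k + D * X = W\<^sup>T * X"
    by (subst CD(2)[symmetric], subst add_mult_distrib_mat[of _ k n _ _ k]) (use c in \<open>auto simp: WX0\<close>)
  finally show ?thesis by (simp add: mult.commute mult.left_commute)
qed

end

text \<open>Matrix equations survive ring homomorphisms; the one used later is evaluation of
  polynomials at a point.\<close>

lemma null_frame_map:
  fixes hom :: "'a::idom \<Rightarrow> 'b::idom"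
  assumes "comm_ring_hom hom" and "null_frame n k S X Y U0 W0"
  shows "null_frame n k (map_mat hom S) (map_mat hom X) (map_mat hom Y) (map_mat hom U0) (map_mat hom W0)"
proof -
  interpret comm_ring_hom hom by fact
  interpret null_frame n k S X Y U0 W0 by fact
  have z: "map_mat hom (0\<^sub>m i j) = 0\<^sub>m i j" and o: "map_mat hom (1\<^sub>m i) = 1\<^sub>m i" for i j
    by (auto intro!: eq_matI)
  show ?thesis
  proof
    show "map_mat hom S * map_mat hom X = 0\<^sub>m n k"
      using mat_hom_mult[OF S X] by (simp add: SX z)
    show "(map_mat hom S)\<^sup>T * map_mat hom Y = 0\<^sub>m n k"
      using mat_hom_mult[of "S\<^sup>T" n n Y k] by (simp add: SY z map_mat_transpose)
    show "(map_mat hom Y)\<^sup>T * map_mat hom U0 = 1\<^sub>m k"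
      using mat_hom_mult[of "Y\<^sup>T" k n U0 k] by (simp add: YU0 o map_mat_transpose)
    show "(map_mat hom W0)\<^sup>T * map_mat hom X = 1\<^sub>m k"
      using mat_hom_mult[of "W0\<^sup>T" k n X k] by (simp add: WX0 o map_mat_transpose)
  qed auto
qed

section \<open>Kernels, linear systems and ranks over a field\<close>

lemma smult_zero_vec: "c \<cdot>\<^sub>v 0\<^sub>v n = (0\<^sub>v n :: 'a::mult_zero vec)"
  by (rule eq_vecI) auto

lemma smult_mat_mult_vec:
  fixes M :: "'a::comm_ring_1 mat"
  assumes "M \<in> carrier_mat m n" "x \<in> carrier_vec n"
  shows "(c \<cdot>\<^sub>m M) *\<^sub>v x = c \<cdot>\<^sub>v (M *\<^sub>v x)"
  by (rule eq_vecI) (use assms in auto)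

lemma singular_mat_kernelE:
  fixes M :: "'a::field mat"
  assumes "M \<in> carrier_mat n n" "det M = 0"
  obtains v where "v \<in> carrier_vec n" "v \<noteq> 0\<^sub>v n" "M *\<^sub>v v = 0\<^sub>v n"
  using assms det_0_iff_vec_prod_zero_field by blast

lemma nonsingular_mat_kernelD:
  fixes M :: "'a::field mat"
  assumes "M \<in> carrier_mat n n" "det M \<noteq> 0" "v \<in> carrier_vec n" "M *\<^sub>v v = 0\<^sub>v n"
  shows "v = 0\<^sub>v n"
  using assms det_0_iff_vec_prod_zero_field by blast

lemma nonsingular_mat_solveE:
  fixes M :: "'a::field mat"
  assumes M: "M \<in> carrier_mat n n" and "det M \<noteq> 0" and b: "b \<in> carrier_vec n"
  obtains v where "v \<in> carrier_vec n" "M *\<^sub>v v = b"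
proof -
  from assms obtain N where N: "N \<in> carrier_mat n n" "M * N = 1\<^sub>m n"
    using det_non_zero_imp_unit[OF M] by (auto simp: Units_def ring_mat_def)
  show ?thesis
    by (rule that[of "N *\<^sub>v b"]) (use N M b in \<open>auto simp: assoc_mult_mat_vec[symmetric]\<close>)
qed

lemma (in vec_space) rank_mult_le:
  assumes A: "A \<in> carrier_mat n k" and B: "B \<in> carrier_mat k m"
  shows "rank (A * B) \<le> rank A"
proof -
  have AB: "A * B \<in> carrier_mat n m" using A B by auto
  have "col_space (A * B) \<subseteq> col_space A"
    unfolding col_space_eq[OF A] col_space_eq[OF AB]
    using A B by (auto intro!: bexI[of _ "B *\<^sub>v _"])
  then have sub: "span (set (cols (A * B))) \<subseteq> span (set (cols A))"
    by (simp add: col_space_def)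
  have sA: "VectorSpace.subspace class_ring (span (set (cols A))) V"
    and sAB: "VectorSpace.subspace class_ring (span (set (cols (A * B)))) V"
    using A AB cols_dim span_is_subspace by (metis carrier_matD(1))+
  show ?thesis
    unfolding rank_def
    using vectorspace.subspace_dim[OF subspace_is_vs[OF sA] nested_subspaces[OF sA sAB sub]]
      fin_dim_span_cols[OF A] fin_dim_span_cols[OF AB] by auto
qed

text \<open>Rank-nullity for \<open>S\<close>, with the columns of \<open>Z\<close> as independent
  vectors in its kernel.\<close>

lemma (in vec_space) rank_plus_kernel_le:
  assumes S: "S \<in> carrier_mat n n" and Z: "Z \<in> carrier_mat n m" and SZ: "S * Z = 0\<^sub>m n m"
    and inj: "\<And>c. c \<in> carrier_vec m \<Longrightarrow> Z *\<^sub>v c = 0\<^sub>v n \<Longrightarrow> c = 0\<^sub>v m"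
  shows "rank S + m \<le> n"
proof -
  interpret K: kernel n n S by unfold_locales fact
  have "(\<lambda>v. S *\<^sub>v v) \<in> LinearCombinations.module_hom class_ring V V"
    using S by (auto simp: LinearCombinations.module_hom_def module_vec_simps class_ring_simps
        mult_add_distrib_mat_vec[of _ n n] mult_mat_vec[of _ n n])
  then interpret L: linear_map class_ring V V "\<lambda>v. S *\<^sub>v v"
    by (intro linear_map.intro mod_hom.intro mod_hom_axioms.intro vec_vs vec_module)
  have im: "L.im = span (set (cols S))"
    using S col_space_eq[OF S] by (auto simp: L.im_def col_space_def)
  have ker: "L.ker = mat_kernel S"
    using S by (auto simp: L.ker_def mat_kernel)
  have rn: "rank S + K.dim = n"
    using L.rank_nullity[OF fin_dim] by (simp add: im ker rank_def dim_is_n)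
  \<comment> \<open>Independence concerns the set of columns, whose cardinality is \<open>m\<close>
    only if no column repeats. Two equal columns would put a difference of unit vectors into the
    kernel of \<open>Z\<close>.\<close>
  have distinct: "distinct (cols Z)"
  proof (rule ccontr)
    assume "\<not> distinct (cols Z)"
    then obtain i j where ij: "i < m" "j < m" "i \<noteq> j" "col Z i = col Z j"
      using Z by (auto simp: distinct_conv_nth)
    have "Z *\<^sub>v (unit_vec m i - unit_vec m j) = 0\<^sub>v n"
    proof -
      have "Z *\<^sub>v unit_vec m l = col Z l" if "l < m" for l
        by (rule eq_vecI) (use that Z in \<open>auto simp: scalar_prod_right_unit\<close>)
      then show ?thesis
        using ij Z by (subst mult_minus_distrib_mat_vec[of _ n m]) auto
    qed
    from inj[OF _ this] have "unit_vec m i - unit_vec m j = (0\<^sub>v m :: 'a vec)" by auto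
    then have "(unit_vec m i - unit_vec m j :: 'a vec) $ i = 0\<^sub>v m $ i" by simp
    then show False using ij by simp
  qed
  have "lin_indpt (set (cols Z))"
    using lin_depE[OF Z _ distinct] inj by blast
  have sub: "set (cols Z) \<subseteq> mat_kernel S"
  proof
    fix x assume "x \<in> set (cols Z)"
    then obtain j where j: "j < m" "x = col Z j" using Z by (auto simp: cols_def)
    have "S *\<^sub>v x = col (S * Z) j" using j S Z by auto
    then show "x \<in> mat_kernel S" using j S Z SZ by (auto simp: mat_kernel)
  qed
  obtain bs where bs: "finite bs" "K.basis bs" using kernel_basis_exists[OF S] by blast
  then have fin: "K.Ker.fin_dim" unfolding K.Ker.fin_dim_def K.Ker.basis_def by blast
  from \<open>lin_indpt (set (cols Z))\<close> sub have "K.lin_indpt (set (cols Z))" using K.lindep_same by blast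
  then have "card (set (cols Z)) \<le> K.dim"
    using K.Ker.li_le_dim(2)[OF fin] sub by simp
  then show ?thesis using rn distinct_card[OF distinct] Z by simp
qed

section \<open>Kernel vectors of rank \<open>k\<close> updates over a field\<close>

locale field_null_frame = null_frame n k S X Y U0 W0
  for n k and S X Y U0 W0 :: "'a::field mat"
begin

text \<open>With \<open>U = U0\<close> the factor \<open>det (Y\<^sup>T * U)\<close> in
  \<open>det_rank_update\<close> is 1, so \<open>S + U0 * W\<^sup>T\<close> is nonsingular, while it
  annihilates every common kernel vector of \<open>S\<close> and \<open>W\<^sup>T\<close>.\<close>

lemma kernel_cap_trivial:
  assumes W: "W \<in> carrier_mat n k" and "det bordered \<noteq> 0" "det (W\<^sup>T * X) \<noteq> 0"
    and x: "x \<in> carrier_vec n" "S *\<^sub>v x = 0\<^sub>v n" "W\<^sup>T *\<^sub>v x = 0\<^sub>v k"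
  shows "x = 0\<^sub>v n"
proof (rule nonsingular_mat_kernelD)
  show "S + U0 * W\<^sup>T \<in> carrier_mat n n" using W by auto
  show "det (S + U0 * W\<^sup>T) \<noteq> 0" using det_rank_update[OF U0 W] assms by (simp add: YU0)
  have "(S + U0 * W\<^sup>T) *\<^sub>v x = S *\<^sub>v x + U0 * W\<^sup>T *\<^sub>v x"
    by (rule add_mult_distrib_mat_vec[of _ n n]) (use W x in auto)
  also have "U0 * W\<^sup>T *\<^sub>v x = U0 *\<^sub>v (W\<^sup>T *\<^sub>v x)"
    by (rule assoc_mult_mat_vec[of _ n k _ n]) (use W x in auto)
  finally show "(S + U0 * W\<^sup>T) *\<^sub>v x = 0\<^sub>v n" by (auto simp: x intro: eq_vecI)
qed fact

text \<open>A kernel vector \<open>c\<close> of \<open>W\<^sup>T * X\<close> gives the vector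
  \<open>X *\<^sub>v c\<close>, which is nonzero because \<open>W0\<^sup>T\<close> recovers
  \<open>c\<close> from it. Every update through \<open>W\<^sup>T\<close> leaves it in the
  kernel.\<close>

lemma constant_eigenvectorE:
  assumes W: "W \<in> carrier_mat n k" and "det (W\<^sup>T * X) = 0"
  obtains x where "x \<in> carrier_vec n" "x \<noteq> 0\<^sub>v n" "S *\<^sub>v x = 0\<^sub>v n" "W\<^sup>T *\<^sub>v x = 0\<^sub>v k"
proof -
  obtain c where c: "c \<in> carrier_vec k" "c \<noteq> 0\<^sub>v k" "W\<^sup>T * X *\<^sub>v c = 0\<^sub>v k"
    by (rule singular_mat_kernelE[of "W\<^sup>T * X" k]) (use assms in auto)
  have "W0\<^sup>T *\<^sub>v (X *\<^sub>v c) = c"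
    by (subst assoc_mult_mat_vec[symmetric, of _ k n _ k]) (use c in \<open>auto simp: WX0\<close>)
  moreover have "W0\<^sup>T *\<^sub>v 0\<^sub>v n = 0\<^sub>v k" using W0 by auto
  ultimately have "X *\<^sub>v c \<noteq> 0\<^sub>v n" using c by metis
  moreover have "S *\<^sub>v (X *\<^sub>v c) = 0\<^sub>v n"
    by (subst assoc_mult_mat_vec[symmetric, of _ n n _ k]) (use c in \<open>auto simp: SX\<close>)
  moreover have "W\<^sup>T *\<^sub>v (X *\<^sub>v c) = 0\<^sub>v k"
    by (subst assoc_mult_mat_vec[symmetric, of _ k n _ k]) (use c W in auto)
  moreover have "X *\<^sub>v c \<in> carrier_vec n" using c by auto
  ultimately show ?thesis using that by blast
qed

text \<open>A kernel vector \<open>v\<close> of \<open>bordered\<close> satisfies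
  \<open>W0\<^sup>T *\<^sub>v v = 0\<^sub>v k\<close> by \<open>YB\<close>, hence is killed by
  \<open>S\<close>. Since \<open>W0\<^sup>T\<close> inverts \<open>X\<close> from the left,
  \<open>v\<close> is independent of the columns of \<open>X\<close>, and the rank drops below
  \<open>n - k\<close>. Conversely, the border has rank at most \<open>k\<close>, so an invertible
  \<open>bordered\<close> leaves \<open>S\<close> with rank at least \<open>n - k\<close>.\<close>

lemma rank_ge_iff:
  assumes "k \<le> n"
  shows "n - k \<le> vec_space.rank n S \<longleftrightarrow> det bordered \<noteq> 0"
proof
  assume "det bordered \<noteq> 0"
  then have "n = vec_space.rank n bordered"
    using vec_space.det_rank_iff[OF bordered_carrier] by simp
  also have "\<dots> \<le> vec_space.rank n S + vec_space.rank n (U0 * W0\<^sup>T)"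
    unfolding bordered_def by (rule vec_space.rank_subadditive[of _ n n]) auto
  also have "vec_space.rank n (U0 * W0\<^sup>T) \<le> vec_space.rank n U0"
    by (rule vec_space.rank_mult_le[of _ n k _ n]) auto
  also have "vec_space.rank n U0 \<le> k"
    by (rule vec_space.rank_le_nc) auto
  finally show "n - k \<le> vec_space.rank n S" by simp
next
  assume rank: "n - k \<le> vec_space.rank n S"
  show "det bordered \<noteq> 0"
  proof
    assume "det bordered = 0"
    then obtain v where v: "v \<in> carrier_vec n" "v \<noteq> 0\<^sub>v n" "bordered *\<^sub>v v = 0\<^sub>v n"
      using singular_mat_kernelE[OF bordered_carrier] by blast
    have Wv: "W0\<^sup>T *\<^sub>v v = 0\<^sub>v k"
      unfolding YB[symmetric]
      by (subst assoc_mult_mat_vec[of _ k n _ n]) (use v in \<open>auto intro: eq_vecI\<close>)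
    have "bordered *\<^sub>v v = S *\<^sub>v v + U0 *\<^sub>v (W0\<^sup>T *\<^sub>v v)"
      unfolding bordered_def
      by (subst add_mult_distrib_mat_vec[of _ n n]) (use v in \<open>auto simp: assoc_mult_mat_vec[of _ n k _ n]\<close>)
    also have "U0 *\<^sub>v (W0\<^sup>T *\<^sub>v v) = 0\<^sub>v n" unfolding Wv using U0 by (auto intro: eq_vecI)
    finally have Sv: "S *\<^sub>v v = 0\<^sub>v n" using v by simp
    define Z where "Z = mat n (k + 1) (\<lambda>(i, j). if j < k then X $$ (i, j) else v $ i)"
    have Z: "Z \<in> carrier_mat n (k + 1)" by (simp add: Z_def)
    have colZ: "col Z j = (if j < k then col X j else v)" if "j < k + 1" for j
      using that v by (auto simp: Z_def intro!: eq_vecI)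
    have SZ: "S * Z = 0\<^sub>m n (k + 1)"
    proof (rule eq_matI)
      fix i j assume ij: "i < dim_row (0\<^sub>m n (k + 1) :: 'a mat)" "j < dim_col (0\<^sub>m n (k + 1) :: 'a mat)"
      have "(S * Z) $$ (i, j) = (S *\<^sub>v col Z j) $ i" using ij Z by simp
      also have "S *\<^sub>v col Z j = 0\<^sub>v n"
        using ij Sv col_mult2[OF S X, of j] by (auto simp: colZ SX)
      finally show "(S * Z) $$ (i, j) = 0\<^sub>m n (k + 1) $$ (i, j)" using ij by simp
    qed (use Z in auto)
    have "vec_space.rank n S + (k + 1) \<le> n"
    proof (rule vec_space.rank_plus_kernel_le[OF S Z SZ])
      fix c assume c: "c \<in> carrier_vec (k + 1)" and Zc: "Z *\<^sub>v c = 0\<^sub>v n"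
      define c' where "c' = vec k (\<lambda>i. c $ i)"
      have c': "c' \<in> carrier_vec k" by (simp add: c'_def)
      have "Z *\<^sub>v c = X *\<^sub>v c' + c $ k \<cdot>\<^sub>v v"
        by (rule eq_vecI) (use c v Z in \<open>auto simp: Z_def c'_def scalar_prod_def mult.commute\<close>)
      then have eq: "X *\<^sub>v c' + c $ k \<cdot>\<^sub>v v = 0\<^sub>v n" using Zc by simp
      have "W0\<^sup>T *\<^sub>v (X *\<^sub>v c' + c $ k \<cdot>\<^sub>v v) = W0\<^sup>T *\<^sub>v (X *\<^sub>v c') + W0\<^sup>T *\<^sub>v (c $ k \<cdot>\<^sub>v v)"
        by (rule mult_add_distrib_mat_vec[of _ k n]) (use c' v in auto)
      also have "W0\<^sup>T *\<^sub>v (c $ k \<cdot>\<^sub>v v) = c $ k \<cdot>\<^sub>v (W0\<^sup>T *\<^sub>v v)"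
        by (rule mult_mat_vec[of _ k n]) (use v in auto)
      also have "W0\<^sup>T *\<^sub>v (X *\<^sub>v c') = c'"
        by (subst assoc_mult_mat_vec[symmetric, of _ k n _ k]) (use c' in \<open>auto simp: WX0\<close>)
      also have "W0\<^sup>T *\<^sub>v (X *\<^sub>v c' + c $ k \<cdot>\<^sub>v v) = 0\<^sub>v k"
        unfolding eq by (auto intro: eq_vecI)
      finally have c'0: "c' = 0\<^sub>v k" using c' by (simp add: Wv smult_zero_vec)
      have "X *\<^sub>v 0\<^sub>v k = 0\<^sub>v n" by (rule eq_vecI) auto
      then have "c $ k \<cdot>\<^sub>v v = 0\<^sub>v n" using eq v by (simp add: c'0)
      moreover obtain i where "i < n" "v $ i \<noteq> 0" using v by (auto simp: vec_eq_iff)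
      ultimately have "c $ k = 0" using v by (auto simp: vec_eq_iff)
      moreover have "c $ i = 0" if "i < k" for i
        using arg_cong[OF c'0, of "\<lambda>u. u $ i"] that by (simp add: c'_def)
      ultimately show "c = 0\<^sub>v (k + 1)" using c by (auto simp: less_Suc_eq vec_eq_iff)
    qed
    then show False using rank assms by linarith
  qed
qed

lemma perturbed_mult_vec:
  assumes "E \<in> carrier_mat n k" "W \<in> carrier_mat n k" "x \<in> carrier_vec n"
  shows "(S + \<tau> \<cdot>\<^sub>m (E * W\<^sup>T)) *\<^sub>v x = S *\<^sub>v x + \<tau> \<cdot>\<^sub>v (E *\<^sub>v (W\<^sup>T *\<^sub>v x))"
proof -
  have "(S + \<tau> \<cdot>\<^sub>m (E * W\<^sup>T)) *\<^sub>v x = S *\<^sub>v x + (\<tau> \<cdot>\<^sub>m (E * W\<^sup>T)) *\<^sub>v x"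
    by (rule add_mult_distrib_mat_vec[of _ n n]) (use assms in auto)
  also have "(\<tau> \<cdot>\<^sub>m (E * W\<^sup>T)) *\<^sub>v x = \<tau> \<cdot>\<^sub>v (E * W\<^sup>T *\<^sub>v x)"
    by (rule smult_mat_mult_vec) (use assms in auto)
  also have "E * W\<^sup>T *\<^sub>v x = E *\<^sub>v (W\<^sup>T *\<^sub>v x)"
    by (rule assoc_mult_mat_vec[of _ n k _ n]) (use assms in auto)
  finally show ?thesis .
qed

text \<open>An eigenvector \<open>x1\<close> for \<open>\<tau> = 1\<close> is split as \<open>x1 = w + z\<close> with \<open>w\<close> in the range of \<open>X\<close> and
  \<open>W\<^sup>T z = 0\<close>; then \<open>w + \<tau> z\<close> is an eigenvector for every \<open>\<tau>\<close>.\<close>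

lemma linear_eigenvectorE:
  assumes E: "E \<in> carrier_mat n k" and W: "W \<in> carrier_mat n k"
    and nz: "det bordered \<noteq> 0" "det (W\<^sup>T * X) \<noteq> 0" and "det (Y\<^sup>T * E) = 0"
  obtains w z where "w \<in> carrier_vec n" "z \<in> carrier_vec n"
    "\<And>\<tau>. (S + \<tau> \<cdot>\<^sub>m (E * W\<^sup>T)) *\<^sub>v (w + \<tau> \<cdot>\<^sub>v z) = 0\<^sub>v n"
    "\<And>\<tau>. W\<^sup>T *\<^sub>v (w + \<tau> \<cdot>\<^sub>v z) \<noteq> 0\<^sub>v k"
proof -
  have "det (S + E * W\<^sup>T) = 0" using det_rank_update[OF E W] assms by simp
  then obtain x1 where x1: "x1 \<in> carrier_vec n" "x1 \<noteq> 0\<^sub>v n" "(S + E * W\<^sup>T) *\<^sub>v x1 = 0\<^sub>v n"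
    using singular_mat_kernelE[of "S + E * W\<^sup>T" n] E W by auto
  obtain c where c: "c \<in> carrier_vec k" "W\<^sup>T * X *\<^sub>v c = W\<^sup>T *\<^sub>v x1"
    by (rule nonsingular_mat_solveE[of "W\<^sup>T * X" k "W\<^sup>T *\<^sub>v x1"]) (use nz W x1 in auto)
  define w where "w = X *\<^sub>v c"
  define z where "z = x1 - w"
  have w: "w \<in> carrier_vec n" using c by (auto simp: w_def)
  have z: "z \<in> carrier_vec n" using w x1 by (auto simp: z_def)
  have Sw: "S *\<^sub>v w = 0\<^sub>v n"
    unfolding w_def by (subst assoc_mult_mat_vec[symmetric, of _ n n _ k]) (use c in \<open>auto simp: SX\<close>)
  have Ww: "W\<^sup>T *\<^sub>v w = W\<^sup>T *\<^sub>v x1"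
    unfolding w_def by (subst assoc_mult_mat_vec[symmetric, of _ k n _ k]) (use c W in auto)
  have Wz: "W\<^sup>T *\<^sub>v z = 0\<^sub>v k"
    unfolding z_def by (subst mult_minus_distrib_mat_vec[of _ k n]) (use W w x1 Ww in auto)
  have Sz: "S *\<^sub>v z = S *\<^sub>v x1"
    unfolding z_def by (subst mult_minus_distrib_mat_vec[of _ n n]) (use w x1 Sw in \<open>auto simp: minus_zero_vec\<close>)
  have lin: "M *\<^sub>v (w + \<tau> \<cdot>\<^sub>v z) = M *\<^sub>v w + \<tau> \<cdot>\<^sub>v (M *\<^sub>v z)" if "M \<in> carrier_mat m n" for M m \<tau>
    using that w z by (subst mult_add_distrib_mat_vec[of _ m n]) (auto simp: mult_mat_vec)
  \<comment> \<open>\<open>W\<^sup>T\<close> does not see \<open>z\<close> and \<open>S\<close> does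
    not see \<open>w\<close>. Hence the updated matrix sends
    \<open>w + \<tau> \<cdot>\<^sub>v z\<close> to \<tau> times the image of \<open>x1\<close> at
    \<tau> = 1, which is zero.\<close>
  have e: "W\<^sup>T *\<^sub>v (w + \<tau> \<cdot>\<^sub>v z) = W\<^sup>T *\<^sub>v x1" for \<tau>
    by (subst lin[of _ k]) (use W x1 in \<open>auto simp: Wz Ww\<close>)
  have "1 \<cdot>\<^sub>m (E * W\<^sup>T) = E * W\<^sup>T" by (auto intro: eq_matI)
  then have "S *\<^sub>v x1 + E *\<^sub>v (W\<^sup>T *\<^sub>v x1) = 0\<^sub>v n"
    using perturbed_mult_vec[OF E W x1(1), of 1] x1(3) by simp
  then have "(S + \<tau> \<cdot>\<^sub>m (E * W\<^sup>T)) *\<^sub>v (w + \<tau> \<cdot>\<^sub>v z) = \<tau> \<cdot>\<^sub>v 0\<^sub>v n" for \<tau>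
    by (subst perturbed_mult_vec) (use E W w z x1 in
      \<open>auto simp: e lin[of _ n] Sw Sz smult_add_distrib_vec[symmetric, of _ n]\<close>)
  \<comment> \<open>Otherwise \<open>x1\<close> would lie in the kernels of both \<open>S\<close>
    and \<open>W\<^sup>T\<close>.\<close>
  moreover have "W\<^sup>T *\<^sub>v x1 \<noteq> 0\<^sub>v k"
  proof
    assume W0: "W\<^sup>T *\<^sub>v x1 = 0\<^sub>v k"
    have "E *\<^sub>v 0\<^sub>v k = 0\<^sub>v n" using E by (auto intro: eq_vecI)
    then have "S *\<^sub>v x1 = 0\<^sub>v n"
      using \<open>S *\<^sub>v x1 + E *\<^sub>v (W\<^sup>T *\<^sub>v x1) = 0\<^sub>v n\<close> x1 by (auto simp: W0 mult_mat_vec_carrier[OF S])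
    then show False using kernel_cap_trivial[OF W nz] W0 x1 by blast
  qed
  ultimately show ?thesis using that[OF w z] by (simp add: e smult_zero_vec)
qed

text \<open>Multiplying by \<open>Y\<^sup>T\<close> removes \<open>S\<close> and leaves a
  nonsingular matrix applied to the perturbation part, so both summands vanish separately. The
  resulting conditions are free of \<tau>.\<close>

lemma perturbed_kernel_iff:
  assumes U: "U \<in> carrier_mat n k" and D: "D \<in> carrier_mat k k" and W: "W \<in> carrier_mat n k"
    and nz: "det (Y\<^sup>T * U) \<noteq> 0" "\<tau> \<noteq> 0" and x: "x \<in> carrier_vec n"
  shows "(S + \<tau> \<cdot>\<^sub>m (U * D * W\<^sup>T)) *\<^sub>v x = 0\<^sub>v n \<longleftrightarrow>
    S *\<^sub>v x = 0\<^sub>v n \<and> D *\<^sub>v (W\<^sup>T *\<^sub>v x) = 0\<^sub>v k"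
proof -
  define y where "y = D *\<^sub>v (W\<^sup>T *\<^sub>v x)"
  have y: "y \<in> carrier_vec k" using D W x by (auto simp: y_def)
  have "(S + \<tau> \<cdot>\<^sub>m (U * D * W\<^sup>T)) *\<^sub>v x = S *\<^sub>v x + \<tau> \<cdot>\<^sub>v (U * D *\<^sub>v (W\<^sup>T *\<^sub>v x))"
    by (rule perturbed_mult_vec) (use assms in auto)
  also have "U * D *\<^sub>v (W\<^sup>T *\<^sub>v x) = U *\<^sub>v y"
    unfolding y_def by (rule assoc_mult_mat_vec[of _ n k _ k]) (use assms in auto)
  finally have eq: "(S + \<tau> \<cdot>\<^sub>m (U * D * W\<^sup>T)) *\<^sub>v x = S *\<^sub>v x + \<tau> \<cdot>\<^sub>v (U *\<^sub>v y)" .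
  have U0: "U *\<^sub>v 0\<^sub>v k = 0\<^sub>v n" using U by (auto intro: eq_vecI)
  have "S *\<^sub>v x = 0\<^sub>v n \<and> y = 0\<^sub>v k" if "S *\<^sub>v x + \<tau> \<cdot>\<^sub>v (U *\<^sub>v y) = 0\<^sub>v n"
  proof -
    have "Y\<^sup>T *\<^sub>v (S *\<^sub>v x + \<tau> \<cdot>\<^sub>v (U *\<^sub>v y)) = Y\<^sup>T *\<^sub>v (S *\<^sub>v x) + Y\<^sup>T *\<^sub>v (\<tau> \<cdot>\<^sub>v (U *\<^sub>v y))"
      by (rule mult_add_distrib_mat_vec[of _ k n]) (use U y x in auto)
    also have "Y\<^sup>T *\<^sub>v (S *\<^sub>v x) = 0\<^sub>v k"
      by (subst assoc_mult_mat_vec[symmetric, of _ k n _ n]) (use x in \<open>auto simp: YS\<close>)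
    also have "Y\<^sup>T *\<^sub>v (\<tau> \<cdot>\<^sub>v (U *\<^sub>v y)) = \<tau> \<cdot>\<^sub>v (Y\<^sup>T *\<^sub>v (U *\<^sub>v y))"
      by (rule mult_mat_vec[of _ k n]) (use U y in auto)
    also have "Y\<^sup>T *\<^sub>v (U *\<^sub>v y) = Y\<^sup>T * U *\<^sub>v y"
      by (rule assoc_mult_mat_vec[symmetric, of _ k n _ k]) (use U y in auto)
    also have "Y\<^sup>T *\<^sub>v (S *\<^sub>v x + \<tau> \<cdot>\<^sub>v (U *\<^sub>v y)) = 0\<^sub>v k"
      unfolding that by (auto intro: eq_vecI)
    finally have "\<tau> \<cdot>\<^sub>v (Y\<^sup>T * U *\<^sub>v y) = 0\<^sub>v k"
      using U y by (metis left_zero_vec smult_carrier_vec mult_mat_vec_carrier mult_carrier_mat transpose_carrier_mat Y)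
    then have "Y\<^sup>T * U *\<^sub>v y = 0\<^sub>v k"
      using nz(2) U y by (auto simp: vec_eq_iff)
    then have "y = 0\<^sub>v k"
      using nonsingular_mat_kernelD[OF mult_carrier_mat[OF _ U] nz(1) y] by simp
    then show ?thesis using that x U0 by (auto simp: smult_zero_vec)
  qed
  moreover have "S *\<^sub>v x + \<tau> \<cdot>\<^sub>v (U *\<^sub>v y) = 0\<^sub>v n" if "S *\<^sub>v x = 0\<^sub>v n" "y = 0\<^sub>v k"
    using that by (simp add: U0 smult_zero_vec)
  ultimately show ?thesis unfolding eq y_def[symmetric] by blast
qed

end

section \<open>Null chains from the Kronecker form\<close>

text \<open>Only the columns of one block are described, over all rows, because null chains are read
  off from whole columns. A block without rows, such as \<open>L_block 0\<close>, yields a zero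
  column.\<close>

lemma diag_block_mat_index:
  assumes "i < length Cs" "b < dim_col (Cs ! i)" "a < sum_list (map dim_row Cs)"
  shows "diag_block_mat Cs $$ (a, sum_list (map dim_col (take i Cs)) + b) =
    (let r = sum_list (map dim_row (take i Cs)) in
     if r \<le> a \<and> a < r + dim_row (Cs ! i) then Cs ! i $$ (a - r, b) else 0)"
  using assms
proof (induction Cs arbitrary: i a)
  case (Cons C Cs)
  have dims: "dim_row (diag_block_mat Cs) = sum_list (map dim_row Cs)"
    "dim_col (diag_block_mat Cs) = sum_list (map dim_col Cs)"
    by (rule dim_diag_block_mat)+
  show ?case
  proof (cases i)
    case 0
    then show ?thesis using Cons.prems by (auto simp: Let_def dims)
  next
    case (Suc l)
    have le: "sum_list (map f (take l Cs)) + f (Cs ! l) \<le> sum_list (map f Cs)" for f :: "'a mat \<Rightarrow> nat"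
    proof -
      have "sum_list (map f Cs) = sum_list (map f (take l Cs @ Cs ! l # drop (Suc l) Cs))"
        using Cons.prems Suc by (simp add: id_take_nth_drop[symmetric])
      then show ?thesis by simp
    qed
    show ?thesis
    proof (cases "a < dim_row C")
      case True
      then show ?thesis using Cons.prems Suc le[of dim_col] by (auto simp: Let_def dims)
    next
      case False
      have IH: "diag_block_mat Cs $$ (a - dim_row C, sum_list (map dim_col (take l Cs)) + b) =
        (let r = sum_list (map dim_row (take l Cs)) in
        if r \<le> a - dim_row C \<and> a - dim_row C < r + dim_row (Cs ! l)
        then Cs ! l $$ (a - dim_row C - r, b) else 0)"
        using Cons.prems Suc False by (intro Cons.IH) auto
      have "a - dim_row C - r = a - (dim_row C + r)" for r by simp
      then show ?thesis using Cons.prems Suc le[of dim_col] False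
        by (auto simp: Let_def dims IH)
    qed
  qed
qed simp

lemma transpose_diag_block_mat:
  "(diag_block_mat Cs)\<^sup>T = diag_block_mat (map transpose_mat Cs)"
proof (induction Cs)
  case (Cons C Cs)
  have "(four_block_mat C (0\<^sub>m (dim_row C) (dim_col D)) (0\<^sub>m (dim_row D) (dim_col C)) D)\<^sup>T
    = four_block_mat C\<^sup>T (0\<^sub>m (dim_col C) (dim_row D)) (0\<^sub>m (dim_col D) (dim_row C)) D\<^sup>T" for D
    by (subst transpose_four_block_mat[of _ "dim_row C" "dim_col C" _ "dim_col D" _ "dim_row D"]) auto
  then show ?case by (simp add: Let_def Cons.IH[symmetric])
qed (auto intro: eq_matI)

text \<open>For every \<open>j < k\<close> the vectors \<open>f j r\<close>, \<open>r \<le> d j\<close>, are the coefficients of a vector polynomial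
  in the kernel of \<open>A - \<lambda> B\<close>; the family \<open>g\<close> is dual to \<open>f\<close>.\<close>

definition null_chains :: "nat \<Rightarrow> nat \<Rightarrow> complex mat \<Rightarrow> complex mat \<Rightarrow> (nat \<Rightarrow> nat)
    \<Rightarrow> (nat \<Rightarrow> nat \<Rightarrow> complex vec) \<Rightarrow> (nat \<Rightarrow> nat \<Rightarrow> complex vec) \<Rightarrow> bool" where
  "null_chains n k A B d f g \<longleftrightarrow>
    (\<forall>j<k. \<forall>r\<le>d j. f j r \<in> carrier_vec n \<and> g j r \<in> carrier_vec n) \<and>
    (\<forall>j<k. A *\<^sub>v f j 0 = 0\<^sub>v n \<and> B *\<^sub>v f j (d j) = 0\<^sub>v n \<and>
      (\<forall>r<d j. A *\<^sub>v f j (Suc r) = B *\<^sub>v f j r)) \<and>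
    (\<forall>i<k. \<forall>j<k. \<forall>q\<le>d i. \<forall>r\<le>d j. g i q \<bullet> f j r = (if i = j \<and> q = r then 1 else 0))"

text \<open>The block \<open>L_block j \<lambda>\<close> kills the vector of powers of \<lambda>
  from 0 to \<open>j\<close>. So the columns of \<open>Q\<close> that belong to the block are the
  coefficients of a kernel polynomial, and the matching rows of the inverse of \<open>Q\<close> are
  the dual family. The other blocks stay abstract, so that the lemma also covers the transposed
  form.\<close>

lemma null_chains_of_L_blocks:
  assumes A: "A \<in> carrier_mat n n" and B: "B \<in> carrier_mat n n"
    and P: "P \<in> carrier_mat n n" "P' \<in> carrier_mat n n" "P' * P = 1\<^sub>m n"
    and Q: "Q \<in> carrier_mat n n" "Q' \<in> carrier_mat n n" "Q' * Q = 1\<^sub>m n"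
    and eq: "\<And>\<zeta>. P * (A - \<zeta> \<cdot>\<^sub>m B) * Q = diag_block_mat (Cs \<zeta>)"
    and len: "\<And>\<zeta>. length (Cs \<zeta>) = len" "off + k \<le> len"
    and dims: "\<And>\<zeta> i. i < len \<Longrightarrow> dim_row (Cs \<zeta> ! i) = dr i \<and> dim_col (Cs \<zeta> ! i) = dc i"
    and L: "\<And>\<zeta> j. j < k \<Longrightarrow> Cs \<zeta> ! (off + j) = L_block (d j) \<zeta>"
  shows "\<exists>f g. null_chains n k A B d f g"
proof -
  define K where "K = (\<lambda>\<zeta>. diag_block_mat (Cs \<zeta>))"
  define r where "r = (\<lambda>i. sum_list (map dr [0..<i]))"
  define c where "c = (\<lambda>i. sum_list (map dc [0..<i]))"
  have take: "map dim_row (take i (Cs \<zeta>)) = map dr [0..<i]" "map dim_col (take i (Cs \<zeta>)) = map dc [0..<i]"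
    if "i \<le> len" for i \<zeta>
    using that dims by (auto intro!: nth_equalityI simp: len)
  have K: "K \<zeta> \<in> carrier_mat n n" for \<zeta>
    unfolding K_def eq[symmetric] using A B P Q by auto
  have KD: "dim_row (K \<zeta>) = n" "dim_col (K \<zeta>) = n" for \<zeta> using K[of \<zeta>] by auto
  have rlen: "r len = n" and clen: "c len = n"
    using K[of 0] dim_diag_block_mat[of "Cs 0"] take[of len 0]
    by (auto simp: K_def r_def c_def len)
  have dcj: "dc (off + j) = d j + 1" "dr (off + j) = d j" if "j < k" for j
    using dims[of "off + j" 0] L[OF that, of 0] that len(2) by (auto simp: L_block_def)
  have cmono: "c i \<le> c j" if "i \<le> j" for i j
  proof -
    have "[0..<j] = [0..<i] @ [i..<j]" using that upt_add_eq_append[of 0 i "j - i"] by simp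
    then show ?thesis by (simp add: c_def)
  qed
  have cSuc: "c (Suc i) = c i + dc i" for i by (simp add: c_def)
  have cj: "c (off + j) + b < n" if "j < k" "b \<le> d j" for j b
  proof -
    have "c (off + j) + b < c (Suc (off + j))" using that by (simp add: cSuc dcj)
    also have "\<dots> \<le> c len" by (rule cmono) (use that len in auto)
    finally show ?thesis by (simp add: clen)
  qed
  \<comment> \<open>Distinct pairs of block and position are distinct columns of \<open>Q\<close>;
    the duality of \<open>g\<close> and \<open>f\<close> rests on this.\<close>
  have inj: "c (off + i) + a = c (off + j) + b \<longleftrightarrow> i = j \<and> a = b"
    if "i < k" "j < k" "a \<le> d i" "b \<le> d j" for i j a b
  proof -
    have "c (off + i) + a < c (off + j) + b" if "i < j" "j < k" "a \<le> d i" for i j a b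
    proof -
      have "c (off + i) + a < c (Suc (off + i))" using that by (simp add: cSuc dcj)
      also have "\<dots> \<le> c (off + j)" by (rule cmono) (use that in auto)
      finally show ?thesis by simp
    qed
    from this[of i j a b] this[of j i b a] that show ?thesis
      by (metis add_left_cancel less_irrefl linorder_neqE_nat)
  qed
  have idx: "K \<zeta> $$ (a, c (off + j) + b) =
    (if r (off + j) \<le> a \<and> a < r (off + j) + d j
     then L_block (d j) \<zeta> $$ (a - r (off + j), b) else 0)"
    if "j < k" "b \<le> d j" "a < n" for a b j \<zeta>
  proof -
    have n: "sum_list (map dim_row (Cs \<zeta>)) = n"
      using K[of \<zeta>] dim_diag_block_mat(1)[of "Cs \<zeta>"] by (auto simp: K_def)
    have "off + j < len" using that len by simp
    then show ?thesis
      using diag_block_mat_index[of "off + j" "Cs \<zeta>" b a] that n dims[of "off + j" \<zeta>] dcj[OF that(1)]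
      unfolding K_def L[OF that(1)] by (simp add: take r_def c_def Let_def len L)
  qed
  have KL: "K \<zeta> $$ (a, c (off + j) + b) =
    (if r (off + j) \<le> a \<and> a < r (off + j) + d j
     then (if b = a - r (off + j) + 1 then 1 else 0) - \<zeta> * (if b = a - r (off + j) then 1 else 0) else 0)"
    if "j < k" "b \<le> d j" "a < n" for a b j \<zeta>
    using idx[OF that, of \<zeta>] that by (auto simp: L_block_def)
  \<comment> \<open>The pencil equation is known pointwise; its values at 0 and 1 recover both
    coefficient matrices.\<close>
  have PAQ: "P * A * Q = K 0"
  proof -
    have "A - 0 \<cdot>\<^sub>m B = A" by (rule eq_matI) (use A B in auto)
    then show ?thesis using eq[of 0] by (simp add: K_def)
  qed
  have PBQ: "P * B * Q = K 0 - K 1"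
  proof -
    have 1: "1 \<cdot>\<^sub>m B = B" by (rule eq_matI) (use B in auto)
    have "K 1 = P * (A - B) * Q" using eq[of 1] by (simp add: K_def 1)
    also have "\<dots> = P * A * Q - P * B * Q"
      using A B P Q by (simp add: mult_minus_distrib_mat[of _ n n] minus_mult_distrib_mat[of _ n n])
    finally show ?thesis unfolding PAQ using K P B Q
      by (intro eq_matI) auto
  qed
  have image: "M *\<^sub>v col Q l = P' *\<^sub>v col (P * M * Q) l" if "M \<in> carrier_mat n n" "l < n" for M l
  proof -
    have "P' *\<^sub>v col (P * M * Q) l = P' *\<^sub>v (P *\<^sub>v (M *\<^sub>v col Q l))"
      using that P Q by (subst col_mult2[of _ n n _ n]) (auto simp: assoc_mult_mat_vec[of _ n n _ n])
    also have "\<dots> = (P' * P) *\<^sub>v (M *\<^sub>v col Q l)"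
      by (rule assoc_mult_mat_vec[symmetric, of _ n n _ n]) (use that P Q in auto)
    also have "\<dots> = M *\<^sub>v col Q l" unfolding P using that Q
      by (intro one_mult_mat_vec) (auto intro!: mult_mat_vec_carrier)
    finally show ?thesis by simp
  qed
  define f where "f = (\<lambda>j b. col Q (c (off + j) + b))"
  define g where "g = (\<lambda>j b. row Q' (c (off + j) + b))"
  have P0: "P' *\<^sub>v 0\<^sub>v n = 0\<^sub>v n" using P by (intro eq_vecI) auto
  have "A *\<^sub>v f j 0 = 0\<^sub>v n" if "j < k" for j
  proof -
    have "col (K 0) (c (off + j) + 0) = 0\<^sub>v n"
      by (rule eq_vecI) (use K[of 0] that cj[OF that, of 0] KL[OF that, of 0 _ 0] in auto)
    then show ?thesis using image[OF A cj[OF that, of 0]] P0 by (simp add: f_def PAQ)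
  qed
  moreover have "B *\<^sub>v f j (d j) = 0\<^sub>v n" if "j < k" for j
  proof -
    have "col (K 0 - K 1) (c (off + j) + d j) = 0\<^sub>v n"
      by (rule eq_vecI) (use KD that cj[OF that, of "d j"] KL[OF that, of "d j"] in auto)
    then show ?thesis using image[OF B cj[OF that, of "d j"]] P0 by (simp add: f_def PBQ)
  qed
  moreover have "A *\<^sub>v f j (Suc b) = B *\<^sub>v f j b" if "j < k" "b < d j" for j b
  proof -
    have "col (K 0) (c (off + j) + Suc b) = col (K 0 - K 1) (c (off + j) + b)"
      by (rule eq_vecI) (use KD that cj[OF that(1), of "Suc b"] cj[OF that(1), of b]
          KL[OF that(1), of "Suc b"] KL[OF that(1), of b] in \<open>auto simp del: add_Suc_right\<close>)
    then show ?thesis using image[OF A cj[OF that(1), of "Suc b"]] image[OF B cj[OF that(1), of b]] that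
      by (simp add: f_def PAQ PBQ)
  qed
  moreover have "g i a \<bullet> f j b = (if i = j \<and> a = b then 1 else 0)"
    if "i < k" "j < k" "a \<le> d i" "b \<le> d j" for i j a b
  proof -
    have ij: "c (off + i) + a < n" "c (off + j) + b < n" using cj that by auto
    then have "g i a \<bullet> f j b = (Q' * Q) $$ (c (off + i) + a, c (off + j) + b)"
      using Q(1,2) by (simp add: f_def g_def)
    also have "\<dots> = 1\<^sub>m n $$ (c (off + i) + a, c (off + j) + b)" unfolding Q(3) ..
    also have "\<dots> = (if i = j \<and> a = b then 1 else 0)" using ij inj[OF that] by simp
    finally show ?thesis .
  qed
  moreover have "f j b \<in> carrier_vec n" "g j b \<in> carrier_vec n" for j b
    using Q by (auto simp: f_def g_def intro!: carrier_vecI)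
  ultimately have "null_chains n k A B d f g"
    unfolding null_chains_def by blast
  then show ?thesis by blast
qed

text \<open>Transposition turns the transposed L blocks into L blocks and exchanges the roles of
  \<open>P\<close> and \<open>Q\<close>, so left minimal indices become right ones of the transposed
  pencil.\<close>

lemma has_minimal_indices_imp_null_chains:
  assumes A: "A \<in> carrier_mat n n" and B: "B \<in> carrier_mat n n"
    and "has_minimal_indices n A B ns ms"
  shows "\<exists>f g. null_chains n (length ms) A B ((!) ms) f g"
    and "\<exists>f g. null_chains n (length ns) A\<^sup>T B\<^sup>T ((!) ns) f g"
proof -
  from assms(3) obtain P Q J N0 where P: "P \<in> carrier_mat n n" "invertible_mat P"
    and Q: "Q \<in> carrier_mat n n" "invertible_mat Q"
    and jordan: "in_jordan_form J" "in_jordan_form N0"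
    and eq: "\<And>\<zeta>. P * (A - \<zeta> \<cdot>\<^sub>m B) * Q =
           diag_block_mat
             ([J - \<zeta> \<cdot>\<^sub>m 1\<^sub>m (dim_row J), 1\<^sub>m (dim_row N0) - \<zeta> \<cdot>\<^sub>m N0]
              @ map (\<lambda>j. L_block j \<zeta>) ms
              @ map (\<lambda>j. transpose_mat (L_block j \<zeta>)) ns)"
    unfolding has_minimal_indices_def by blast
  obtain P' where P': "P' \<in> carrier_mat n n" "P' * P = 1\<^sub>m n" "P * P' = 1\<^sub>m n"
    using P by (auto simp: invertible_mat_def inverts_mat_def)
      (metis carrier_matD carrier_matI index_mult_mat(2,3) index_one_mat(2,3))
  obtain Q' where Q': "Q' \<in> carrier_mat n n" "Q' * Q = 1\<^sub>m n" "Q * Q' = 1\<^sub>m n"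
    using Q by (auto simp: invertible_mat_def inverts_mat_def)
      (metis carrier_matD carrier_matI index_mult_mat(2,3) index_one_mat(2,3))
  define Cs where "Cs = (\<lambda>\<zeta>. [J - \<zeta> \<cdot>\<^sub>m 1\<^sub>m (dim_row J), 1\<^sub>m (dim_row N0) - \<zeta> \<cdot>\<^sub>m N0]
              @ map (\<lambda>j. L_block j \<zeta>) ms @ map (\<lambda>j. transpose_mat (L_block j \<zeta>)) ns)"
  have eqC: "P * (A - \<zeta> \<cdot>\<^sub>m B) * Q = diag_block_mat (Cs \<zeta>)" for \<zeta>
    using eq by (simp add: Cs_def)
  have len: "length (Cs \<zeta>) = 2 + length ms + length ns" for \<zeta> by (simp add: Cs_def)
  have dimL: "dim_row (L_block j \<zeta>) = j" "dim_col (L_block j \<zeta>) = j + 1" for j \<zeta>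
    by (auto simp: L_block_def)
  have dims: "dim_row (Cs \<zeta> ! i) = dim_row (Cs 0 ! i) \<and> dim_col (Cs \<zeta> ! i) = dim_col (Cs 0 ! i)"
    if "i < 2 + length ms + length ns" for i \<zeta>
    using that by (auto simp: Cs_def nth_append nth_Cons' dimL)
  \<comment> \<open>The two blocks of the regular part come first, hence the offset 2.\<close>
  show "\<exists>f g. null_chains n (length ms) A B ((!) ms) f g"
  proof (rule null_chains_of_L_blocks[OF A B P(1) P'(1,2) Q(1) Q'(1,2) eqC len _ dims, where off = 2])
    show "Cs \<zeta> ! (2 + j) = L_block (ms ! j) \<zeta>" if "j < length ms" for \<zeta> j
      using that by (simp add: Cs_def nth_append)
  qed auto
  define Cs' where "Cs' = (\<lambda>\<zeta>. map transpose_mat (Cs \<zeta>))"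
  have eqT: "Q\<^sup>T * (A\<^sup>T - \<zeta> \<cdot>\<^sub>m B\<^sup>T) * P\<^sup>T = diag_block_mat (Cs' \<zeta>)" for \<zeta>
  proof -
    have S: "A - \<zeta> \<cdot>\<^sub>m B \<in> carrier_mat n n" using A B by auto
    have "A\<^sup>T - \<zeta> \<cdot>\<^sub>m B\<^sup>T = (A - \<zeta> \<cdot>\<^sub>m B)\<^sup>T"
      by (rule eq_matI) (use A B in auto)
    moreover have "(P * (A - \<zeta> \<cdot>\<^sub>m B) * Q)\<^sup>T = Q\<^sup>T * ((A - \<zeta> \<cdot>\<^sub>m B)\<^sup>T * P\<^sup>T)"
      using S P Q by (simp add: transpose_mult[of _ n n _ n])
    moreover have "\<dots> = Q\<^sup>T * (A - \<zeta> \<cdot>\<^sub>m B)\<^sup>T * P\<^sup>T"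
      by (rule assoc_mult_mat[symmetric, of _ n n _ n _ n]) (use S P Q in auto)
    ultimately show ?thesis by (simp add: eqC transpose_diag_block_mat Cs'_def)
  qed
  have inv: "P'\<^sup>T * P\<^sup>T = 1\<^sub>m n" "Q'\<^sup>T * Q\<^sup>T = 1\<^sub>m n"
    using transpose_mult[OF P(1) P'(1)] transpose_mult[OF Q(1) Q'(1)]
    unfolding P'(3) Q'(3) by (metis transpose_one)+
  show "\<exists>f g. null_chains n (length ns) A\<^sup>T B\<^sup>T ((!) ns) f g"
  proof (rule null_chains_of_L_blocks[OF _ _ _ _ inv(2) _ _ inv(1) eqT, where off = "2 + length ms"])
    show "Cs' \<zeta> ! (2 + length ms + j) = L_block (ns ! j) \<zeta>" if "j < length ns" for \<zeta> j
      using that by (simp add: Cs'_def Cs_def nth_append)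
    show "dim_row (Cs' \<zeta> ! i) = dim_col (Cs 0 ! i) \<and> dim_col (Cs' \<zeta> ! i) = dim_row (Cs 0 ! i)"
      if "i < 2 + length ms + length ns" for \<zeta> i
      using dims[OF that, of \<zeta>] that by (simp add: Cs'_def len)
    show "length (Cs' \<zeta>) = 2 + length ms + length ns" for \<zeta> by (simp add: Cs'_def len)
  qed (use A B P P' Q Q' in simp_all)
qed

section \<open>Polynomial functions and the discriminant\<close>

text \<open>Conditions on \<open>U\<close> and \<open>W\<close> are treated as functions of the
  parameter vector; the closure rules below supply the underlying \<open>cpoly\<close>, which never
  has to be written down.\<close>

definition poly_fun :: "nat \<Rightarrow> (complex vec \<Rightarrow> complex) \<Rightarrow> bool" where
  "poly_fun m F \<longleftrightarrow> (\<exists>p. poly_in m p \<and> (\<forall>x\<in>carrier_vec m. F x = poly_value p x))"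

definition monomial_value :: "(nat \<Rightarrow>\<^sub>0 nat) \<Rightarrow> complex vec \<Rightarrow> complex" where
  "monomial_value e x = (\<Prod>i\<in>Poly_Mapping.keys e. (x $ i) ^ Poly_Mapping.lookup e i)"

text \<open>Monomials to be multiplied have different supports; a common finite index set only adds
  factors with exponent 0.\<close>

lemma monomial_value_superset:
  "finite I \<Longrightarrow> Poly_Mapping.keys e \<subseteq> I \<Longrightarrow>
    monomial_value e x = (\<Prod>i\<in>I. (x $ i) ^ Poly_Mapping.lookup e i)"
  unfolding monomial_value_def by (rule prod.mono_neutral_left) (auto simp: in_keys_iff)

lemma monomial_value_add:
  "monomial_value (e + e') x = monomial_value e x * monomial_value e' x"
proof -
  let ?I = "Poly_Mapping.keys e \<union> Poly_Mapping.keys e'"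
  have "monomial_value (e + e') x = (\<Prod>i\<in>?I. (x $ i) ^ Poly_Mapping.lookup (e + e') i)"
    by (rule monomial_value_superset) (use keys_add[of e e'] in auto)
  also have "\<dots> = (\<Prod>i\<in>?I. (x $ i) ^ Poly_Mapping.lookup e i) * (\<Prod>i\<in>?I. (x $ i) ^ Poly_Mapping.lookup e' i)"
    by (simp add: lookup_add power_add prod.distrib)
  finally show ?thesis
    using monomial_value_superset[of ?I e x] monomial_value_superset[of ?I e' x] by simp
qed

lemma poly_value_superset:
  "finite E \<Longrightarrow> Poly_Mapping.keys p \<subseteq> E \<Longrightarrow>
    poly_value p x = (\<Sum>e\<in>E. Poly_Mapping.lookup p e * monomial_value e x)"
  unfolding poly_value_def monomial_value_def by (rule sum.mono_neutral_left) (auto simp: in_keys_iff)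

lemma poly_value_add: "poly_value (p + q) x = poly_value p x + poly_value q x"
proof -
  let ?E = "Poly_Mapping.keys p \<union> Poly_Mapping.keys q"
  have "poly_value (p + q) x = (\<Sum>e\<in>?E. Poly_Mapping.lookup (p + q) e * monomial_value e x)"
    by (rule poly_value_superset) (use keys_add[of p q] in auto)
  also have "\<dots> = (\<Sum>e\<in>?E. Poly_Mapping.lookup p e * monomial_value e x)
      + (\<Sum>e\<in>?E. Poly_Mapping.lookup q e * monomial_value e x)"
    by (simp add: lookup_add distrib_right sum.distrib)
  finally show ?thesis
    using poly_value_superset[of ?E p x] poly_value_superset[of ?E q x] by simp
qed

lemma poly_fun_monomial:
  assumes "Poly_Mapping.keys e \<subseteq> {..<m}"
  shows "poly_fun m (\<lambda>x. c * monomial_value e x)"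
proof -
  have "poly_in m (Poly_Mapping.single e c)" using assms by (auto simp: poly_in_def split: if_splits)
  moreover have "poly_value (Poly_Mapping.single e c) x = c * monomial_value e x" for x
    using poly_value_superset[of "{e}" "Poly_Mapping.single e c" x] by simp
  ultimately show ?thesis unfolding poly_fun_def by metis
qed

lemma poly_fun_const [intro]: "poly_fun m (\<lambda>x. c)"
  using poly_fun_monomial[of 0 m c] by (simp add: monomial_value_def)

lemma poly_fun_coord: "i < m \<Longrightarrow> poly_fun m (\<lambda>x. x $ i)"
  using poly_fun_monomial[of "Poly_Mapping.single i 1" m 1] by (simp add: monomial_value_def)

lemma poly_fun_add [intro]:
  assumes "poly_fun m F" "poly_fun m G"
  shows "poly_fun m (\<lambda>x. F x + G x)"
proof -
  from assms obtain p q where p: "poly_in m p" "\<And>x. x \<in> carrier_vec m \<Longrightarrow> F x = poly_value p x"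
    and q: "poly_in m q" "\<And>x. x \<in> carrier_vec m \<Longrightarrow> G x = poly_value q x"
    by (auto simp: poly_fun_def)
  have "poly_in m (p + q)" using p(1) q(1) keys_add[of p q] by (auto simp: poly_in_def)
  then show ?thesis using p q unfolding poly_fun_def
    by (intro exI[of _ "p + q"]) (simp add: poly_value_add)
qed

lemma poly_fun_sum [intro]: "(\<And>i. i \<in> I \<Longrightarrow> poly_fun m (F i)) \<Longrightarrow> poly_fun m (\<lambda>x. \<Sum>i\<in>I. F i x)"
  by (induction I rule: infinite_finite_induct) auto

lemma poly_fun_cong:
  "(\<And>x. x \<in> carrier_vec m \<Longrightarrow> F x = G x) \<Longrightarrow> poly_fun m G \<Longrightarrow> poly_fun m F"
  by (auto simp: poly_fun_def)

lemma poly_fun_mult [intro]: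
  assumes "poly_fun m F" "poly_fun m G"
  shows "poly_fun m (\<lambda>x. F x * G x)"
proof -
  from assms obtain p q where p: "poly_in m p" "\<And>x. x \<in> carrier_vec m \<Longrightarrow> F x = poly_value p x"
    and q: "poly_in m q" "\<And>x. x \<in> carrier_vec m \<Longrightarrow> G x = poly_value q x"
    by (auto simp: poly_fun_def)
  show ?thesis
  proof (rule poly_fun_cong)
    show "F x * G x = (\<Sum>e\<in>Poly_Mapping.keys p. \<Sum>e'\<in>Poly_Mapping.keys q.
        (Poly_Mapping.lookup p e * Poly_Mapping.lookup q e') * monomial_value (e + e') x)"
      if "x \<in> carrier_vec m" for x
      unfolding p(2)[OF that] q(2)[OF that]
      by (simp add: poly_value_superset[OF finite_keys order_refl] sum_product monomial_value_add mult_ac)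
    show "poly_fun m (\<lambda>x. \<Sum>e\<in>Poly_Mapping.keys p. \<Sum>e'\<in>Poly_Mapping.keys q.
        (Poly_Mapping.lookup p e * Poly_Mapping.lookup q e') * monomial_value (e + e') x)"
    proof (intro poly_fun_sum poly_fun_monomial)
      fix e e' assume "e \<in> Poly_Mapping.keys p" "e' \<in> Poly_Mapping.keys q"
      then show "Poly_Mapping.keys (e + e') \<subseteq> {..<m}"
        using p(1) q(1) keys_add[of e e'] unfolding poly_in_def by blast
    qed
  qed
qed

lemma poly_fun_if [intro]:
  "poly_fun m F \<Longrightarrow> poly_fun m G \<Longrightarrow> poly_fun m (\<lambda>x. if P then F x else G x)"
  by (cases P) auto

lemma poly_fun_prod [intro]: "(\<And>i. i \<in> I \<Longrightarrow> poly_fun m (F i)) \<Longrightarrow> poly_fun m (\<lambda>x. \<Prod>i\<in>I. F i x)"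
  by (induction I rule: infinite_finite_induct) auto

lemma poly_fun_det:
  assumes "\<And>x. M x \<in> carrier_mat n n"
    and "\<And>i j. i < n \<Longrightarrow> j < n \<Longrightarrow> poly_fun m (\<lambda>x. M x $$ (i, j))"
  shows "poly_fun m (\<lambda>x. det (M x))"
proof -
  have "det (M x) = (\<Sum>p | p permutes {0..<n}. signof p * (\<Prod>i = 0..<n. M x $$ (i, p i)))" for x
    using assms(1)[of x] by (simp add: det_def')
  then show ?thesis
    using assms(2) by (auto intro!: poly_fun_sum poly_fun_mult poly_fun_prod simp: permutes_def)
qed

text \<open>Keeps the pencil parameter, which is the variable of the polynomial, apart from the
  entries of \<open>U\<close> and \<open>W\<close>, on which the coefficients depend.\<close>

definition coeffs_poly_fun :: "nat \<Rightarrow> (complex vec \<Rightarrow> complex poly) \<Rightarrow> bool" where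
  "coeffs_poly_fun m F \<longleftrightarrow> (\<forall>i. poly_fun m (\<lambda>x. coeff (F x) i))"

lemma coeffs_poly_fun_const [intro]: "coeffs_poly_fun m (\<lambda>x. p)"
  by (auto simp: coeffs_poly_fun_def)

lemma coeffs_poly_fun_lift [intro]: "poly_fun m F \<Longrightarrow> coeffs_poly_fun m (\<lambda>x. [:F x:])"
  unfolding coeffs_poly_fun_def
proof
  fix i assume "poly_fun m F"
  then show "poly_fun m (\<lambda>x. coeff [:F x:] i)" by (cases i) auto
qed

lemma coeffs_poly_fun_add [intro]:
  "coeffs_poly_fun m F \<Longrightarrow> coeffs_poly_fun m G \<Longrightarrow> coeffs_poly_fun m (\<lambda>x. F x + G x)"
  by (auto simp: coeffs_poly_fun_def)

lemma coeffs_poly_fun_mult [intro]: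
  "coeffs_poly_fun m F \<Longrightarrow> coeffs_poly_fun m G \<Longrightarrow> coeffs_poly_fun m (\<lambda>x. F x * G x)"
  unfolding coeffs_poly_fun_def coeff_mult by (intro allI poly_fun_sum poly_fun_mult) auto

lemma coeffs_poly_fun_sum [intro]:
  "(\<And>i. i \<in> I \<Longrightarrow> coeffs_poly_fun m (F i)) \<Longrightarrow> coeffs_poly_fun m (\<lambda>x. \<Sum>i\<in>I. F i x)"
  by (induction I rule: infinite_finite_induct) auto

lemma coeffs_poly_fun_prod [intro]:
  "(\<And>i. i \<in> I \<Longrightarrow> coeffs_poly_fun m (F i)) \<Longrightarrow> coeffs_poly_fun m (\<lambda>x. \<Prod>i\<in>I. F i x)"
  by (induction I rule: infinite_finite_induct) auto

lemma coeffs_poly_fun_det: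
  assumes "\<And>x. M x \<in> carrier_mat n n"
    and "\<And>i j. i < n \<Longrightarrow> j < n \<Longrightarrow> coeffs_poly_fun m (\<lambda>x. M x $$ (i, j))"
  shows "coeffs_poly_fun m (\<lambda>x. det (M x))"
proof -
  have "det (M x) = (\<Sum>p | p permutes {0..<n}. signof p * (\<Prod>i = 0..<n. M x $$ (i, p i)))" for x
    using assms(1)[of x] by (simp add: det_def')
  then show ?thesis
    using assms(2) by (auto intro!: coeffs_poly_fun_sum coeffs_poly_fun_mult coeffs_poly_fun_prod simp: permutes_def)
qed

text \<open>One polynomial and one point where it does not vanish suffice: the point makes the zero
  set proper.\<close>

lemma generic_set_nonzero:
  assumes F: "poly_fun m F" and x0: "x0 \<in> carrier_vec m" "F x0 \<noteq> 0"
  shows "generic_set m {x \<in> carrier_vec m. F x \<noteq> 0}"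
proof -
  from F obtain p where p: "poly_in m p" "\<And>x. x \<in> carrier_vec m \<Longrightarrow> F x = poly_value p x"
    by (auto simp: poly_fun_def)
  define S where "S = {x \<in> carrier_vec m. \<forall>q\<in>{p}. poly_value q x = 0}"
  have "algebraic_set m S"
    unfolding algebraic_set_def S_def by (intro exI[of _ "{p}"]) (use p in auto)
  moreover have "S \<noteq> carrier_vec m" using x0 p by (auto simp: S_def)
  moreover have "carrier_vec m - {x \<in> carrier_vec m. F x \<noteq> 0} \<subseteq> S" using p by (auto simp: S_def)
  ultimately show ?thesis unfolding generic_set_def by blast
qed

section \<open>Degrees, discriminants and square-free polynomials\<close>

lemma degree_det_le:
  fixes M :: "'a::idom poly mat"
  assumes M: "M \<in> carrier_mat n n" and d: "\<And>i j. i < n \<Longrightarrow> j < n \<Longrightarrow> degree (M $$ (i, j)) \<le> d j"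
  shows "degree (det M) \<le> (\<Sum>j<n. d j)"
proof -
  have "degree (signof p * (\<Prod>i = 0..<n. M $$ (i, p i))) \<le> (\<Sum>j<n. d j)"
    if p: "p permutes {0..<n}" for p
  proof -
    have "degree (signof p * (\<Prod>i = 0..<n. M $$ (i, p i)))
        \<le> degree (signof p :: 'a poly) + degree (\<Prod>i = 0..<n. M $$ (i, p i))"
      by (rule degree_mult_le)
    also have "degree (signof p :: 'a poly) = 0" by (simp add: sign_def)
    also have "degree (\<Prod>i = 0..<n. M $$ (i, p i)) \<le> (\<Sum>i = 0..<n. degree (M $$ (i, p i)))"
      using degree_prod_sum_le[of "{0..<n}" "\<lambda>i. M $$ (i, p i)"] by (simp add: o_def)
    also have "\<dots> \<le> (\<Sum>i = 0..<n. d (p i))"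
      using p by (intro sum_mono d) (auto simp: permutes_def)
    also have "\<dots> = (\<Sum>j<n. d j)"
      using sum.permute[OF p, of d] by (simp add: o_def atLeast0LessThan)
    finally show ?thesis by simp
  qed
  then show ?thesis unfolding det_def'[OF M] by (intro degree_sum_le) (auto simp: finite_permutations)
qed

text \<open>The Sylvester matrix has the fixed size belonging to degree \<open>d\<close>, so its
  determinant is polynomial in the coefficients of \<open>h\<close> even where the degree of
  \<open>h\<close> drops. For \<open>d = 0\<close> the matrix is empty and the value is 1.\<close>

definition discriminant :: "nat \<Rightarrow> complex poly \<Rightarrow> complex" where
  "discriminant d h = resultant_sub d (d - 1) h (pderiv h)"

text \<open>At exact degree \<open>d\<close> this is the true resultant. It vanishes iff
  \<open>h\<close> and \<open>pderiv h\<close> have a nonconstant common divisor, which over the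
  complex numbers means a common root.\<close>

lemma discriminant_nonzero_iff:
  assumes "degree h = d" "h \<noteq> 0"
  shows "discriminant d h \<noteq> 0 \<longleftrightarrow> rsquarefree h"
proof -
  have "discriminant d h = resultant h (pderiv h)"
    using assms by (simp add: discriminant_def resultant_sub degree_pderiv)
  then have "discriminant d h \<noteq> 0 \<longleftrightarrow> degree (gcd h (pderiv h)) = 0"
    by (simp add: resultant_0_gcd)
  also have "\<dots> \<longleftrightarrow> (\<forall>z. \<not> (poly h z = 0 \<and> poly (pderiv h) z = 0))"
  proof
    assume deg: "degree (gcd h (pderiv h)) = 0"
    show "\<forall>z. \<not> (poly h z = 0 \<and> poly (pderiv h) z = 0)"
    proof (intro allI notI)
      fix z assume "poly h z = 0 \<and> poly (pderiv h) z = 0"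
      then have "[:- z, 1:] dvd gcd h (pderiv h)" by (simp add: poly_eq_0_iff_dvd)
      moreover have "gcd h (pderiv h) \<noteq> 0" using assms by simp
      ultimately have "degree [:- z, 1:] \<le> degree (gcd h (pderiv h))" by (rule dvd_imp_degree_le)
      then show False using deg by simp
    qed
  next
    assume *: "\<forall>z. \<not> (poly h z = 0 \<and> poly (pderiv h) z = 0)"
    show "degree (gcd h (pderiv h)) = 0"
    proof (rule ccontr)
      assume "degree (gcd h (pderiv h)) \<noteq> 0"
      then have "\<not> constant (poly (gcd h (pderiv h)))" by (simp add: constant_degree)
      then obtain z where "poly (gcd h (pderiv h)) z = 0"
        using fundamental_theorem_of_algebra by blast
      then have "poly h z = 0 \<and> poly (pderiv h) z = 0"
        unfolding poly_eq_0_iff_dvd by simp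
      then show False using * by blast
    qed
  qed
  finally show ?thesis by (simp add: rsquarefree_roots)
qed

lemma poly_fun_discriminant:
  assumes "coeffs_poly_fun m F"
  shows "poly_fun m (\<lambda>x. discriminant d (F x))"
  unfolding discriminant_def resultant_sub_def
proof (rule poly_fun_det)
  fix i j assume "i < d + (d - 1)" "j < d + (d - 1)"
  then have eq: "sylvester_mat_sub d (d - 1) (F x) (pderiv (F x)) $$ (i, j) =
     (if i < d - 1 then if i \<le> j \<and> j - i \<le> d then coeff (F x) (d + i - j) else 0
     else if i - (d - 1) \<le> j \<and> j \<le> i then of_nat (Suc (i - j)) * coeff (F x) (Suc (i - j)) else 0)" for x
    by (simp add: sylvester_mat_sub_index coeff_pderiv del: of_nat_Suc)
  show "poly_fun m (\<lambda>x. sylvester_mat_sub d (d - 1) (F x) (pderiv (F x)) $$ (i, j))"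
    unfolding eq using assms
    by (intro poly_fun_if poly_fun_mult poly_fun_const) (simp_all add: coeffs_poly_fun_def)
qed (rule sylvester_mat_sub_carrier)

lemma rsquarefree_card_roots:
  fixes h :: "complex poly"
  assumes "rsquarefree h"
  shows "card {z. poly h z = 0} = degree h"
proof -
  have h: "h \<noteq> 0" using assms by (auto simp: rsquarefree_def)
  have "degree h = degree (smult (lead_coeff h) (\<Prod>z | poly h z = 0. [:- z, 1:]))"
    using complex_poly_decompose_rsquarefree[OF assms] by simp
  also have "\<dots> = (\<Sum>z | poly h z = 0. degree [:- z, 1:])"
    using h by (subst degree_smult_eq, subst degree_prod_eq_sum_degree) auto
  finally show ?thesis by simp
qed

lemma rsquarefree_prod_linear:
  fixes Z :: "'a::field_char_0 set"
  assumes "finite Z"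
  shows "rsquarefree (\<Prod>z\<in>Z. [:- z, 1:])"
  unfolding rsquarefree_roots
proof (intro allI notI)
  fix a assume a: "poly (\<Prod>z\<in>Z. [:- z, 1:]) a = 0 \<and> poly (pderiv (\<Prod>z\<in>Z. [:- z, 1:])) a = 0"
  then have aZ: "a \<in> Z" using assms by (auto simp: poly_prod prod_zero_iff)
  define h where "h = (\<Prod>z\<in>Z - {a}. [:- z, 1:])"
  have "(\<Prod>z\<in>Z. [:- z, 1:]) = [:- a, 1:] * h"
    unfolding h_def using assms aZ by (rule prod.remove)
  then have "poly (pderiv (\<Prod>z\<in>Z. [:- z, 1:])) a = poly h a"
    by (simp only: pderiv_mult) (simp add: pderiv_pCons)
  moreover have "poly h a \<noteq> 0" using assms by (auto simp: h_def poly_prod prod_zero_iff)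
  ultimately show False using a by simp
qed

section \<open>Homogeneous pencils in two charts\<close>

text \<open>The homogeneous pencil \<open>s A - t B\<close> is dehomogenised in two charts, \<open>(s, t) = (1, \<lambda>)\<close> around
  finite points and \<open>(s, t) = (- \<lambda>, -1)\<close> around infinity; the signs make \<open>s A - t B\<close> at \<open>\<lambda> = 0\<close>
  equal to \<open>B\<close> in the second one.\<close>

fun chart_s :: "ext_complex \<Rightarrow> complex poly" where
  "chart_s (Fin_ev z) = 1"
| "chart_s Inf_ev = [:0, -1:]"

fun chart_t :: "ext_complex \<Rightarrow> complex poly" where
  "chart_t (Fin_ev z) = [:0, 1:]"
| "chart_t Inf_ev = [:-1:]"

fun chart_point :: "ext_complex \<Rightarrow> complex" where
  "chart_point (Fin_ev z) = z"
| "chart_point Inf_ev = 0"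

abbreviation const_mat :: "complex mat \<Rightarrow> complex poly mat" where
  "const_mat \<equiv> map_mat (\<lambda>c. [:c:])"

abbreviation eval_mat :: "complex \<Rightarrow> complex poly mat \<Rightarrow> complex mat" where
  "eval_mat z \<equiv> map_mat (\<lambda>p. poly p z)"

lemma comm_ring_hom_eval: "comm_ring_hom (\<lambda>p :: complex poly. poly p z)"
  by unfold_locales auto

lemma poly_det: "poly (det M) z = det (eval_mat z M)"
  by (rule comm_ring_hom.hom_det[OF comm_ring_hom_eval, symmetric])

lemma eval_const_mat [simp]: "eval_mat z (const_mat M) = M"
  by (rule eq_matI) auto

lemma eval_mat_mult:
  "M \<in> carrier_mat m n \<Longrightarrow> N \<in> carrier_mat n k \<Longrightarrow> eval_mat z (M * N) = eval_mat z M * eval_mat z N"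
  by (rule semiring_hom.mat_hom_mult) (unfold_locales, auto)

lemma const_sum: "[:\<Sum>i\<in>I. F i:] = (\<Sum>i\<in>I. [:F i:])"
proof (induction I rule: infinite_finite_induct)
  case (insert i I)
  have "[:sum F (insert i I):] = [:F i + sum F I:]" using insert by simp
  also have "\<dots> = [:F i:] + [:sum F I:]" by simp
  also have "[:sum F I:] = (\<Sum>i\<in>I. [:F i:])" by fact
  finally show ?case using insert by simp
qed auto

lemma const_mult: "[:a * b:] = [:a:] * [:b :: complex:]"
  by simp

text \<open>At \<open>Inf_ev\<close> this is \<open>B - \<lambda> A\<close>, the reversed pencil in
  which \<open>alg_mult\<close> counts the multiplicity of 0.\<close>

definition pencil_poly :: "complex mat \<Rightarrow> complex mat \<Rightarrow> ext_complex \<Rightarrow> complex poly mat" where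
  "pencil_poly A B \<mu> = mat (dim_row A) (dim_col A)
     (\<lambda>(i, j). chart_s \<mu> * [:A $$ (i, j):] - chart_t \<mu> * [:B $$ (i, j):])"

lemma pencil_poly_carrier [simp, intro]: "A \<in> carrier_mat n m \<Longrightarrow> pencil_poly A B \<mu> \<in> carrier_mat n m"
  by (auto simp: pencil_poly_def)

lemma pencil_poly_dim [simp]:
  "dim_row (pencil_poly A B \<mu>) = dim_row A" "dim_col (pencil_poly A B \<mu>) = dim_col A"
  by (simp_all add: pencil_poly_def)

text \<open>All finite points share one chart, so \<open>Fin_ev 0\<close> stands for it wherever a
  whole polynomial is meant rather than its value at a point.\<close>

lemma pencil_poly_Fin: "pencil_poly A B (Fin_ev z) = pencil_poly A B (Fin_ev 0)"
  by (simp add: pencil_poly_def)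

lemma pencil_det_eq:
  assumes "A \<in> carrier_mat n n" "B \<in> carrier_mat n n"
  shows "pencil_det A B = det (pencil_poly A B (Fin_ev z))"
    and "pencil_det B A = det (pencil_poly A B Inf_ev)"
  unfolding pencil_det_def by (rule arg_cong[of _ _ det]; rule eq_matI; use assms in \<open>auto simp: pencil_poly_def\<close>)+

lemma alg_mult_eq:
  assumes "A \<in> carrier_mat n n" "B \<in> carrier_mat n n"
  shows "alg_mult A B \<mu> = order (chart_point \<mu>) (det (pencil_poly A B \<mu>))"
  using pencil_det_eq[OF assms] by (cases \<mu>) auto

lemma eval_pencil_poly:
  assumes "A \<in> carrier_mat n n" "B \<in> carrier_mat n n"
  shows "eval_mat (chart_point \<mu>) (pencil_poly A B \<mu>) = pencil_at A B \<mu>"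
  by (rule eq_matI; use assms in \<open>cases \<mu>\<close>) (auto simp: pencil_poly_def)

lemma pencil_poly_transpose:
  assumes "A \<in> carrier_mat n n" "B \<in> carrier_mat n n"
  shows "pencil_poly A\<^sup>T B\<^sup>T \<mu> = (pencil_poly A B \<mu>)\<^sup>T"
  by (rule eq_matI) (use assms in \<open>auto simp: pencil_poly_def\<close>)

lemma pencil_poly_diag:
  "pencil_poly (mat_diag k a) (mat_diag k b) \<mu> = mat_diag k (\<lambda>l. chart_s \<mu> * [:a l:] - chart_t \<mu> * [:b l:])"
  by (rule eq_matI) (auto simp: pencil_poly_def mat_diag_def)

lemma det_mat_diag: "det (mat_diag k c) = (\<Prod>l<k. c l)" for c :: "nat \<Rightarrow> 'a::comm_ring_1"
proof -
  have "det (mat_diag k c) = prod_list (diag_mat (mat_diag k c))"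
    by (rule det_upper_triangular[of _ k]) (auto simp: mat_diag_def)
  also have "diag_mat (mat_diag k c) = map c [0..<k]"
    by (auto simp: diag_mat_def mat_diag_def)
  finally show ?thesis by (simp add: prod.distinct_set_conv_list[symmetric] atLeast0LessThan)
qed

lemma mult_diag_transpose_index:
  fixes U :: "'a::comm_ring_1 mat"
  assumes "U \<in> carrier_mat n k" "W \<in> carrier_mat n k" "i < n" "j < n"
  shows "(U * mat_diag k a * W\<^sup>T) $$ (i, j) = (\<Sum>l<k. U $$ (i, l) * a l * W $$ (j, l))"
proof -
  have "U * mat_diag k a = mat n k (\<lambda>(i, l). U $$ (i, l) * a l)"
    by (rule mat_diag_mult_right) (use assms in auto)
  then show ?thesis
    using assms by (simp add: scalar_prod_def atLeast0LessThan)
qed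

text \<open>The scalar \<tau> and the diagonal pencil are grouped with \<open>U\<close>, so that the
  perturbation has the shape required by \<open>det_rank_update\<close>.\<close>

lemma pencil_poly_update:
  assumes A: "A \<in> carrier_mat n n" and B: "B \<in> carrier_mat n n"
    and U: "U \<in> carrier_mat n k" and W: "W \<in> carrier_mat n k"
  shows "pencil_poly (A + \<tau> \<cdot>\<^sub>m (U * mat_diag k a * W\<^sup>T)) (B + \<tau> \<cdot>\<^sub>m (U * mat_diag k b * W\<^sup>T)) \<mu> =
    pencil_poly A B \<mu> +
    (const_mat (\<tau> \<cdot>\<^sub>m U) * pencil_poly (mat_diag k a) (mat_diag k b) \<mu>) * (const_mat W)\<^sup>T"
    (is "?L = ?R")
proof (rule eq_matI)
  fix i j assume "i < dim_row ?R" "j < dim_col ?R"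
  then have ij: "i < n" "j < n" using U W by auto
  let ?s = "chart_s \<mu>" and ?t = "chart_t \<mu>"
  have cU: "const_mat (\<tau> \<cdot>\<^sub>m U) \<in> carrier_mat n k" and cW: "const_mat W \<in> carrier_mat n k"
    using U W by auto
  have "?R $$ (i, j) = pencil_poly A B \<mu> $$ (i, j) +
      (\<Sum>l<k. [:\<tau> * U $$ (i, l):] * (?s * [:a l:] - ?t * [:b l:]) * [:W $$ (j, l):])"
    unfolding pencil_poly_diag
    using mult_diag_transpose_index[OF cU cW ij] A U W ij by simp
  also have "(\<Sum>l<k. [:\<tau> * U $$ (i, l):] * (?s * [:a l:] - ?t * [:b l:]) * [:W $$ (j, l):]) =
      ?s * [:\<tau> * (\<Sum>l<k. U $$ (i, l) * a l * W $$ (j, l)):] -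
      ?t * [:\<tau> * (\<Sum>l<k. U $$ (i, l) * b l * W $$ (j, l)):]"
    unfolding sum_distrib_left const_sum sum_subtractf[symmetric]
    by (intro sum.cong refl) (simp only: const_mult algebra_simps)
  also have "pencil_poly A B \<mu> $$ (i, j) + \<dots> = ?L $$ (i, j)"
  proof -
    have add: "[:x + y:] = [:x:] + [:y:]" for x y :: complex by simp
    have 1: "pencil_poly A B \<mu> $$ (i, j) = ?s * [:A $$ (i, j):] - ?t * [:B $$ (i, j):]"
      using A ij by (simp add: pencil_poly_def)
    have 2: "?L $$ (i, j) = ?s * [:A $$ (i, j) + \<tau> * (\<Sum>l<k. U $$ (i, l) * a l * W $$ (j, l)):] -
      ?t * [:B $$ (i, j) + \<tau> * (\<Sum>l<k. U $$ (i, l) * b l * W $$ (j, l)):]"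
      using A B U W ij by (simp add: pencil_poly_def mult_diag_transpose_index[OF U W ij])
    show ?thesis unfolding 1 2 add by (simp only: algebra_simps)
  qed
  finally show "?L $$ (i, j) = ?R $$ (i, j)" ..
qed (use A U W in auto)

lemma pencil_at_carrier [simp, intro]:
  "A \<in> carrier_mat n n \<Longrightarrow> B \<in> carrier_mat n n \<Longrightarrow> pencil_at A B \<mu> \<in> carrier_mat n n"
  by (cases \<mu>) auto

lemma pencil_at_transpose:
  assumes "A \<in> carrier_mat n n" "B \<in> carrier_mat n n"
  shows "pencil_at A\<^sup>T B\<^sup>T \<mu> = (pencil_at A B \<mu>)\<^sup>T"
  by (cases \<mu>) (use assms in \<open>auto intro!: eq_matI\<close>)

lemma pencil_at_diag:
  "pencil_at (mat_diag k a) (mat_diag k b) \<mu> =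
    mat_diag k (\<lambda>l. case \<mu> of Fin_ev z \<Rightarrow> a l - z * b l | Inf_ev \<Rightarrow> b l)"
  by (cases \<mu>) (auto intro!: eq_matI simp: mat_diag_def)

lemma pencil_at_update:
  assumes A: "A \<in> carrier_mat n n" and B: "B \<in> carrier_mat n n"
    and U: "U \<in> carrier_mat n k" and W: "W \<in> carrier_mat n k"
  shows "pencil_at (A + \<tau> \<cdot>\<^sub>m (U * mat_diag k a * W\<^sup>T)) (B + \<tau> \<cdot>\<^sub>m (U * mat_diag k b * W\<^sup>T)) \<mu> =
    pencil_at A B \<mu> + \<tau> \<cdot>\<^sub>m (U * pencil_at (mat_diag k a) (mat_diag k b) \<mu> * W\<^sup>T)"
proof (rule eq_matI)
  fix i j assume ij: "i < dim_row (pencil_at A B \<mu> + \<tau> \<cdot>\<^sub>m (U * pencil_at (mat_diag k a) (mat_diag k b) \<mu> * W\<^sup>T))"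
    "j < dim_col (pencil_at A B \<mu> + \<tau> \<cdot>\<^sub>m (U * pencil_at (mat_diag k a) (mat_diag k b) \<mu> * W\<^sup>T))"
  have UW: "(U * mat_diag k c * W\<^sup>T) $$ (i, j) = (\<Sum>l<k. U $$ (i, l) * c l * W $$ (j, l))" for c
    using mult_diag_transpose_index[OF U W] ij U W by simp
  show "pencil_at (A + \<tau> \<cdot>\<^sub>m (U * mat_diag k a * W\<^sup>T)) (B + \<tau> \<cdot>\<^sub>m (U * mat_diag k b * W\<^sup>T)) \<mu> $$ (i, j) =
    (pencil_at A B \<mu> + \<tau> \<cdot>\<^sub>m (U * pencil_at (mat_diag k a) (mat_diag k b) \<mu> * W\<^sup>T)) $$ (i, j)"
    unfolding pencil_at_diag
    using ij A B U W
    by (cases \<mu>) (simp_all add: UW algebra_simps sum_subtractf sum_distrib_left)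
qed (use A B U W in \<open>cases \<mu>; auto\<close>)+

section \<open>Kernel polynomials and their pairing with constant matrices\<close>

text \<open>Column \<open>j\<close> is the kernel polynomial of chain \<open>j\<close>, homogenised
  to degree \<open>d j\<close>, so that it lies in the kernel of \<open>s A - t B\<close> in both
  charts.\<close>

definition chain_mat :: "nat \<Rightarrow> nat \<Rightarrow> (nat \<Rightarrow> nat) \<Rightarrow> (nat \<Rightarrow> nat \<Rightarrow> complex vec) \<Rightarrow> ext_complex \<Rightarrow> complex poly mat" where
  "chain_mat n k d f \<mu> = mat n k (\<lambda>(i, j). \<Sum>r\<le>d j. [:f j r $ i:] * (chart_s \<mu> ^ (d j - r) * chart_t \<mu> ^ r))"

text \<open>With \<open>g\<close> dual to the chains, column \<open>i\<close> pairs only with chain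
  \<open>i\<close>, and \<open>c i q\<close> becomes the coefficient of its monomial number
  \<open>q\<close>. The dual frames and the generic witness are both of this form.\<close>

definition dual_mat :: "nat \<Rightarrow> nat \<Rightarrow> (nat \<Rightarrow> nat) \<Rightarrow> (nat \<Rightarrow> nat \<Rightarrow> complex vec) \<Rightarrow> (nat \<Rightarrow> nat \<Rightarrow> complex) \<Rightarrow> complex mat" where
  "dual_mat n k d g c = mat n k (\<lambda>(l, i). \<Sum>q\<le>d i. c i q * g i q $ l)"

text \<open>In the finite chart its roots are the eigenvalues \<alpha> if the chains come from the
  pencil, and the eigenvalues \<beta> if they come from its transpose.\<close>

definition chain_det :: "nat \<Rightarrow> nat \<Rightarrow> (nat \<Rightarrow> nat) \<Rightarrow> (nat \<Rightarrow> nat \<Rightarrow> complex vec) \<Rightarrow> ext_complex \<Rightarrow> complex mat \<Rightarrow> complex poly" where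
  "chain_det n k d f \<mu> W = det ((const_mat W)\<^sup>T * chain_mat n k d f \<mu>)"

lemma chain_mat_carrier [simp, intro]: "chain_mat n k d f \<mu> \<in> carrier_mat n k"
  by (simp add: chain_mat_def)

lemma chain_mat_dim [simp]: "dim_row (chain_mat n k d f \<mu>) = n" "dim_col (chain_mat n k d f \<mu>) = k"
  by (simp_all add: chain_mat_def)

lemma dual_mat_carrier [simp, intro]: "dual_mat n k d g c \<in> carrier_mat n k"
  by (simp add: dual_mat_def)

lemma dual_mat_dim [simp]: "dim_row (dual_mat n k d g c) = n" "dim_col (dual_mat n k d g c) = k"
  by (simp_all add: dual_mat_def)

lemma chain_det_Fin: "chain_det n k d f (Fin_ev z) = chain_det n k d f (Fin_ev 0)"
  by (simp add: chain_det_def chain_mat_def fun_eq_iff)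

lemma chain_mat_product_index:
  assumes W: "W \<in> carrier_mat n k" and ij: "i < k" "j < k"
  shows "((const_mat W)\<^sup>T * chain_mat n k d f \<mu>) $$ (i, j) =
    (\<Sum>r\<le>d j. [:\<Sum>l<n. W $$ (l, i) * f j r $ l:] * (chart_s \<mu> ^ (d j - r) * chart_t \<mu> ^ r))"
proof -
  have "((const_mat W)\<^sup>T * chain_mat n k d f \<mu>) $$ (i, j) =
     (\<Sum>l<n. [:W $$ (l, i):] * (\<Sum>r\<le>d j. [:f j r $ l:] * (chart_s \<mu> ^ (d j - r) * chart_t \<mu> ^ r)))"
    using W ij by (simp add: scalar_prod_def chain_mat_def atLeast0LessThan)
  also have "\<dots> = (\<Sum>r\<le>d j. \<Sum>l<n. [:W $$ (l, i):] * ([:f j r $ l:] * (chart_s \<mu> ^ (d j - r) * chart_t \<mu> ^ r)))"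
    unfolding sum_distrib_left by (rule sum.swap)
  also have "\<dots> = (\<Sum>r\<le>d j. [:\<Sum>l<n. W $$ (l, i) * f j r $ l:] * (chart_s \<mu> ^ (d j - r) * chart_t \<mu> ^ r))"
    unfolding const_sum sum_distrib_right by (intro sum.cong refl) (simp only: const_mult mult_ac)
  finally show ?thesis .
qed

lemma dual_mat_mult_chain_mat:
  assumes "null_chains n k A B d f g"
  shows "(const_mat (dual_mat n k d g c))\<^sup>T * chain_mat n k d f \<mu> =
    mat_diag k (\<lambda>j. \<Sum>r\<le>d j. [:c j r:] * (chart_s \<mu> ^ (d j - r) * chart_t \<mu> ^ r))"
proof (rule eq_matI)
  fix i j assume "i < dim_row (mat_diag k (\<lambda>j. \<Sum>r\<le>d j. [:c j r:] * (chart_s \<mu> ^ (d j - r) * chart_t \<mu> ^ r)))"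
    "j < dim_col (mat_diag k (\<lambda>j. \<Sum>r\<le>d j. [:c j r:] * (chart_s \<mu> ^ (d j - r) * chart_t \<mu> ^ r)))"
  then have ij: "i < k" "j < k" by (auto simp: mat_diag_def)
  have "(\<Sum>l<n. dual_mat n k d g c $$ (l, i) * f j r $ l) = (if i = j then c j r else 0)" if r: "r \<le> d j" for r
  proof -
    have f: "dim_vec (f j r) = n" using assms ij r by (auto simp: null_chains_def)
    have "(\<Sum>l<n. dual_mat n k d g c $$ (l, i) * f j r $ l) = (\<Sum>l<n. \<Sum>q\<le>d i. c i q * (g i q $ l * f j r $ l))"
      using ij by (simp add: dual_mat_def sum_distrib_right mult.assoc)
    also have "\<dots> = (\<Sum>q\<le>d i. \<Sum>l<n. c i q * (g i q $ l * f j r $ l))"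
      by (rule sum.swap)
    also have "\<dots> = (\<Sum>q\<le>d i. c i q * (g i q \<bullet> f j r))"
      using f by (simp add: scalar_prod_def sum_distrib_left atLeast0LessThan)
    also have "\<dots> = (\<Sum>q\<le>d i. if i = j \<and> q = r then c i q else 0)"
      using assms ij r by (intro sum.cong refl) (auto simp: null_chains_def)
    also have "\<dots> = (if i = j then c j r else 0)"
      using r by (auto simp: sum.delta)
    finally show ?thesis .
  qed
  then show "((const_mat (dual_mat n k d g c))\<^sup>T * chain_mat n k d f \<mu>) $$ (i, j) =
    mat_diag k (\<lambda>j. \<Sum>r\<le>d j. [:c j r:] * (chart_s \<mu> ^ (d j - r) * chart_t \<mu> ^ r)) $$ (i, j)"
    unfolding chain_mat_product_index[OF dual_mat_carrier ij] using ij by (simp add: mat_diag_def)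
qed (auto simp: mat_diag_def)

text \<open>The links \<open>a (Suc r) = b r\<close> cancel inner terms and the end conditions
  remove the rest. This is why a chain gives a kernel polynomial, for any \<open>s\<close> and
  \<open>t\<close>.\<close>

lemma telescoping_chain:
  fixes s t :: "'a::comm_ring_1"
  assumes "a 0 = 0" "b m = 0" "\<And>r. r < m \<Longrightarrow> a (Suc r) = b r"
  shows "(\<Sum>r\<le>m. (s * a r - t * b r) * (s ^ (m - r) * t ^ r)) = 0"
proof -
  have "(\<Sum>r\<le>m. s * a r * (s ^ (m - r) * t ^ r)) = (\<Sum>r<m. s * a (Suc r) * (s ^ (m - Suc r) * t ^ Suc r))"
    unfolding lessThan_Suc_atMost[symmetric] sum.lessThan_Suc_shift by (simp add: assms)
  also have "\<dots> = (\<Sum>r<m. t * b r * (s ^ (m - r) * t ^ r))"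
  proof (intro sum.cong refl)
    fix r assume "r \<in> {..<m}"
    then have "s ^ (m - r) = s * s ^ (m - Suc r)" by (simp add: Suc_diff_Suc flip: power_Suc)
    then show "s * a (Suc r) * (s ^ (m - Suc r) * t ^ Suc r) = t * b r * (s ^ (m - r) * t ^ r)"
      using assms(3)[of r] \<open>r \<in> {..<m}\<close> by (simp add: mult_ac)
  qed
  also have "\<dots> = (\<Sum>r\<le>m. t * b r * (s ^ (m - r) * t ^ r))"
    unfolding lessThan_Suc_atMost[symmetric] by (simp add: assms)
  finally show ?thesis by (simp add: left_diff_distrib sum_subtractf)
qed

lemma pencil_poly_mult_chain_mat:
  assumes A: "A \<in> carrier_mat n n" and B: "B \<in> carrier_mat n n" and chains: "null_chains n k A B d f g"
  shows "pencil_poly A B \<mu> * chain_mat n k d f \<mu> = 0\<^sub>m n k"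
proof (rule eq_matI)
  fix i j assume "i < dim_row (0\<^sub>m n k :: complex poly mat)" "j < dim_col (0\<^sub>m n k :: complex poly mat)"
  then have ij: "i < n" "j < k" by auto
  let ?s = "chart_s \<mu>" and ?t = "chart_t \<mu>"
  have f: "f j r \<in> carrier_vec n" if "r \<le> d j" for r using chains ij that by (auto simp: null_chains_def)
  have mv: "(M *\<^sub>v f j r) $ i = (\<Sum>l<n. M $$ (i, l) * f j r $ l)" if "M \<in> carrier_mat n n" "r \<le> d j" for M r
    using that ij f[of r] by (auto simp: scalar_prod_def atLeast0LessThan)
  have "(pencil_poly A B \<mu> * chain_mat n k d f \<mu>) $$ (i, j) =
      (\<Sum>l<n. (?s * [:A $$ (i, l):] - ?t * [:B $$ (i, l):]) * (\<Sum>r\<le>d j. [:f j r $ l:] * (?s ^ (d j - r) * ?t ^ r)))"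
    using A ij by (simp add: pencil_poly_def chain_mat_def scalar_prod_def atLeast0LessThan)
  also have "\<dots> = (\<Sum>r\<le>d j. \<Sum>l<n. (?s * [:A $$ (i, l):] - ?t * [:B $$ (i, l):]) * ([:f j r $ l:] * (?s ^ (d j - r) * ?t ^ r)))"
    unfolding sum_distrib_left by (rule sum.swap)
  also have "\<dots> = (\<Sum>r\<le>d j. (?s * [:(A *\<^sub>v f j r) $ i:] - ?t * [:(B *\<^sub>v f j r) $ i:]) * (?s ^ (d j - r) * ?t ^ r))"
  proof (intro sum.cong refl)
    fix r assume "r \<in> {..d j}"
    then have r: "r \<le> d j" by simp
    show "(\<Sum>l<n. (?s * [:A $$ (i, l):] - ?t * [:B $$ (i, l):]) * ([:f j r $ l:] * (?s ^ (d j - r) * ?t ^ r))) =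
      (?s * [:(A *\<^sub>v f j r) $ i:] - ?t * [:(B *\<^sub>v f j r) $ i:]) * (?s ^ (d j - r) * ?t ^ r)"
      unfolding mv[OF A r] mv[OF B r] const_sum sum_distrib_left sum_subtractf[symmetric] sum_distrib_right
      by (intro sum.cong refl) (simp only: const_mult algebra_simps)
  qed
  also have "\<dots> = 0"
    using chains ij by (intro telescoping_chain) (auto simp: null_chains_def)
  finally show "(pencil_poly A B \<mu> * chain_mat n k d f \<mu>) $$ (i, j) = 0\<^sub>m n k $$ (i, j)" using ij by simp
qed (use A in auto)

text \<open>Selects from each chain the coefficient whose monomial is constant in the chart: number
  0, where \<open>s = 1\<close>, or number \<open>d i\<close>, where \<open>t = -1\<close> and the
  sign is undone by the power of -1. So \<open>chain_mat\<close> has a constant left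
  inverse.\<close>

definition chart_dual :: "nat \<Rightarrow> nat \<Rightarrow> (nat \<Rightarrow> nat) \<Rightarrow> (nat \<Rightarrow> nat \<Rightarrow> complex vec) \<Rightarrow> ext_complex \<Rightarrow> complex mat" where
  "chart_dual n k d g \<mu> = dual_mat n k d g
    (\<lambda>i q. case \<mu> of Fin_ev z \<Rightarrow> of_bool (q = 0) | Inf_ev \<Rightarrow> of_bool (q = d i) * (-1) ^ d i)"

lemma chart_dual_carrier [simp, intro]: "chart_dual n k d g \<mu> \<in> carrier_mat n k"
  by (simp add: chart_dual_def)

lemma chart_dual_mult_chain_mat:
  assumes "null_chains n k A B d f g"
  shows "(const_mat (chart_dual n k d g \<mu>))\<^sup>T * chain_mat n k d f \<mu> = 1\<^sub>m k"
proof -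
  have "(\<Sum>r\<le>m. [:of_bool (r = 0) :: complex:] * (1 * [:0, 1:] ^ r)) = 1" for m
  proof -
    have "(\<Sum>r\<le>m. [:of_bool (r = 0) :: complex:] * (1 * [:0, 1:] ^ r)) = (\<Sum>r\<le>m. if r = 0 then 1 else 0)"
      by (intro sum.cong) auto
    then show ?thesis by simp
  qed
  moreover have "(\<Sum>r\<le>m. [:of_bool (r = m) * (-1) ^ m :: complex:] * ([:0, -1:] ^ (m - r) * [:-1:] ^ r)) = 1" for m
  proof -
    have "(\<Sum>r\<le>m. [:of_bool (r = m) * (-1) ^ m :: complex:] * ([:0, -1:] ^ (m - r) * [:-1:] ^ r)) =
      (\<Sum>r\<le>m. if r = m then [:(-1) ^ m * (-1) ^ m:] else 0)"
      by (intro sum.cong) (simp_all add: poly_const_pow)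
    also have "(-1) ^ m * (-1) ^ m = (1 :: complex)" by (simp flip: power_mult_distrib)
    finally show ?thesis by simp
  qed
  ultimately show ?thesis
    unfolding chart_dual_def dual_mat_mult_chain_mat[OF assms] by (cases \<mu>) simp_all
qed

text \<open>Column \<open>j\<close> of the product has degree at most \<open>d j\<close>. The bound
  turns the condition of full degree into the nonvanishing of one coefficient.\<close>

lemma degree_chain_det_le:
  assumes "W \<in> carrier_mat n k"
  shows "degree (chain_det n k d f (Fin_ev z) W) \<le> (\<Sum>j<k. d j)"
  unfolding chain_det_def
proof (rule degree_det_le)
  fix i j assume ij: "i < k" "j < k"
  show "degree (((const_mat W)\<^sup>T * chain_mat n k d f (Fin_ev z)) $$ (i, j)) \<le> d j"
    unfolding chain_mat_product_index[OF assms ij]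
  proof (intro degree_sum_le)
    fix r assume "r \<in> {..d j}"
    have "degree ([:\<Sum>l<n. W $$ (l, i) * f j r $ l:] * [:0, 1:] ^ r) \<le> 0 + 1 * r"
      by (rule order_trans[OF degree_mult_le]) (auto intro: order_trans[OF degree_power_le])
    then show "degree ([:\<Sum>l<n. W $$ (l, i) * f j r $ l:] * (chart_s (Fin_ev z) ^ (d j - r) * chart_t (Fin_ev z) ^ r)) \<le> d j"
      using \<open>r \<in> {..d j}\<close> by simp
  qed auto
qed (use assms in auto)

lemma chain_det_dual_mat:
  assumes "null_chains n k A B d f g"
  shows "chain_det n k d f \<mu> (dual_mat n k d g c) =
    (\<Prod>j<k. \<Sum>r\<le>d j. [:c j r:] * (chart_s \<mu> ^ (d j - r) * chart_t \<mu> ^ r))"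
  unfolding chain_det_def dual_mat_mult_chain_mat[OF assms] det_mat_diag ..

text \<open>Chain \<open>j\<close> can carry the coefficients of any \<open>h j\<close> of degree at
  most \<open>d j\<close>; the pairing is diagonal, so the determinant is prescribed factor by
  factor.\<close>

lemma chain_det_dual_mat_Fin:
  assumes "null_chains n k A B d f g" "\<And>j. j < k \<Longrightarrow> degree (h j) \<le> d j"
  shows "chain_det n k d f (Fin_ev z) (dual_mat n k d g (\<lambda>j. coeff (h j))) = (\<Prod>j<k. h j)"
  unfolding chain_det_dual_mat[OF assms(1)]
proof (intro prod.cong refl)
  fix j assume "j \<in> {..<k}"
  then have "degree (h j) \<le> d j" using assms by simp
  then have "h j = (\<Sum>r\<le>d j. monom (coeff (h j) r) r)" by (simp add: poly_as_sum_of_monoms')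
  then show "(\<Sum>r\<le>d j. [:coeff (h j) r:] * (chart_s (Fin_ev z) ^ (d j - r) * chart_t (Fin_ev z) ^ r)) = h j"
    by (simp add: monom_altdef)
qed

lemma chain_det_dual_mat_Inf:
  assumes "null_chains n k A B d f g"
  shows "poly (chain_det n k d f Inf_ev (dual_mat n k d g (\<lambda>j. coeff (h j)))) 0 =
    (\<Prod>j<k. coeff (h j) (d j) * (-1) ^ d j)"
  unfolding chain_det_dual_mat[OF assms] poly_prod
proof (intro prod.cong refl)
  fix j
  have "poly (\<Sum>r\<le>d j. [:coeff (h j) r:] * (chart_s Inf_ev ^ (d j - r) * chart_t Inf_ev ^ r)) 0 =
    (\<Sum>r\<le>d j. coeff (h j) r * (0 ^ (d j - r) * (-1) ^ r))"
    by (simp add: poly_sum)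
  \<comment> \<open>At the chart point of infinity \<open>s\<close> vanishes, so only the top
    coefficient survives, through \<open>0 ^ 0 = 1\<close>.\<close>
  also have "\<dots> = (\<Sum>r\<le>d j. if r = d j then coeff (h j) r * (-1) ^ r else 0)"
    by (intro sum.cong) auto
  finally show "poly (\<Sum>r\<le>d j. [:coeff (h j) r:] * (chart_s Inf_ev ^ (d j - r) * chart_t Inf_ev ^ r)) 0 =
    coeff (h j) (d j) * (-1) ^ d j" by (simp add: sum.delta)
qed

lemma chain_det_coeffs_poly_fun:
  assumes W: "\<And>x. W x \<in> carrier_mat n k"
    and pf: "\<And>l i. l < n \<Longrightarrow> i < k \<Longrightarrow> poly_fun m (\<lambda>x. W x $$ (l, i))"
  shows "coeffs_poly_fun m (\<lambda>x. chain_det n k d f \<mu> (W x))"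
  unfolding chain_det_def
proof (rule coeffs_poly_fun_det)
  fix i j assume ij: "i < k" "j < k"
  show "coeffs_poly_fun m (\<lambda>x. ((const_mat (W x))\<^sup>T * chain_mat n k d f \<mu>) $$ (i, j))"
    unfolding chain_mat_product_index[OF W ij]
    by (intro coeffs_poly_fun_sum coeffs_poly_fun_mult coeffs_poly_fun_const coeffs_poly_fun_lift
        poly_fun_sum poly_fun_mult poly_fun_const pf) (use ij in auto)
next
  show "(const_mat (W x))\<^sup>T * chain_mat n k d f \<mu> \<in> carrier_mat k k" for x using W[of x] by auto
qed

lemma chain_det_value:
  assumes "W \<in> carrier_mat n k"
  shows "poly (chain_det n k d f \<mu> W) z = det (W\<^sup>T * eval_mat z (chain_mat n k d f \<mu>))"
  unfolding chain_det_def poly_det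
  using assms by (subst eval_mat_mult[of _ k n]) (auto simp: map_mat_transpose)

lemma chain_det_value_poly_fun:
  assumes W: "\<And>x. W x \<in> carrier_mat n k"
    and pf: "\<And>l i. l < n \<Longrightarrow> i < k \<Longrightarrow> poly_fun m (\<lambda>x. W x $$ (l, i))"
  shows "poly_fun m (\<lambda>x. poly (chain_det n k d f \<mu> (W x)) z)"
  unfolding chain_det_value[OF W]
proof (rule poly_fun_det)
  fix i j assume ij: "i < k" "j < k"
  have "((W x)\<^sup>T * eval_mat z (chain_mat n k d f \<mu>)) $$ (i, j) =
      (\<Sum>l<n. W x $$ (l, i) * eval_mat z (chain_mat n k d f \<mu>) $$ (l, j))" for x
    using W[of x] ij carrier_matD[OF chain_mat_carrier[of n k d f \<mu>]]
    by (simp add: scalar_prod_def atLeast0LessThan)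
  then show "poly_fun m (\<lambda>x. ((W x)\<^sup>T * eval_mat z (chain_mat n k d f \<mu>)) $$ (i, j))"
    using ij by (auto intro!: poly_fun_sum poly_fun_mult poly_fun_const pf)
next
  show "(W x)\<^sup>T * eval_mat z (chain_mat n k d f \<mu>) \<in> carrier_mat k k" for x using W[of x] by auto
qed

section \<open>The perturbed pencil\<close>

lemma mult_zero_vec:
  fixes M :: "'a::comm_ring_1 mat"
  assumes "M \<in> carrier_mat n k"
  shows "M *\<^sub>v 0\<^sub>v k = 0\<^sub>v n"
  by (rule eq_vecI) (use assms in auto)

locale pencil_chains =
  fixes n k :: nat and A B :: "complex mat"
    and dX :: "nat \<Rightarrow> nat" and f g :: "nat \<Rightarrow> nat \<Rightarrow> complex vec"
    and dY :: "nat \<Rightarrow> nat" and f' g' :: "nat \<Rightarrow> nat \<Rightarrow> complex vec"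
  assumes A: "A \<in> carrier_mat n n" and B: "B \<in> carrier_mat n n"
    and X_chains: "null_chains n k A B dX f g"
    and Y_chains: "null_chains n k A\<^sup>T B\<^sup>T dY f' g'"
begin

text \<open>Transposition swaps the two families of chains, and with them \<open>q\<close> and
  \<open>p\<close>.\<close>

lemma transposed: "pencil_chains n k A\<^sup>T B\<^sup>T dY f' g' dX f g"
  by unfold_locales (use A B X_chains Y_chains in auto)

abbreviation "X \<equiv> chain_mat n k dX f"
abbreviation "Y \<equiv> chain_mat n k dY f'"
abbreviation "U0 \<equiv> chart_dual n k dY g'"
abbreviation "W0 \<equiv> chart_dual n k dX g"
abbreviation "q \<equiv> chain_det n k dX f"
abbreviation "p \<equiv> chain_det n k dY f'"

text \<open>The border depends on the chart, but whether this polynomial vanishes at the chart point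
  is intrinsic, by \<open>rank_ge_iff_rho\<close>.\<close>

definition "rho \<mu> = det (pencil_poly A B \<mu> + const_mat (U0 \<mu>) * (const_mat (W0 \<mu>))\<^sup>T)"

lemma rho_Fin: "rho (Fin_ev z) = rho (Fin_ev 0)"
  by (simp add: rho_def pencil_poly_Fin[of _ _ z] chart_dual_def)

lemma rho_transposed: "pencil_chains.rho n k A\<^sup>T B\<^sup>T dY g' dX g \<mu> = rho \<mu>"
proof -
  interpret T: pencil_chains n k "A\<^sup>T" "B\<^sup>T" dY f' g' dX f g by (rule transposed)
  define C D where "C = const_mat (U0 \<mu>)" and "D = const_mat (W0 \<mu>)"
  have C: "C \<in> carrier_mat n k" and D: "D \<in> carrier_mat n k" by (auto simp: C_def D_def)
  have S: "pencil_poly A B \<mu> \<in> carrier_mat n n" using A by auto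
  have "(pencil_poly A B \<mu> + C * D\<^sup>T)\<^sup>T = pencil_poly A\<^sup>T B\<^sup>T \<mu> + D * C\<^sup>T"
    using C D S A B by (simp add: transpose_add[of _ n n] transpose_mult[of _ n k _ n] pencil_poly_transpose)
  moreover have "det (pencil_poly A B \<mu> + C * D\<^sup>T)\<^sup>T = det (pencil_poly A B \<mu> + C * D\<^sup>T)"
    by (rule det_transpose[of _ n]) (use S C D in auto)
  ultimately show ?thesis by (simp add: rho_def T.rho_def C_def D_def)
qed

lemma frame: "null_frame n k (pencil_poly A B \<mu>) (X \<mu>) (Y \<mu>) (const_mat (U0 \<mu>)) (const_mat (W0 \<mu>))"
proof
  show "pencil_poly A B \<mu> * X \<mu> = 0\<^sub>m n k"
    by (rule pencil_poly_mult_chain_mat[OF A B X_chains])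
  show "(pencil_poly A B \<mu>)\<^sup>T * Y \<mu> = 0\<^sub>m n k"
    unfolding pencil_poly_transpose[OF A B, symmetric]
    by (rule pencil_poly_mult_chain_mat[OF _ _ Y_chains]) (use A B in auto)
  show "(const_mat (W0 \<mu>))\<^sup>T * X \<mu> = 1\<^sub>m k"
    by (rule chart_dual_mult_chain_mat[OF X_chains])
  have "((const_mat (U0 \<mu>))\<^sup>T * Y \<mu>)\<^sup>T = (Y \<mu>)\<^sup>T * const_mat (U0 \<mu>)"
    by (subst transpose_mult[of _ k n _ k]) auto
  then show "(Y \<mu>)\<^sup>T * const_mat (U0 \<mu>) = 1\<^sub>m k"
    unfolding chart_dual_mult_chain_mat[OF Y_chains] by simp
qed (use A in auto)

lemma det_Y:
  assumes U: "U \<in> carrier_mat n k"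
  shows "det ((Y \<mu>)\<^sup>T * const_mat U) = p \<mu> U"
proof -
  have "((const_mat U)\<^sup>T * Y \<mu>)\<^sup>T = (Y \<mu>)\<^sup>T * const_mat U"
    using U by (subst transpose_mult[of _ k n _ k]) auto
  moreover have "det ((const_mat U)\<^sup>T * Y \<mu>)\<^sup>T = det ((const_mat U)\<^sup>T * Y \<mu>)"
    by (rule det_transpose[of _ k]) (use U in auto)
  ultimately show ?thesis by (simp add: chain_det_def)
qed

abbreviation update :: "complex mat \<Rightarrow> complex mat \<Rightarrow> complex mat \<Rightarrow> (nat \<Rightarrow> complex) \<Rightarrow> complex \<Rightarrow> complex mat" where
  "update M U W a \<tau> \<equiv> M + \<tau> \<cdot>\<^sub>m (U * mat_diag k a * W\<^sup>T)"

text \<open>This is \<open>det_rank_update\<close> over polynomials with the grouped left factor.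
  The multiplicities of eigenvalues below are read off as orders of its factors.\<close>

lemma det_update:
  assumes U: "U \<in> carrier_mat n k" and W: "W \<in> carrier_mat n k"
  shows "det (pencil_poly (update A U W a \<tau>) (update B U W b \<tau>) \<mu>) =
    rho \<mu> * p \<mu> U * q \<mu> W * [:\<tau> ^ k:] * det (pencil_poly (mat_diag k a) (mat_diag k b) \<mu>)"
proof -
  interpret null_frame n k "pencil_poly A B \<mu>" "X \<mu>" "Y \<mu>" "const_mat (U0 \<mu>)" "const_mat (W0 \<mu>)"
    by (rule frame)
  let ?D = "pencil_poly (mat_diag k a) (mat_diag k b) \<mu>"
  have D: "?D \<in> carrier_mat k k" by auto
  have cU: "const_mat U \<in> carrier_mat n k" using U by auto
  have t: "const_mat (\<tau> \<cdot>\<^sub>m U) = [:\<tau>:] \<cdot>\<^sub>m const_mat U"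
    by (rule eq_matI) auto
  have YU: "(Y \<mu>)\<^sup>T * const_mat U \<in> carrier_mat k k" using U by auto
  have "(Y \<mu>)\<^sup>T * (const_mat (\<tau> \<cdot>\<^sub>m U) * ?D) = (Y \<mu>)\<^sup>T * const_mat (\<tau> \<cdot>\<^sub>m U) * ?D"
    by (rule assoc_mult_mat[symmetric, of _ k n _ k _ k]) (use U D in auto)
  also have "(Y \<mu>)\<^sup>T * const_mat (\<tau> \<cdot>\<^sub>m U) = [:\<tau>:] \<cdot>\<^sub>m ((Y \<mu>)\<^sup>T * const_mat U)"
    unfolding t by (rule mult_smult_distrib[of _ k n _ k]) (use U in auto)
  finally have *: "det ((Y \<mu>)\<^sup>T * (const_mat (\<tau> \<cdot>\<^sub>m U) * ?D)) =
      det ([:\<tau>:] \<cdot>\<^sub>m ((Y \<mu>)\<^sup>T * const_mat U)) * det ?D"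
    using det_mult[OF _ D, of "[:\<tau>:] \<cdot>\<^sub>m ((Y \<mu>)\<^sup>T * const_mat U)"] YU by simp
  have "det ([:\<tau>:] \<cdot>\<^sub>m ((Y \<mu>)\<^sup>T * const_mat U)) = [:\<tau> ^ k:] * p \<mu> U"
    unfolding det_smult det_Y[OF U] using U by (simp add: poly_const_pow)
  note * = *[unfolded this]
  have "const_mat (\<tau> \<cdot>\<^sub>m U) * ?D \<in> carrier_mat n k" using U D by (intro mult_carrier_mat[of _ n k]) auto
  then have "det (pencil_poly A B \<mu> + const_mat (\<tau> \<cdot>\<^sub>m U) * ?D * (const_mat W)\<^sup>T) =
      rho \<mu> * det ((Y \<mu>)\<^sup>T * (const_mat (\<tau> \<cdot>\<^sub>m U) * ?D)) * q \<mu> W"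
    using W by (subst det_rank_update) (auto simp: bordered_def rho_def chain_det_def)
  then show ?thesis
    unfolding pencil_poly_update[OF A B U W] * by (simp only: mult_ac)
qed

lemma frame_at:
  "field_null_frame n k (pencil_at A B \<mu>) (eval_mat (chart_point \<mu>) (X \<mu>)) (eval_mat (chart_point \<mu>) (Y \<mu>)) (U0 \<mu>) (W0 \<mu>)"
  using null_frame_map[OF comm_ring_hom_eval frame, of "chart_point \<mu>" \<mu>]
  by (simp add: eval_pencil_poly[OF A B] field_null_frame_def)

lemma det_bordered_at:
  "det (null_frame.bordered (pencil_at A B \<mu>) (U0 \<mu>) (W0 \<mu>)) = poly (rho \<mu>) (chart_point \<mu>)"
proof -
  interpret field_null_frame n k "pencil_at A B \<mu>" "eval_mat (chart_point \<mu>) (X \<mu>)"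
    "eval_mat (chart_point \<mu>) (Y \<mu>)" "U0 \<mu>" "W0 \<mu>" by (rule frame_at)
  let ?ev = "eval_mat (chart_point \<mu>)"
  have "?ev (pencil_poly A B \<mu> + const_mat (U0 \<mu>) * (const_mat (W0 \<mu>))\<^sup>T)
    = ?ev (pencil_poly A B \<mu>) + ?ev (const_mat (U0 \<mu>) * (const_mat (W0 \<mu>))\<^sup>T)"
    by (rule eq_matI) (use A in auto)
  also have "?ev (const_mat (U0 \<mu>) * (const_mat (W0 \<mu>))\<^sup>T) = U0 \<mu> * (W0 \<mu>)\<^sup>T"
    by (subst eval_mat_mult[of _ n k _ n]) (auto simp: map_mat_transpose)
  finally show ?thesis
    unfolding rho_def poly_det bordered_def eval_pencil_poly[OF A B] by (rule arg_cong[of _ _ det, symmetric])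
qed

text \<open>Evaluates \<open>rank_ge_iff\<close> at a point: for normal rank \<open>n - k\<close>
  the eigenvalues of the singular pencil are the zeros of \<open>rho\<close>, at infinity
  too.\<close>

lemma rank_ge_iff_rho:
  assumes "k \<le> n"
  shows "n - k \<le> mat_rank (pencil_at A B \<mu>) \<longleftrightarrow> poly (rho \<mu>) (chart_point \<mu>) \<noteq> 0"
proof -
  interpret field_null_frame n k "pencil_at A B \<mu>" "eval_mat (chart_point \<mu>) (X \<mu>)"
    "eval_mat (chart_point \<mu>) (Y \<mu>)" "U0 \<mu>" "W0 \<mu>" by (rule frame_at)
  have "dim_row (pencil_at A B \<mu>) = n" by simp
  then show ?thesis using rank_ge_iff[OF assms] by (simp add: mat_rank_def det_bordered_at)
qed

lemma det_Y_at:
  assumes U: "U \<in> carrier_mat n k"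
  shows "det ((eval_mat z (Y \<mu>))\<^sup>T * U) = poly (p \<mu> U) z"
proof -
  have "(eval_mat z (Y \<mu>))\<^sup>T * U = eval_mat z ((Y \<mu>)\<^sup>T * const_mat U)"
    using U by (subst eval_mat_mult[of _ k n _ k]) (auto simp: map_mat_transpose)
  then show ?thesis unfolding det_Y[OF U, symmetric] poly_det by (rule arg_cong)
qed

lemma constant_eigenvector:
  assumes U: "U \<in> carrier_mat n k" and W: "W \<in> carrier_mat n k"
    and "poly (q \<mu> W) (chart_point \<mu>) = 0"
  obtains x where "x \<in> carrier_vec n" "x \<noteq> 0\<^sub>v n" "W\<^sup>T *\<^sub>v x = 0\<^sub>v k"
    "\<And>\<tau>. pencil_at (update A U W a \<tau>) (update B U W b \<tau>) \<mu> *\<^sub>v x = 0\<^sub>v n"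
proof -
  interpret field_null_frame n k "pencil_at A B \<mu>" "eval_mat (chart_point \<mu>) (X \<mu>)"
    "eval_mat (chart_point \<mu>) (Y \<mu>)" "U0 \<mu>" "W0 \<mu>" by (rule frame_at)
  obtain x where x: "x \<in> carrier_vec n" "x \<noteq> 0\<^sub>v n" "pencil_at A B \<mu> *\<^sub>v x = 0\<^sub>v n" "W\<^sup>T *\<^sub>v x = 0\<^sub>v k"
    using constant_eigenvectorE[OF W] assms(3) chain_det_value[OF W] by metis
  let ?E = "U * pencil_at (mat_diag k a) (mat_diag k b) \<mu>"
  have E: "?E \<in> carrier_mat n k" using U by auto
  have "?E *\<^sub>v 0\<^sub>v k = 0\<^sub>v n" by (rule mult_zero_vec[OF E])
  then have "pencil_at (update A U W a \<tau>) (update B U W b \<tau>) \<mu> *\<^sub>v x = 0\<^sub>v n" for \<tau>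
    unfolding pencil_at_update[OF A B U W] perturbed_mult_vec[OF E W x(1)]
    by (simp add: x smult_zero_vec)
  then show ?thesis using that x by blast
qed

lemma linear_eigenvector:
  assumes U: "U \<in> carrier_mat n k" and W: "W \<in> carrier_mat n k"
    and nz: "poly (rho \<mu>) (chart_point \<mu>) \<noteq> 0" "poly (q \<mu> W) (chart_point \<mu>) \<noteq> 0"
    and z: "poly (p \<mu> U) (chart_point \<mu>) = 0"
  obtains w z where "w \<in> carrier_vec n" "z \<in> carrier_vec n"
    "\<And>\<tau>. pencil_at (update A U W a \<tau>) (update B U W b \<tau>) \<mu> *\<^sub>v (w + \<tau> \<cdot>\<^sub>v z) = 0\<^sub>v n"
    "\<And>\<tau>. W\<^sup>T *\<^sub>v (w + \<tau> \<cdot>\<^sub>v z) \<noteq> 0\<^sub>v k"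
proof -
  interpret field_null_frame n k "pencil_at A B \<mu>" "eval_mat (chart_point \<mu>) (X \<mu>)"
    "eval_mat (chart_point \<mu>) (Y \<mu>)" "U0 \<mu>" "W0 \<mu>" by (rule frame_at)
  let ?D = "pencil_at (mat_diag k a) (mat_diag k b) \<mu>"
  let ?Y = "eval_mat (chart_point \<mu>) (Y \<mu>)"
  have E: "U * ?D \<in> carrier_mat n k" using U by auto
  have "?Y\<^sup>T * (U * ?D) = ?Y\<^sup>T * U * ?D"
    by (rule assoc_mult_mat[symmetric, of _ k n _ k _ k]) (use U in auto)
  moreover have "det (?Y\<^sup>T * U * ?D) = det (?Y\<^sup>T * U) * det ?D"
    by (rule det_mult[of _ k]) (use U in auto)
  ultimately have "det (?Y\<^sup>T * (U * ?D)) = 0" using z by (simp add: det_Y_at[OF U])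
  then obtain w z where "w \<in> carrier_vec n" "z \<in> carrier_vec n"
    "\<And>\<tau>. (pencil_at A B \<mu> + \<tau> \<cdot>\<^sub>m (U * ?D * W\<^sup>T)) *\<^sub>v (w + \<tau> \<cdot>\<^sub>v z) = 0\<^sub>v n"
    "\<And>\<tau>. W\<^sup>T *\<^sub>v (w + \<tau> \<cdot>\<^sub>v z) \<noteq> 0\<^sub>v k"
    using linear_eigenvectorE[OF E W] nz unfolding det_bordered_at chain_det_value[OF W] by blast
  then show ?thesis using that unfolding pencil_at_update[OF A B U W] by blast
qed

lemma updated_kernel_iff:
  assumes U: "U \<in> carrier_mat n k" and W: "W \<in> carrier_mat n k"
    and "poly (p \<mu> U) (chart_point \<mu>) \<noteq> 0" "\<tau> \<noteq> 0" "x \<in> carrier_vec n"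
  shows "pencil_at (update A U W a \<tau>) (update B U W b \<tau>) \<mu> *\<^sub>v x = 0\<^sub>v n \<longleftrightarrow>
    pencil_at A B \<mu> *\<^sub>v x = 0\<^sub>v n \<and>
    pencil_at (mat_diag k a) (mat_diag k b) \<mu> *\<^sub>v (W\<^sup>T *\<^sub>v x) = 0\<^sub>v k"
proof -
  interpret field_null_frame n k "pencil_at A B \<mu>" "eval_mat (chart_point \<mu>) (X \<mu>)"
    "eval_mat (chart_point \<mu>) (Y \<mu>)" "U0 \<mu>" "W0 \<mu>" by (rule frame_at)
  show ?thesis unfolding pencil_at_update[OF A B U W]
    by (rule perturbed_kernel_iff) (use assms in \<open>auto simp: det_Y_at\<close>)
qed

lemma updated_kernel_cap_trivial:
  assumes U: "U \<in> carrier_mat n k" and W: "W \<in> carrier_mat n k"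
    and "poly (rho \<mu>) (chart_point \<mu>) \<noteq> 0" "poly (q \<mu> W) (chart_point \<mu>) \<noteq> 0"
    and "pencil_at A B \<mu> *\<^sub>v x = 0\<^sub>v n" "W\<^sup>T *\<^sub>v x = 0\<^sub>v k" "x \<in> carrier_vec n"
  shows "x = 0\<^sub>v n"
proof -
  interpret field_null_frame n k "pencil_at A B \<mu>" "eval_mat (chart_point \<mu>) (X \<mu>)"
    "eval_mat (chart_point \<mu>) (Y \<mu>)" "U0 \<mu>" "W0 \<mu>" by (rule frame_at)
  show ?thesis
    by (rule kernel_cap_trivial[OF W]) (use assms in \<open>auto simp: det_bordered_at chain_det_value[OF W]\<close>)
qed

end

section \<open>Regular pencils, null spaces and adjoints\<close>

lemma mat_rank_le: "M \<in> carrier_mat n n \<Longrightarrow> mat_rank M \<le> n"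
  by (auto simp: mat_rank_def intro: vec_space.rank_le_nc)

lemma mat_rank_less_iff: "M \<in> carrier_mat n n \<Longrightarrow> mat_rank M < n \<longleftrightarrow> det M = 0"
proof -
  assume M: "M \<in> carrier_mat n n"
  then have "dim_row M = n" by simp
  with vec_space.det_rank_iff[OF M] mat_rank_le[OF M] show ?thesis
    by (auto simp: mat_rank_def)
qed

lemma nrank_attained:
  assumes "A \<in> carrier_mat n n" "B \<in> carrier_mat n n"
  obtains z where "mat_rank (A - z \<cdot>\<^sub>m B) = nrank A B"
    and "\<And>w. mat_rank (A - w \<cdot>\<^sub>m B) \<le> nrank A B"
proof -
  let ?R = "range (\<lambda>z. mat_rank (A - z \<cdot>\<^sub>m B))"
  have "?R \<subseteq> {..n}" using assms by (auto intro!: mat_rank_le)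
  then have fin: "finite ?R" by (rule finite_subset) simp
  then have "nrank A B \<in> ?R" unfolding nrank_def by (rule Max_in) simp
  then obtain z where z: "nrank A B = mat_rank (A - z \<cdot>\<^sub>m B)" by (rule rangeE)
  have "mat_rank (A - w \<cdot>\<^sub>m B) \<le> nrank A B" for w
    unfolding nrank_def by (rule Max_ge[OF fin]) simp
  with z[symmetric] show ?thesis by (rule that)
qed

lemma poly_pencil_det:
  assumes "A \<in> carrier_mat n n" "B \<in> carrier_mat n n"
  shows "poly (pencil_det A B) z = det (A - z \<cdot>\<^sub>m B)"
proof -
  have "eval_mat z (pencil_poly A B (Fin_ev z)) = A - z \<cdot>\<^sub>m B"
    using eval_pencil_poly[OF assms, of "Fin_ev z"] by simp
  then show ?thesis unfolding pencil_det_eq(1)[OF assms, of z] poly_det by (rule arg_cong)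
qed

lemma nrank_regular:
  assumes A: "A \<in> carrier_mat n n" and B: "B \<in> carrier_mat n n" and "regular_pencil A B"
  shows "nrank A B = n"
proof -
  obtain z where z: "mat_rank (A - z \<cdot>\<^sub>m B) = nrank A B" "\<And>w. mat_rank (A - w \<cdot>\<^sub>m B) \<le> nrank A B"
    by (rule nrank_attained[OF A B]) (rule that)
  have "pencil_det A B \<noteq> 0" using assms by (simp add: regular_pencil_def singular_pencil_def)
  then obtain w where "poly (pencil_det A B) w \<noteq> 0" using poly_all_0_iff_0 by blast
  then have "\<not> mat_rank (A - w \<cdot>\<^sub>m B) < n"
    using A B by (subst mat_rank_less_iff[of _ n]) (auto simp: poly_pencil_det)
  moreover have "mat_rank (A - z \<cdot>\<^sub>m B) \<le> n" using A B by (intro mat_rank_le) auto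
  ultimately show ?thesis using z(1) z(2)[of w] by linarith
qed

lemma pencil_eigenvalue_regular_iff:
  assumes A: "A \<in> carrier_mat n n" and B: "B \<in> carrier_mat n n" and "regular_pencil A B"
  shows "pencil_eigenvalue A B \<mu> \<longleftrightarrow> poly (det (pencil_poly A B \<mu>)) (chart_point \<mu>) = 0"
  unfolding pencil_eigenvalue_def nrank_regular[OF assms] poly_det eval_pencil_poly[OF A B]
  by (rule mat_rank_less_iff[OF pencil_at_carrier[OF A B]])

lemma regular_pencil_iff:
  assumes A: "A \<in> carrier_mat n n" and B: "B \<in> carrier_mat n n"
  shows "regular_pencil A B \<longleftrightarrow> det (pencil_poly A B (Fin_ev 0)) \<noteq> 0"
  unfolding regular_pencil_def singular_pencil_def pencil_det_eq(1)[OF A B, of 0] ..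

lemma mat_adjoint_eq: "mat_adjoint M = (map_mat cnj M)\<^sup>T"
  by (rule eq_matI) (auto simp: mat_adjoint_def mat_of_rows_def conjugate_complex_def)

lemma mat_adjoint_dim [simp]: "dim_row (mat_adjoint M) = dim_col M" "dim_col (mat_adjoint M) = dim_row M"
  by (simp_all add: mat_adjoint_def)

lemma mat_adjoint_mult_vec:
  fixes M :: "complex mat"
  assumes "M \<in> carrier_mat m n" "y \<in> carrier_vec m"
  shows "mat_adjoint M *\<^sub>v y = conjugate (M\<^sup>T *\<^sub>v conjugate y)"
proof (rule eq_vecI)
  fix i assume "i < dim_vec (conjugate (M\<^sup>T *\<^sub>v conjugate y))"
  then have i: "i < n" using assms by simp
  have "(mat_adjoint M *\<^sub>v y) $ i = (\<Sum>j = 0..<m. cnj (M $$ (j, i)) * y $ j)"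
    unfolding mat_adjoint_eq using i assms by (simp add: scalar_prod_def)
  also have "\<dots> = cnj (\<Sum>j = 0..<m. M $$ (j, i) * cnj (y $ j))" by (simp add: cnj_sum)
  also have "\<dots> = conjugate (M\<^sup>T *\<^sub>v conjugate y) $ i"
    using i assms by (simp add: scalar_prod_def conjugate_complex_def)
  finally show "(mat_adjoint M *\<^sub>v y) $ i = conjugate (M\<^sup>T *\<^sub>v conjugate y) $ i" .
qed (use assms in simp)

lemma conjugate_eq_zero_iff: "conjugate y = 0\<^sub>v m \<longleftrightarrow> y = (0\<^sub>v m :: complex vec)"
  by (auto simp: vec_eq_iff conjugate_complex_def)

lemma order_mult_nonroot:
  fixes c h :: "'a::idom poly"
  assumes "poly c z \<noteq> 0"
  shows "order z (c * h) = order z h"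
proof (cases "h = 0")
  case False
  moreover have "c \<noteq> 0" using assms by auto
  ultimately show ?thesis using assms by (simp add: order_mult order_0I)
qed simp

lemma right_nullspace_iff:
  assumes "A \<in> carrier_mat n n" "B \<in> carrier_mat n n"
  shows "x \<in> right_nullspace A B \<mu> \<longleftrightarrow> x \<in> carrier_vec n \<and> pencil_at A B \<mu> *\<^sub>v x = 0\<^sub>v n"
  unfolding right_nullspace_def mat_kernel[OF pencil_at_carrier[OF assms]] by (rule mem_Collect_eq)

text \<open>Conjugating the vector turns the adjoint into the transpose; the transposed pencil is
  taken at the same \<mu>, not at its conjugate.\<close>

lemma left_nullspace_iff:
  assumes A: "A \<in> carrier_mat n n" and B: "B \<in> carrier_mat n n"
  shows "y \<in> left_nullspace A B \<mu> \<longleftrightarrow> conjugate y \<in> right_nullspace A\<^sup>T B\<^sup>T \<mu>"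
proof -
  have P: "pencil_at A B \<mu> \<in> carrier_mat n n" using A B by auto
  then have adj: "mat_adjoint (pencil_at A B \<mu>) \<in> carrier_mat n n" by auto
  have "y \<in> left_nullspace A B \<mu> \<longleftrightarrow> y \<in> carrier_vec n \<and> mat_adjoint (pencil_at A B \<mu>) *\<^sub>v y = 0\<^sub>v n"
    unfolding left_nullspace_def mat_kernel[OF adj] by auto
  also have "\<dots> \<longleftrightarrow> y \<in> carrier_vec n \<and> (pencil_at A B \<mu>)\<^sup>T *\<^sub>v conjugate y = 0\<^sub>v n"
    by (intro conj_cong refl, subst mat_adjoint_mult_vec[OF P]) (simp_all add: conjugate_eq_zero_iff)
  finally have 1: "y \<in> left_nullspace A B \<mu> \<longleftrightarrow>
    y \<in> carrier_vec n \<and> (pencil_at A B \<mu>)\<^sup>T *\<^sub>v conjugate y = 0\<^sub>v n" .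
  have 2: "conjugate y \<in> right_nullspace A\<^sup>T B\<^sup>T \<mu> \<longleftrightarrow>
    conjugate y \<in> carrier_vec n \<and> (pencil_at A B \<mu>)\<^sup>T *\<^sub>v conjugate y = 0\<^sub>v n"
    unfolding pencil_at_transpose[OF A B, symmetric]
    by (rule right_nullspace_iff) (use A B in auto)
  have 3: "conjugate y \<in> carrier_vec n \<longleftrightarrow> y \<in> carrier_vec n"
    using carrier_vec_conjugate[of y n] carrier_vec_conjugate[of "conjugate y" n] by (simp only: conjugate_id) blast
  show ?thesis unfolding 1 2 3 ..
qed

lemma right_eigenvector_iff:
  assumes "A \<in> carrier_mat n n" "B \<in> carrier_mat n n"
  shows "right_eigenvector A B \<mu> x \<longleftrightarrow>
    x \<in> carrier_vec n \<and> x \<noteq> 0\<^sub>v n \<and> pencil_at A B \<mu> *\<^sub>v x = 0\<^sub>v n"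
proof -
  have dim: "dim_col A = n" using assms by simp
  show ?thesis unfolding right_eigenvector_def right_nullspace_iff[OF assms] dim by blast
qed

lemma left_eigenvector_iff:
  assumes A: "A \<in> carrier_mat n n" and B: "B \<in> carrier_mat n n"
  shows "left_eigenvector A B \<mu> y \<longleftrightarrow> right_eigenvector A\<^sup>T B\<^sup>T \<mu> (conjugate y)"
proof -
  have "y \<noteq> 0\<^sub>v (dim_row A) \<longleftrightarrow> conjugate y \<noteq> 0\<^sub>v (dim_col A\<^sup>T)"
    using conjugate_eq_zero_iff by simp
  then show ?thesis
    unfolding left_eigenvector_def right_eigenvector_def left_nullspace_iff[OF A B] by blast
qed

section \<open>The perturbed pencil for one generic choice of \<open>U\<close> and
  \<open>W\<close>\<close>

text \<open>\<open>W\<close> is the entrywise conjugate of \<open>V\<close>, so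
  \<open>W\<^sup>T\<close> is the adjoint of \<open>V\<close>. The generic conditions are symmetric
  in \<open>q\<close> and \<open>p\<close>, most of them being put on the product, which makes the
  locale stable under transposition.\<close>

locale perturbation = pencil_chains n k A B dX f g dY f' g'
  for n k :: nat and A B :: "complex mat" and dX f g dY f' g' +
  fixes U W :: "complex mat" and a b :: "nat \<Rightarrow> complex"
  assumes U: "U \<in> carrier_mat n k" and W: "W \<in> carrier_mat n k"
    and regular_D: "regular_pencil (mat_diag k a) (mat_diag k b)"
    and rho_nonzero: "rho (Fin_ev 0) \<noteq> 0"
    and gamma: "\<And>j \<mu>. j < k \<Longrightarrow> \<mu> = ev_quotient (a j) (b j) \<Longrightarrow> poly (rho \<mu>) (chart_point \<mu>) \<noteq> 0 \<and>
      poly (q \<mu> W) (chart_point \<mu>) \<noteq> 0 \<and> poly (p \<mu> U) (chart_point \<mu>) \<noteq> 0"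
    and squarefree: "rsquarefree (q (Fin_ev 0) W * p (Fin_ev 0) U)"
    and degree_sum: "degree (q (Fin_ev 0) W * p (Fin_ev 0) U) = (\<Sum>j<k. dX j) + (\<Sum>j<k. dY j)"
    and rho_root: "\<And>z. poly (rho (Fin_ev 0)) z = 0 \<Longrightarrow> poly (q (Fin_ev 0) W * p (Fin_ev 0) U) z \<noteq> 0"
begin

abbreviation "At \<equiv> update A U W a"
abbreviation "Bt \<equiv> update B U W b"
abbreviation "DA \<equiv> mat_diag k a"
abbreviation "DB \<equiv> mat_diag k b"

lemma At [simp]: "At \<tau> \<in> carrier_mat n n" and Bt [simp]: "Bt \<tau> \<in> carrier_mat n n"
  using A B U W by auto

lemma transposed_perturbation: "perturbation n k A\<^sup>T B\<^sup>T dY f' g' dX f g W U a b"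
proof -
  interpret T: pencil_chains n k "A\<^sup>T" "B\<^sup>T" dY f' g' dX f g by (rule transposed)
  show ?thesis
  proof (unfold_locales, unfold rho_transposed)
    show "rsquarefree (p (Fin_ev 0) U * q (Fin_ev 0) W)"
      using squarefree by (simp only: mult.commute)
    show "degree (p (Fin_ev 0) U * q (Fin_ev 0) W) = (\<Sum>j<k. dY j) + (\<Sum>j<k. dX j)"
      using degree_sum by (simp only: mult.commute add.commute)
    show "poly (p (Fin_ev 0) U * q (Fin_ev 0) W) z \<noteq> 0" if "poly (rho (Fin_ev 0)) z = 0" for z
      using rho_root[OF that] by (subst mult.commute)
    show "poly (rho \<mu>) (chart_point \<mu>) \<noteq> 0 \<and> poly (p \<mu> U) (chart_point \<mu>) \<noteq> 0 \<and>
        poly (q \<mu> W) (chart_point \<mu>) \<noteq> 0"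
      if "j < k" "\<mu> = ev_quotient (a j) (b j)" for j \<mu>
      using gamma[OF that] by blast
  qed (rule U W regular_D rho_nonzero)+
qed

lemma update_transpose:
  assumes M: "M \<in> carrier_mat n n"
  shows "(update M U W c \<tau>)\<^sup>T = update M\<^sup>T W U c \<tau>"
proof (rule eq_matI)
  fix i j assume "i < dim_row (update M\<^sup>T W U c \<tau>)" "j < dim_col (update M\<^sup>T W U c \<tau>)"
  then have ij: "i < n" "j < n" using M U W by auto
  show "(update M U W c \<tau>)\<^sup>T $$ (i, j) = update M\<^sup>T W U c \<tau> $$ (i, j)"
    using ij M U W
    by (simp add: mult_diag_transpose_index[OF U W ij(2,1)] mult_diag_transpose_index[OF W U ij] mult_ac)
qed (use M U W in auto)

text \<open>The determinant of the diagonal pencil is the product of its entries, so regularity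
  excludes the quotient 0/0.\<close>

lemma diag_nonzero: "j < k \<Longrightarrow> a j \<noteq> 0 \<or> b j \<noteq> 0"
proof (rule ccontr)
  assume j: "j < k" and "\<not> (a j \<noteq> 0 \<or> b j \<noteq> 0)"
  then have "(\<Prod>l<k. chart_s (Fin_ev 0) * [:a l:] - chart_t (Fin_ev 0) * [:b l:]) = 0"
    by (intro prod_zero) auto
  then show False
    using regular_D regular_pencil_iff[of DA k DB] by (simp add: pencil_poly_diag det_mat_diag)
qed

lemma det_D_nonzero: "det (pencil_poly DA DB \<mu>) \<noteq> 0"
  unfolding pencil_poly_diag det_mat_diag
proof (subst prod_zero_iff; safe?)
  fix j assume "j < k" "chart_s \<mu> * [:a j:] - chart_t \<mu> * [:b j:] = 0"
  then show False using diag_nonzero[of j] by (cases \<mu>) auto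
qed

lemma det_D_root_iff:
  "poly (det (pencil_poly DA DB \<mu>)) (chart_point \<mu>) = 0 \<longleftrightarrow> (\<exists>j<k. \<mu> = ev_quotient (a j) (b j))"
proof -
  have "(chart_s \<mu> * [:a j:] - chart_t \<mu> * [:b j:] = c \<longrightarrow> poly c (chart_point \<mu>) = 0) \<longleftrightarrow>
      \<mu> = ev_quotient (a j) (b j)"
    if "j < k" "c = chart_s \<mu> * [:a j:] - chart_t \<mu> * [:b j:]" for j c
    using diag_nonzero[OF that(1)] that(2) by (cases \<mu>) (auto simp: ev_quotient_def field_simps)
  then show ?thesis
    unfolding pencil_poly_diag det_mat_diag poly_prod by (subst prod_zero_iff) auto
qed

lemma factors_nonzero: "q (Fin_ev 0) W \<noteq> 0" "p (Fin_ev 0) U \<noteq> 0"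
  using squarefree by (auto simp: rsquarefree_def)

lemma regular: "\<tau> \<noteq> 0 \<Longrightarrow> regular_pencil (At \<tau>) (Bt \<tau>)"
  unfolding regular_pencil_iff[OF At Bt] det_update[OF U W]
  using rho_nonzero factors_nonzero det_D_nonzero[of "Fin_ev 0"] by simp

lemma root_nonzero:
  assumes "poly (q (Fin_ev 0) W * p (Fin_ev 0) U) z = 0"
  shows "poly (rho (Fin_ev z)) z \<noteq> 0" and "j < k \<Longrightarrow> Fin_ev z \<noteq> ev_quotient (a j) (b j)"
proof -
  show "poly (rho (Fin_ev z)) z \<noteq> 0" using rho_root[of z] assms by (auto simp: rho_Fin[of z])
  show "Fin_ev z \<noteq> ev_quotient (a j) (b j)" if "j < k"
  proof
    assume "Fin_ev z = ev_quotient (a j) (b j)"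
    then have "poly (q (Fin_ev z) W) z \<noteq> 0 \<and> poly (p (Fin_ev z) U) z \<noteq> 0"
      using gamma[OF that, of "Fin_ev z"] unfolding chart_point.simps by blast
    then show False using assms by (simp add: chain_det_Fin[of _ _ _ _ z])
  qed
qed

text \<open>All factors of the determinant besides \<open>q\<close> and \<open>p\<close> are nonzero
  at \<open>z\<close>, so the multiplicity is the order of \<open>z\<close> in their square-free
  product.\<close>

lemma simple_root:
  assumes root: "poly (q (Fin_ev 0) W * p (Fin_ev 0) U) z = 0" and "\<tau> \<noteq> 0"
  shows "simple_eigenvalue (At \<tau>) (Bt \<tau>) (Fin_ev z)"
proof -
  let ?F = "Fin_ev z"
  define c where "c = rho ?F * [:\<tau> ^ k:] * det (pencil_poly DA DB ?F)"
  have eq: "det (pencil_poly (At \<tau>) (Bt \<tau>) ?F) = c * (q (Fin_ev 0) W * p (Fin_ev 0) U)"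
    unfolding det_update[OF U W] c_def chain_det_Fin[of _ _ _ _ z] by (simp only: mult_ac)
  have "poly (det (pencil_poly DA DB ?F)) z \<noteq> 0"
    using det_D_root_iff[of ?F] root_nonzero(2)[OF root] by auto
  then have "poly c z \<noteq> 0" using root_nonzero(1)[OF root] \<open>\<tau> \<noteq> 0\<close> by (simp add: c_def)
  then have "alg_mult (At \<tau>) (Bt \<tau>) ?F = order z (q (Fin_ev 0) W * p (Fin_ev 0) U)"
    unfolding alg_mult_eq[OF At Bt] eq chart_point.simps by (rule order_mult_nonroot)
  also have "\<dots> = 1" using squarefree root by (intro rsquarefree_root_order) (auto simp: rsquarefree_def)
  finally show ?thesis
    using regular[OF \<open>\<tau> \<noteq> 0\<close>] root
    by (simp add: simple_eigenvalue_def pencil_eigenvalue_regular_iff[OF At Bt] eq del: alg_mult.simps)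
qed

text \<open>A common root would have order at least 2 in the square-free product.\<close>

lemma roots_disjoint:
  assumes "poly (q (Fin_ev 0) W) z = 0" "poly (p (Fin_ev 0) U) z = 0"
  shows False
proof -
  have "order z (q (Fin_ev 0) W * p (Fin_ev 0) U) = order z (q (Fin_ev 0) W) + order z (p (Fin_ev 0) U)"
    using factors_nonzero by (intro order_mult) simp
  moreover have "order z (q (Fin_ev 0) W) \<noteq> 0" "order z (p (Fin_ev 0) U) \<noteq> 0"
    using assms factors_nonzero by (auto simp: order_root)
  moreover have "order z (q (Fin_ev 0) W * p (Fin_ev 0) U) = 0 \<or>
      order z (q (Fin_ev 0) W * p (Fin_ev 0) U) = 1"
    using squarefree unfolding rsquarefree_def by blast
  ultimately show False by linarith
qed

text \<open>Both factors obey a degree bound and the degree of the product equals the sum of the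
  bounds, so each bound is attained; a factor of a square-free polynomial has as many roots as its
  degree.\<close>

lemma card_roots: "card {z. poly (q (Fin_ev 0) W) z = 0} = (\<Sum>j<k. dX j)"
proof -
  have dq: "degree (q (Fin_ev 0) W) \<le> (\<Sum>j<k. dX j)" by (rule degree_chain_det_le[OF W])
  have dp: "degree (p (Fin_ev 0) U) \<le> (\<Sum>j<k. dY j)" by (rule degree_chain_det_le[OF U])
  have "degree (q (Fin_ev 0) W) = (\<Sum>j<k. dX j)"
    using dq dp degree_sum factors_nonzero by (simp add: degree_mult_eq)
  moreover have "rsquarefree (q (Fin_ev 0) W)"
    unfolding rsquarefree_def
  proof (intro conjI allI)
    show "q (Fin_ev 0) W \<noteq> 0" by (rule factors_nonzero)
    fix z
    have "order z (q (Fin_ev 0) W * p (Fin_ev 0) U) = order z (q (Fin_ev 0) W) + order z (p (Fin_ev 0) U)"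
      using factors_nonzero by (intro order_mult) simp
    moreover have "order z (q (Fin_ev 0) W * p (Fin_ev 0) U) = 0 \<or> order z (q (Fin_ev 0) W * p (Fin_ev 0) U) = 1"
      using squarefree unfolding rsquarefree_def by blast
    ultimately show "order z (q (Fin_ev 0) W) = 0 \<or> order z (q (Fin_ev 0) W) = 1" by linarith
  qed
  ultimately show ?thesis using rsquarefree_card_roots[of "q (Fin_ev 0) W"] by simp
qed

lemma constant_right_eigenvector:
  assumes "poly (q (Fin_ev 0) W) z = 0"
  shows "\<exists>x. \<forall>\<tau>. right_eigenvector (At \<tau>) (Bt \<tau>) (Fin_ev z) x \<and> W\<^sup>T *\<^sub>v x = 0\<^sub>v k"
proof -
  have "poly (q (Fin_ev z) W) (chart_point (Fin_ev z)) = 0"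
    using assms by (simp add: chain_det_Fin[of _ _ _ _ z])
  then obtain x where "x \<in> carrier_vec n" "x \<noteq> 0\<^sub>v n" "W\<^sup>T *\<^sub>v x = 0\<^sub>v k"
    "\<And>\<tau>. pencil_at (At \<tau>) (Bt \<tau>) (Fin_ev z) *\<^sub>v x = 0\<^sub>v n"
    using constant_eigenvector[OF U W] by blast
  then show ?thesis unfolding right_eigenvector_iff[OF At Bt] by blast
qed

lemma linear_right_eigenvector:
  assumes root: "poly (p (Fin_ev 0) U) z = 0"
  shows "\<exists>x. linear_function n x \<and>
    (\<forall>\<tau>. right_eigenvector (At \<tau>) (Bt \<tau>) (Fin_ev z) (x \<tau>) \<and> W\<^sup>T *\<^sub>v x \<tau> \<noteq> 0\<^sub>v k)"
proof -
  have "poly (p (Fin_ev z) U) (chart_point (Fin_ev z)) = 0"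
    using root by (simp add: chain_det_Fin[of _ _ _ _ z])
  moreover have "poly (q (Fin_ev z) W) (chart_point (Fin_ev z)) \<noteq> 0"
    using roots_disjoint root by (auto simp: chain_det_Fin[of _ _ _ _ z])
  moreover have "poly (rho (Fin_ev z)) (chart_point (Fin_ev z)) \<noteq> 0"
    using root_nonzero(1) root by simp
  ultimately obtain w z' where wz: "w \<in> carrier_vec n" "z' \<in> carrier_vec n"
    "\<And>\<tau>. pencil_at (At \<tau>) (Bt \<tau>) (Fin_ev z) *\<^sub>v (w + \<tau> \<cdot>\<^sub>v z') = 0\<^sub>v n"
    "\<And>\<tau>. W\<^sup>T *\<^sub>v (w + \<tau> \<cdot>\<^sub>v z') \<noteq> 0\<^sub>v k"
    using linear_eigenvector[OF U W] by blast
  have "W\<^sup>T *\<^sub>v 0\<^sub>v n = 0\<^sub>v k" by (rule mult_zero_vec) (use W in auto)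
  then have "w + \<tau> \<cdot>\<^sub>v z' \<noteq> 0\<^sub>v n" for \<tau> using wz(4) by metis
  then have "\<forall>\<tau>. right_eigenvector (At \<tau>) (Bt \<tau>) (Fin_ev z) (w + \<tau> \<cdot>\<^sub>v z') \<and> W\<^sup>T *\<^sub>v (w + \<tau> \<cdot>\<^sub>v z') \<noteq> 0\<^sub>v k"
    unfolding right_eigenvector_iff[OF At Bt] using wz by simp
  moreover have "linear_function n (\<lambda>\<tau>. w + \<tau> \<cdot>\<^sub>v z')"
    unfolding linear_function_def using wz by blast
  ultimately show ?thesis by blast
qed

text \<open>Every factor of the determinant except that of the diagonal pencil is nonzero at the
  chart point, so the orders agree; the chart makes this cover an infinite quotient.\<close>

lemma gamma_eigenvalue:
  assumes "j < k" "\<tau> \<noteq> 0" "\<mu> = ev_quotient (a j) (b j)"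
  shows "pencil_eigenvalue (At \<tau>) (Bt \<tau>) \<mu>" and "alg_mult (At \<tau>) (Bt \<tau>) \<mu> = alg_mult DA DB \<mu>"
proof -
  define c where "c = rho \<mu> * p \<mu> U * q \<mu> W * [:\<tau> ^ k:]"
  have eq: "det (pencil_poly (At \<tau>) (Bt \<tau>) \<mu>) = c * det (pencil_poly DA DB \<mu>)"
    unfolding det_update[OF U W] c_def ..
  have c: "poly c (chart_point \<mu>) \<noteq> 0" using gamma[OF assms(1,3)] assms(2) by (simp add: c_def)
  show "pencil_eigenvalue (At \<tau>) (Bt \<tau>) \<mu>"
    unfolding pencil_eigenvalue_regular_iff[OF At Bt regular[OF assms(2)]] eq
    using det_D_root_iff[of \<mu>] assms by auto
  show "alg_mult (At \<tau>) (Bt \<tau>) \<mu> = alg_mult DA DB \<mu>"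
    unfolding alg_mult_eq[OF At Bt] alg_mult_eq[OF mat_diag_dim mat_diag_dim] eq
    by (rule order_mult_nonroot[OF c])
qed

text \<open>The right-hand side does not mention \<tau>, which is how constancy of the null space is
  obtained.\<close>

lemma gamma_right_nullspace:
  assumes "j < k" "\<mu> = ev_quotient (a j) (b j)" "\<tau> \<noteq> 0"
  shows "right_nullspace (At \<tau>) (Bt \<tau>) \<mu> =
    {x \<in> carrier_vec n. pencil_at A B \<mu> *\<^sub>v x = 0\<^sub>v n \<and> pencil_at DA DB \<mu> *\<^sub>v (W\<^sup>T *\<^sub>v x) = 0\<^sub>v k}"
proof (rule Set.set_eqI)
  fix x
  show "x \<in> right_nullspace (At \<tau>) (Bt \<tau>) \<mu> \<longleftrightarrow> x \<in> {x \<in> carrier_vec n.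
      pencil_at A B \<mu> *\<^sub>v x = 0\<^sub>v n \<and> pencil_at DA DB \<mu> *\<^sub>v (W\<^sup>T *\<^sub>v x) = 0\<^sub>v k}"
    unfolding right_nullspace_iff[OF At Bt] mem_Collect_eq
    using updated_kernel_iff[OF U W _ assms(3), of \<mu> x] gamma[OF assms(1,2)] by blast
qed

lemma gamma_right_nullspace_cap:
  assumes "j < k" "\<mu> = ev_quotient (a j) (b j)" "\<tau> \<noteq> 0"
    and "x \<in> right_nullspace (At \<tau>) (Bt \<tau>) \<mu>" "W\<^sup>T *\<^sub>v x = 0\<^sub>v k"
  shows "x = 0\<^sub>v n"
  using updated_kernel_cap_trivial[OF U W, of \<mu> x] gamma[OF assms(1,2)] assms(4,5)
  unfolding gamma_right_nullspace[OF assms(1-3)] mem_Collect_eq by blast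

lemma not_eigenvalue:
  assumes "k \<le> n" "nrank A B = n - k" "poly (q (Fin_ev 0) W * p (Fin_ev 0) U) z = 0"
  shows "\<not> pencil_eigenvalue A B (Fin_ev z)"
  using rank_ge_iff_rho[OF assms(1), of "Fin_ev z"] root_nonzero(1)[OF assms(3)] assms(2)
  by (simp add: pencil_eigenvalue_def)

end

section \<open>Left-hand statements by transposition, and the assembled conclusions\<close>

context perturbation
begin

lemma constant_left_eigenvector:
  assumes "poly (p (Fin_ev 0) U) z = 0"
  shows "\<exists>y. \<forall>\<tau>. left_eigenvector (At \<tau>) (Bt \<tau>) (Fin_ev z) y \<and> mat_adjoint U *\<^sub>v y = 0\<^sub>v k"
proof -
  interpret T: perturbation n k "A\<^sup>T" "B\<^sup>T" dY f' g' dX f g W U a b by (rule transposed_perturbation)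
  obtain x where x: "\<And>\<tau>. right_eigenvector (T.At \<tau>) (T.Bt \<tau>) (Fin_ev z) x" "U\<^sup>T *\<^sub>v x = 0\<^sub>v k"
    using T.constant_right_eigenvector[OF assms] by blast
  have carr: "x \<in> carrier_vec n" using x(1)[of 0] unfolding right_eigenvector_iff[OF T.At T.Bt] by blast
  have "left_eigenvector (At \<tau>) (Bt \<tau>) (Fin_ev z) (conjugate x)" for \<tau>
    unfolding left_eigenvector_iff[OF At Bt] update_transpose[OF A] update_transpose[OF B] conjugate_id
    by (rule x)
  moreover have "mat_adjoint U *\<^sub>v conjugate x = 0\<^sub>v k"
    using carr unfolding mat_adjoint_mult_vec[OF U carrier_vec_conjugate[OF carr]] conjugate_id x(2)
    by (simp add: conjugate_eq_zero_iff)
  ultimately show ?thesis by blast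
qed

lemma linear_left_eigenvector:
  assumes "poly (q (Fin_ev 0) W) z = 0"
  shows "\<exists>y. linear_function n (\<lambda>\<tau>. conjugate (y \<tau>)) \<and>
    (\<forall>\<tau>. left_eigenvector (At \<tau>) (Bt \<tau>) (Fin_ev z) (y \<tau>) \<and> mat_adjoint U *\<^sub>v y \<tau> \<noteq> 0\<^sub>v k)"
proof -
  interpret T: perturbation n k "A\<^sup>T" "B\<^sup>T" dY f' g' dX f g W U a b by (rule transposed_perturbation)
  obtain x where lin: "linear_function n x"
    and x: "\<And>\<tau>. right_eigenvector (T.At \<tau>) (T.Bt \<tau>) (Fin_ev z) (x \<tau>)" "\<And>\<tau>. U\<^sup>T *\<^sub>v x \<tau> \<noteq> 0\<^sub>v k"
    using T.linear_right_eigenvector[OF assms] by blast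
  have carr: "x \<tau> \<in> carrier_vec n" for \<tau> using x(1)[of \<tau>] unfolding right_eigenvector_iff[OF T.At T.Bt] by blast
  have "left_eigenvector (At \<tau>) (Bt \<tau>) (Fin_ev z) (conjugate (x \<tau>))" for \<tau>
    unfolding left_eigenvector_iff[OF At Bt] update_transpose[OF A] update_transpose[OF B] conjugate_id
    by (rule x)
  moreover have "mat_adjoint U *\<^sub>v conjugate (x \<tau>) \<noteq> 0\<^sub>v k" for \<tau>
    using x(2) unfolding mat_adjoint_mult_vec[OF U carrier_vec_conjugate[OF carr]] conjugate_id conjugate_eq_zero_iff .
  moreover have "linear_function n (\<lambda>\<tau>. conjugate (conjugate (x \<tau>)))" using lin by simp
  ultimately show ?thesis by (intro exI[of _ "\<lambda>\<tau>. conjugate (x \<tau>)"]) blast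
qed

lemma gamma_left_nullspace:
  assumes "j < k" "\<mu> = ev_quotient (a j) (b j)" "\<tau> \<noteq> 0"
  shows "y \<in> left_nullspace (At \<tau>) (Bt \<tau>) \<mu> \<longleftrightarrow> conjugate y \<in> carrier_vec n \<and>
    pencil_at A\<^sup>T B\<^sup>T \<mu> *\<^sub>v conjugate y = 0\<^sub>v n \<and> pencil_at DA DB \<mu> *\<^sub>v (U\<^sup>T *\<^sub>v conjugate y) = 0\<^sub>v k"
proof -
  interpret T: perturbation n k "A\<^sup>T" "B\<^sup>T" dY f' g' dX f g W U a b by (rule transposed_perturbation)
  show ?thesis
    unfolding left_nullspace_iff[OF At Bt] update_transpose[OF A] update_transpose[OF B]
      T.gamma_right_nullspace[OF assms] mem_Collect_eq ..
qed

lemma gamma_left_nullspace_cap: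
  assumes "j < k" "\<mu> = ev_quotient (a j) (b j)" "\<tau> \<noteq> 0"
    and y: "y \<in> left_nullspace (At \<tau>) (Bt \<tau>) \<mu>" "mat_adjoint U *\<^sub>v y = 0\<^sub>v k"
  shows "y = 0\<^sub>v n"
proof -
  interpret T: perturbation n k "A\<^sup>T" "B\<^sup>T" dY f' g' dX f g W U a b by (rule transposed_perturbation)
  have r: "conjugate y \<in> right_nullspace (T.At \<tau>) (T.Bt \<tau>) \<mu>"
    using y(1) unfolding left_nullspace_iff[OF At Bt] update_transpose[OF A] update_transpose[OF B] .
  then have "conjugate y \<in> carrier_vec n" unfolding right_nullspace_iff[OF T.At T.Bt] by blast
  then have "y \<in> carrier_vec n" using carrier_vec_conjugate[of "conjugate y" n] by simp
  then have "U\<^sup>T *\<^sub>v conjugate y = 0\<^sub>v k"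
    using y(2) unfolding mat_adjoint_mult_vec[OF U \<open>y \<in> carrier_vec n\<close>] conjugate_eq_zero_iff by blast
  from T.gamma_right_nullspace_cap[OF assms(1-3) r this] show ?thesis
    unfolding conjugate_eq_zero_iff .
qed

lemma card_left_roots: "card {z. poly (p (Fin_ev 0) U) z = 0} = (\<Sum>j<k. dY j)"
proof -
  interpret T: perturbation n k "A\<^sup>T" "B\<^sup>T" dY f' g' dX f g W U a b by (rule transposed_perturbation)
  show ?thesis by (rule T.card_roots)
qed

lemma zero_in_nullspaces:
  "0\<^sub>v n \<in> right_nullspace (At \<tau>) (Bt \<tau>) \<mu>" "0\<^sub>v n \<in> left_nullspace (At \<tau>) (Bt \<tau>) \<mu>"
proof -
  have "pencil_at (At \<tau>) (Bt \<tau>) \<mu> *\<^sub>v 0\<^sub>v n = 0\<^sub>v n"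
    by (rule mult_zero_vec) (rule pencil_at_carrier[OF At Bt])
  then show "0\<^sub>v n \<in> right_nullspace (At \<tau>) (Bt \<tau>) \<mu>"
    unfolding right_nullspace_iff[OF At Bt] by simp
  have T: "(At \<tau>)\<^sup>T \<in> carrier_mat n n" "(Bt \<tau>)\<^sup>T \<in> carrier_mat n n" using At Bt by simp_all
  have "pencil_at (At \<tau>)\<^sup>T (Bt \<tau>)\<^sup>T \<mu> *\<^sub>v 0\<^sub>v n = 0\<^sub>v n"
    by (rule mult_zero_vec) (rule pencil_at_carrier[OF T])
  moreover have "conjugate (0\<^sub>v n) = (0\<^sub>v n :: complex vec)" using conjugate_eq_zero_iff by blast
  ultimately show "0\<^sub>v n \<in> left_nullspace (At \<tau>) (Bt \<tau>) \<mu>"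
    unfolding left_nullspace_iff[OF At Bt] right_nullspace_iff[OF T] by simp
qed

lemma simple_eigenvalues:
  assumes kn: "k \<le> n" "nrank A B = n - k"
  shows "\<exists>\<alpha> \<beta> :: nat \<Rightarrow> ext_complex.
    inj_on \<alpha> {..<\<Sum>j<k. dX j} \<and>
    (\<forall>i<\<Sum>j<k. dX j.
      (\<forall>\<tau>. \<tau> \<noteq> 0 \<longrightarrow> simple_eigenvalue (At \<tau>) (Bt \<tau>) (\<alpha> i)) \<and>
      (\<exists>x. \<forall>\<tau>. \<tau> \<noteq> 0 \<longrightarrow> right_eigenvector (At \<tau>) (Bt \<tau>) (\<alpha> i) x \<and> W\<^sup>T *\<^sub>v x = 0\<^sub>v k) \<and>
      (\<exists>y. linear_function n (\<lambda>\<tau>. conjugate (y \<tau>)) \<and>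
        (\<forall>\<tau>. \<tau> \<noteq> 0 \<longrightarrow> left_eigenvector (At \<tau>) (Bt \<tau>) (\<alpha> i) (y \<tau>) \<and> mat_adjoint U *\<^sub>v y \<tau> \<noteq> 0\<^sub>v k))) \<and>
    inj_on \<beta> {..<\<Sum>j<k. dY j} \<and>
    (\<forall>i<\<Sum>j<k. dY j.
      (\<forall>\<tau>. \<tau> \<noteq> 0 \<longrightarrow> simple_eigenvalue (At \<tau>) (Bt \<tau>) (\<beta> i)) \<and>
      (\<exists>y. \<forall>\<tau>. \<tau> \<noteq> 0 \<longrightarrow> left_eigenvector (At \<tau>) (Bt \<tau>) (\<beta> i) y \<and> mat_adjoint U *\<^sub>v y = 0\<^sub>v k) \<and>
      (\<exists>x. linear_function n x \<and>
        (\<forall>\<tau>. \<tau> \<noteq> 0 \<longrightarrow> right_eigenvector (At \<tau>) (Bt \<tau>) (\<beta> i) (x \<tau>) \<and> W\<^sup>T *\<^sub>v x \<tau> \<noteq> 0\<^sub>v k))) \<and>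
    (\<forall>\<mu> \<in> \<alpha> ` {..<\<Sum>j<k. dX j} \<union> \<beta> ` {..<\<Sum>j<k. dY j}.
      \<not> pencil_eigenvalue A B \<mu> \<and> (\<forall>j<k. \<mu> \<noteq> ev_quotient (a j) (b j)))"
proof -
  let ?h = "q (Fin_ev 0) W * p (Fin_ev 0) U"
  \<comment> \<open>The root set has exactly the required number of elements, so a bijection from an
    initial segment lists it; this gives injectivity of \<alpha>, and likewise of \<beta>.\<close>
  obtain e where e: "bij_betw e {..<\<Sum>j<k. dX j} {z. poly (q (Fin_ev 0) W) z = 0}"
    using ex_bij_betw_nat_finite[OF poly_roots_finite[OF factors_nonzero(1)]]
    unfolding card_roots atLeast0LessThan by blast
  obtain e' where e': "bij_betw e' {..<\<Sum>j<k. dY j} {z. poly (p (Fin_ev 0) U) z = 0}"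
    using ex_bij_betw_nat_finite[OF poly_roots_finite[OF factors_nonzero(2)]]
    unfolding card_left_roots atLeast0LessThan by blast
  have rX: "poly (q (Fin_ev 0) W) (e i) = 0" if "i < (\<Sum>j<k. dX j)" for i
    using bij_betwE[OF e] that by blast
  have rY: "poly (p (Fin_ev 0) U) (e' i) = 0" if "i < (\<Sum>j<k. dY j)" for i
    using bij_betwE[OF e'] that by blast
  have hX: "poly ?h (e i) = 0" if "i < (\<Sum>j<k. dX j)" for i using rX[OF that] by simp
  have hY: "poly ?h (e' i) = 0" if "i < (\<Sum>j<k. dY j)" for i using rY[OF that] by simp
  have new: "\<not> pencil_eigenvalue A B (Fin_ev z) \<and> (\<forall>j<k. Fin_ev z \<noteq> ev_quotient (a j) (b j))"
    if "poly ?h z = 0" for z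
    using not_eigenvalue[OF kn that] root_nonzero(2)[OF that] by blast
  have inj: "inj_on (\<lambda>i. Fin_ev (e i)) {..<\<Sum>j<k. dX j}" "inj_on (\<lambda>i. Fin_ev (e' i)) {..<\<Sum>j<k. dY j}"
    using bij_betw_imp_inj_on[OF e] bij_betw_imp_inj_on[OF e'] unfolding inj_on_def ext_complex.inject by blast+
  have separate: "\<forall>\<mu> \<in> (\<lambda>i. Fin_ev (e i)) ` {..<\<Sum>j<k. dX j} \<union> (\<lambda>i. Fin_ev (e' i)) ` {..<\<Sum>j<k. dY j}.
      \<not> pencil_eigenvalue A B \<mu> \<and> (\<forall>j<k. \<mu> \<noteq> ev_quotient (a j) (b j))"
  proof
    fix \<mu> assume "\<mu> \<in> (\<lambda>i. Fin_ev (e i)) ` {..<\<Sum>j<k. dX j} \<union> (\<lambda>i. Fin_ev (e' i)) ` {..<\<Sum>j<k. dY j}"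
    then obtain z where "\<mu> = Fin_ev z" "poly ?h z = 0" using hX hY by fast
    then show "\<not> pencil_eigenvalue A B \<mu> \<and> (\<forall>j<k. \<mu> \<noteq> ev_quotient (a j) (b j))" using new by simp
  qed
  have \<alpha>: "(\<forall>\<tau>. \<tau> \<noteq> 0 \<longrightarrow> simple_eigenvalue (At \<tau>) (Bt \<tau>) (Fin_ev (e i))) \<and>
      (\<exists>x. \<forall>\<tau>. \<tau> \<noteq> 0 \<longrightarrow> right_eigenvector (At \<tau>) (Bt \<tau>) (Fin_ev (e i)) x \<and> W\<^sup>T *\<^sub>v x = 0\<^sub>v k) \<and>
      (\<exists>y. linear_function n (\<lambda>\<tau>. conjugate (y \<tau>)) \<and>
        (\<forall>\<tau>. \<tau> \<noteq> 0 \<longrightarrow> left_eigenvector (At \<tau>) (Bt \<tau>) (Fin_ev (e i)) (y \<tau>) \<and> mat_adjoint U *\<^sub>v y \<tau> \<noteq> 0\<^sub>v k))"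
    if "i < (\<Sum>j<k. dX j)" for i
  proof (intro conjI allI impI)
    show "\<exists>x. \<forall>\<tau>. \<tau> \<noteq> 0 \<longrightarrow> right_eigenvector (At \<tau>) (Bt \<tau>) (Fin_ev (e i)) x \<and> W\<^sup>T *\<^sub>v x = 0\<^sub>v k"
      using constant_right_eigenvector[OF rX[OF that]] by blast
    show "\<exists>y. linear_function n (\<lambda>\<tau>. conjugate (y \<tau>)) \<and>
        (\<forall>\<tau>. \<tau> \<noteq> 0 \<longrightarrow> left_eigenvector (At \<tau>) (Bt \<tau>) (Fin_ev (e i)) (y \<tau>) \<and> mat_adjoint U *\<^sub>v y \<tau> \<noteq> 0\<^sub>v k)"
      using linear_left_eigenvector[OF rX[OF that]] by blast
  qed (rule simple_root[OF hX[OF that]])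
  have \<beta>: "(\<forall>\<tau>. \<tau> \<noteq> 0 \<longrightarrow> simple_eigenvalue (At \<tau>) (Bt \<tau>) (Fin_ev (e' i))) \<and>
      (\<exists>y. \<forall>\<tau>. \<tau> \<noteq> 0 \<longrightarrow> left_eigenvector (At \<tau>) (Bt \<tau>) (Fin_ev (e' i)) y \<and> mat_adjoint U *\<^sub>v y = 0\<^sub>v k) \<and>
      (\<exists>x. linear_function n x \<and>
        (\<forall>\<tau>. \<tau> \<noteq> 0 \<longrightarrow> right_eigenvector (At \<tau>) (Bt \<tau>) (Fin_ev (e' i)) (x \<tau>) \<and> W\<^sup>T *\<^sub>v x \<tau> \<noteq> 0\<^sub>v k))"
    if "i < (\<Sum>j<k. dY j)" for i
  proof (intro conjI allI impI)
    show "\<exists>y. \<forall>\<tau>. \<tau> \<noteq> 0 \<longrightarrow> left_eigenvector (At \<tau>) (Bt \<tau>) (Fin_ev (e' i)) y \<and> mat_adjoint U *\<^sub>v y = 0\<^sub>v k"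
      using constant_left_eigenvector[OF rY[OF that]] by blast
    show "\<exists>x. linear_function n x \<and>
        (\<forall>\<tau>. \<tau> \<noteq> 0 \<longrightarrow> right_eigenvector (At \<tau>) (Bt \<tau>) (Fin_ev (e' i)) (x \<tau>) \<and> W\<^sup>T *\<^sub>v x \<tau> \<noteq> 0\<^sub>v k)"
      using linear_right_eigenvector[OF rY[OF that]] by blast
  qed (rule simple_root[OF hY[OF that]])
  show ?thesis
    by (rule exI[of _ "\<lambda>i. Fin_ev (e i)"], rule exI[of _ "\<lambda>i. Fin_ev (e' i)"],
        rule conjI[OF inj(1)], rule conjI, rule allI, rule impI, erule \<alpha>,
        rule conjI[OF inj(2)], rule conjI[OF _ separate], rule allI, rule impI, erule \<beta>)
qed

lemma prescribed_eigenvalues: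
  assumes "j < k" "\<mu> = ev_quotient (a j) (b j)"
  shows "(\<forall>\<tau>. \<tau> \<noteq> 0 \<longrightarrow>
      pencil_eigenvalue (At \<tau>) (Bt \<tau>) \<mu> \<and> alg_mult (At \<tau>) (Bt \<tau>) \<mu> = alg_mult DA DB \<mu>) \<and>
    (\<forall>\<tau> \<sigma>. \<tau> \<noteq> 0 \<longrightarrow> \<sigma> \<noteq> 0 \<longrightarrow>
      left_nullspace (At \<tau>) (Bt \<tau>) \<mu> = left_nullspace (At \<sigma>) (Bt \<sigma>) \<mu> \<and>
      right_nullspace (At \<tau>) (Bt \<tau>) \<mu> = right_nullspace (At \<sigma>) (Bt \<sigma>) \<mu>) \<and>
    (\<forall>\<tau>. \<tau> \<noteq> 0 \<longrightarrow>
      right_nullspace (At \<tau>) (Bt \<tau>) \<mu> \<inter> mat_kernel W\<^sup>T = {0\<^sub>v n} \<and>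
      left_nullspace (At \<tau>) (Bt \<tau>) \<mu> \<inter> mat_kernel (mat_adjoint U) = {0\<^sub>v n})"
proof (intro conjI allI impI)
  fix \<tau> \<sigma> :: complex assume "\<tau> \<noteq> 0" "\<sigma> \<noteq> 0"
  then show "left_nullspace (At \<tau>) (Bt \<tau>) \<mu> = left_nullspace (At \<sigma>) (Bt \<sigma>) \<mu>"
    using gamma_left_nullspace[OF assms] by blast
next
  have WT: "W\<^sup>T \<in> carrier_mat k n" and UT: "mat_adjoint U \<in> carrier_mat k n"
    using W U by auto
  fix \<tau> :: complex assume "\<tau> \<noteq> 0"
  have "W\<^sup>T *\<^sub>v 0\<^sub>v n = 0\<^sub>v k" "mat_adjoint U *\<^sub>v 0\<^sub>v n = 0\<^sub>v k"
    using mult_zero_vec[OF WT] mult_zero_vec[OF UT] by auto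
  then show "right_nullspace (At \<tau>) (Bt \<tau>) \<mu> \<inter> mat_kernel W\<^sup>T = {0\<^sub>v n}"
    "left_nullspace (At \<tau>) (Bt \<tau>) \<mu> \<inter> mat_kernel (mat_adjoint U) = {0\<^sub>v n}"
    unfolding mat_kernel[OF WT] mat_kernel[OF UT]
    using zero_in_nullspaces gamma_right_nullspace_cap[OF assms \<open>\<tau> \<noteq> 0\<close>]
      gamma_left_nullspace_cap[OF assms \<open>\<tau> \<noteq> 0\<close>] zero_carrier_vec by blast+
next
  fix \<tau> :: complex assume "\<tau> \<noteq> 0"
  show "pencil_eigenvalue (At \<tau>) (Bt \<tau>) \<mu>" "alg_mult (At \<tau>) (Bt \<tau>) \<mu> = alg_mult DA DB \<mu>"
    by (rule gamma_eigenvalue[OF assms(1) \<open>\<tau> \<noteq> 0\<close> assms(2)])+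
next
  fix \<tau> \<sigma> :: complex assume "\<tau> \<noteq> 0" "\<sigma> \<noteq> 0"
  then show "right_nullspace (At \<tau>) (Bt \<tau>) \<mu> = right_nullspace (At \<sigma>) (Bt \<sigma>) \<mu>"
    using gamma_right_nullspace[OF assms] by simp
qed

end

section \<open>Genericity\<close>

text \<open>The polynomial put on chain \<open>j\<close> has the elements of \<open>R j\<close> as
  simple roots and thus full degree \<open>d j\<close>. Its leading coefficient keeps the
  determinant nonzero at infinity, so only finite points have to be avoided by hand.\<close>

lemma chain_det_witness:
  assumes chains: "null_chains n k A B d f g"
    and R: "\<And>j. j < k \<Longrightarrow> finite (R j) \<and> card (R j) = d j"
  defines "W \<equiv> dual_mat n k d g (\<lambda>j. coeff (\<Prod>z\<in>R j. [:- z, 1:]))"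
  shows "chain_det n k d f (Fin_ev w) W = (\<Prod>j<k. \<Prod>z\<in>R j. [:- z, 1:])"
    and "(\<And>j w. j < k \<Longrightarrow> \<mu> = Fin_ev w \<Longrightarrow> w \<notin> R j) \<Longrightarrow> poly (chain_det n k d f \<mu> W) (chart_point \<mu>) \<noteq> 0"
proof -
  have deg: "degree (\<Prod>z\<in>R j. [:- z, 1:]) = d j" if "j < k" for j
    using R[OF that] by (subst degree_prod_eq_sum_degree) auto
  show Fin: "chain_det n k d f (Fin_ev w) W = (\<Prod>j<k. \<Prod>z\<in>R j. [:- z, 1:])" for w
    unfolding W_def by (rule chain_det_dual_mat_Fin[OF chains], rule eq_imp_le, rule deg)
  show "poly (chain_det n k d f \<mu> W) (chart_point \<mu>) \<noteq> 0"
    if avoid: "\<And>j w. j < k \<Longrightarrow> \<mu> = Fin_ev w \<Longrightarrow> w \<notin> R j"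
  proof (cases \<mu>)
    case (Fin_ev w)
    then show ?thesis
      unfolding Fin_ev Fin chart_point.simps poly_prod
      using avoid[OF _ Fin_ev] R by (auto simp: prod_zero_iff)
  next
    case Inf_ev
    have "coeff (\<Prod>z\<in>R j. [:- z, 1:]) (d j) \<noteq> 0" if "j < k" for j
    proof -
      have "(\<Prod>z\<in>R j. [:- z, 1:]) \<noteq> 0" using R[OF that] by (subst prod_zero_iff) auto
      then have "lead_coeff (\<Prod>z\<in>R j. [:- z, 1:]) \<noteq> 0" by (rule leading_coeff_neq_0)
      then show ?thesis unfolding deg[OF that] .
    qed
    then show ?thesis
      unfolding Inf_ev W_def chart_point.simps chain_det_dual_mat_Inf[OF chains]
      by (subst prod_zero_iff) auto
  qed
qed

definition left_factor :: "nat \<Rightarrow> nat \<Rightarrow> complex vec \<Rightarrow> complex mat" where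
  "left_factor n k x = mat n k (\<lambda>(i, j). x $ (i * k + j))"

text \<open>In \<open>entries_vec U W\<^sup>T\<close> the rows of \<open>W\<^sup>T\<close> follow
  the \<open>n * k\<close> entries of \<open>U\<close>; reading \<open>W\<close> back exchanges the
  two indices.\<close>

definition right_factor :: "nat \<Rightarrow> nat \<Rightarrow> complex vec \<Rightarrow> complex mat" where
  "right_factor n k x = mat n k (\<lambda>(i, j). x $ (n * k + (j * n + i)))"

lemma index_less_mult: "i * k + j < n * k" if "i < n" "j < k" for i j n k :: nat
proof -
  have "i * k + j < Suc i * k" using that by simp
  also have "\<dots> \<le> n * k" using that by (intro mult_le_mono1) simp
  finally show ?thesis .
qed

lemma entries_vec_carrier:
  assumes "U \<in> carrier_mat n k" "W \<in> carrier_mat n k"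
  shows "entries_vec U W\<^sup>T \<in> carrier_vec (2 * n * k)"
proof (rule carrier_vecI)
  have "dim_vec (entries_vec U W\<^sup>T) = n * k + k * n" using assms by (simp add: entries_vec_def)
  then show "dim_vec (entries_vec U W\<^sup>T) = 2 * n * k" by (simp only: mult.commute[of k n])
qed

lemma factors_entries_vec:
  assumes U: "U \<in> carrier_mat n k" and W: "W \<in> carrier_mat n k"
  shows "left_factor n k (entries_vec U W\<^sup>T) = U" and "right_factor n k (entries_vec U W\<^sup>T) = W"
proof -
  show "left_factor n k (entries_vec U W\<^sup>T) = U"
  proof (rule eq_matI)
    fix i j assume "i < dim_row U" "j < dim_col U"
    then have ij: "i < n" "j < k" using U by auto
    then show "left_factor n k (entries_vec U W\<^sup>T) $$ (i, j) = U $$ (i, j)"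
      using U W index_less_mult[OF ij] by (simp add: left_factor_def entries_vec_def)
  qed (use U in \<open>auto simp: left_factor_def\<close>)
  show "right_factor n k (entries_vec U W\<^sup>T) = W"
  proof (rule eq_matI)
    fix i j assume "i < dim_row W" "j < dim_col W"
    then have ij: "i < n" "j < k" using W by auto
    then show "right_factor n k (entries_vec U W\<^sup>T) $$ (i, j) = W $$ (i, j)"
      using U W index_less_mult[OF ij(2,1)] by (simp add: right_factor_def entries_vec_def mult.commute)
  qed (use W in \<open>auto simp: right_factor_def\<close>)
qed

lemma poly_fun_factors:
  assumes "i < n" "j < k"
  shows "poly_fun (2 * n * k) (\<lambda>x. left_factor n k x $$ (i, j))"
    and "poly_fun (2 * n * k) (\<lambda>x. right_factor n k x $$ (i, j))"
proof -
  have "i * k + j < 2 * n * k" "n * k + (j * n + i) < 2 * n * k"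
    using index_less_mult[OF assms] index_less_mult[OF assms(2,1)] unfolding mult.commute[of k n]
    by linarith+
  then show "poly_fun (2 * n * k) (\<lambda>x. left_factor n k x $$ (i, j))"
    "poly_fun (2 * n * k) (\<lambda>x. right_factor n k x $$ (i, j))"
    using assms by (simp_all add: left_factor_def right_factor_def poly_fun_coord)
qed

section \<open>A choice of \<open>U\<close> and \<open>W\<close> at which all generic conditions
  hold\<close>

context pencil_chains
begin

text \<open>Infinitely many complex numbers lie outside \<open>points\<close>, so all roots of both
  determinants can be prescribed there and pairwise distinct.\<close>

lemma generic_factors_exist:
  assumes "finite points"
  obtains U W where "U \<in> carrier_mat n k" "W \<in> carrier_mat n k"
    and "rsquarefree (q (Fin_ev 0) W * p (Fin_ev 0) U)"
    and "degree (q (Fin_ev 0) W * p (Fin_ev 0) U) = (\<Sum>j<k. dX j) + (\<Sum>j<k. dY j)"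
    and "\<And>\<mu>. \<mu> \<in> points \<Longrightarrow>
      poly (q \<mu> W) (chart_point \<mu>) \<noteq> 0 \<and> poly (p \<mu> U) (chart_point \<mu>) \<noteq> 0"
proof -
  have "infinite (UNIV - Fin_ev -` points)"
    using assms by (intro Diff_infinite_finite finite_vimageI infinite_UNIV_char_0) (auto simp: inj_def)
  then obtain c :: "nat \<Rightarrow> complex" where c: "inj c" "range c \<subseteq> UNIV - Fin_ev -` points"
    using infinite_countable_subset by blast
  \<comment> \<open>A triple of side, chain and position is encoded as one number, so that no root
    is used twice; side 0 belongs to \<open>X\<close> and side 1 to \<open>Y\<close>.\<close>
  define e where "e = (\<lambda>i j r. c (prod_encode (i, prod_encode (j, r))))"
  have e_inj: "e i j r = e i' j' r' \<longleftrightarrow> i = i' \<and> j = j' \<and> r = r'" for i j r i' j' r'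
    using c(1) by (auto simp: e_def inj_eq prod_encode_eq)
  have e_avoid: "Fin_ev (e i j r) \<notin> points" for i j r using c(2) by (auto simp: e_def)
  define RX where "RX = (\<lambda>j. e 0 j ` {..<dX j})"
  define RY where "RY = (\<lambda>j. e 1 j ` {..<dY j})"
  have RX: "finite (RX j) \<and> card (RX j) = dX j" and RY: "finite (RY j) \<and> card (RY j) = dY j" for j
    unfolding RX_def RY_def by (auto simp: card_image inj_on_def e_inj)
  define W where "W = dual_mat n k dX g (\<lambda>j. coeff (\<Prod>z\<in>RX j. [:- z, 1:]))"
  define U where "U = dual_mat n k dY g' (\<lambda>j. coeff (\<Prod>z\<in>RY j. [:- z, 1:]))"
  have q: "q (Fin_ev 0) W = (\<Prod>j<k. \<Prod>z\<in>RX j. [:- z, 1:])"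
    unfolding W_def by (rule chain_det_witness(1)[OF X_chains RX])
  have p: "p (Fin_ev 0) U = (\<Prod>j<k. \<Prod>z\<in>RY j. [:- z, 1:])"
    unfolding U_def by (rule chain_det_witness(1)[OF Y_chains RY])
  define R where "R = (\<Union>j<k. RX j) \<union> (\<Union>j<k. RY j)"
  have finR: "finite R" unfolding R_def using RX RY by blast
  have disj: "RX i \<inter> RX j = {}" "RY i \<inter> RY j = {}" if "i \<noteq> j" for i j
    using that by (auto simp: RX_def RY_def e_inj)
  have disj': "(\<Union>j<k. RX j) \<inter> (\<Union>j<k. RY j) = {}"
    by (auto simp: RX_def RY_def e_inj)
  have prodX: "q (Fin_ev 0) W = (\<Prod>z\<in>(\<Union>j<k. RX j). [:- z, 1:])"
    unfolding q using RX disj by (subst prod.UNION_disjoint) auto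
  have prodY: "p (Fin_ev 0) U = (\<Prod>z\<in>(\<Union>j<k. RY j). [:- z, 1:])"
    unfolding p using RY disj by (subst prod.UNION_disjoint) auto
  have prod: "q (Fin_ev 0) W * p (Fin_ev 0) U = (\<Prod>z\<in>R. [:- z, 1:])"
    unfolding prodX prodY R_def using RX RY disj' by (subst prod.union_disjoint) auto
  have "card R = (\<Sum>j<k. dX j) + (\<Sum>j<k. dY j)"
  proof -
    have "card R = card (\<Union>j<k. RX j) + card (\<Union>j<k. RY j)"
      unfolding R_def using RX RY disj' by (intro card_Un_disjoint) auto
    also have "card (\<Union>j<k. RX j) = (\<Sum>j<k. card (RX j))"
      using RX disj by (intro card_UN_disjoint) auto
    also have "card (\<Union>j<k. RY j) = (\<Sum>j<k. card (RY j))"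
      using RY disj by (intro card_UN_disjoint) auto
    finally show ?thesis using RX RY by simp
  qed
  then have deg: "degree (\<Prod>z\<in>R. [:- z, 1:]) = (\<Sum>j<k. dX j) + (\<Sum>j<k. dY j)"
    by (subst degree_prod_eq_sum_degree) auto
  show ?thesis
  proof (rule that)
    show "U \<in> carrier_mat n k" "W \<in> carrier_mat n k" by (simp_all add: U_def W_def)
    show "rsquarefree (q (Fin_ev 0) W * p (Fin_ev 0) U)"
      unfolding prod by (rule rsquarefree_prod_linear[OF finR])
    show "degree (q (Fin_ev 0) W * p (Fin_ev 0) U) = (\<Sum>j<k. dX j) + (\<Sum>j<k. dY j)"
      unfolding prod by (rule deg)
    fix \<mu> assume \<mu>: "\<mu> \<in> points"
    have "poly (q \<mu> W) (chart_point \<mu>) \<noteq> 0"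
      unfolding W_def
      by (rule chain_det_witness(2)[OF X_chains RX]) (use \<mu> e_avoid in \<open>auto simp: RX_def\<close>)
    moreover have "poly (p \<mu> U) (chart_point \<mu>) \<noteq> 0"
      unfolding U_def
      by (rule chain_det_witness(2)[OF Y_chains RY]) (use \<mu> e_avoid in \<open>auto simp: RY_def\<close>)
    ultimately show "poly (q \<mu> W) (chart_point \<mu>) \<noteq> 0 \<and> poly (p \<mu> U) (chart_point \<mu>) \<noteq> 0" ..
  qed
qed

end

theorem theorem4p6:
  fixes n k :: nat
    and A B D\<^sub>A D\<^sub>B :: "complex mat"
    and a b :: "nat \<Rightarrow> complex"
    and ns ms :: "nat list"
    and \<gamma> :: "nat \<Rightarrow> ext_complex"
    and M N :: nat
  assumes A: "A \<in> carrier_mat n n" and B: "B \<in> carrier_mat n n"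
    and singular: "singular_pencil A B"
    and nrank: "k \<le> n" "nrank A B = n - k"
    and min_indices: "has_minimal_indices n A B ns ms" "length ns = k" "length ms = k"
    and D\<^sub>A: "D\<^sub>A = mat_diag k a" and D\<^sub>B: "D\<^sub>B = mat_diag k b"
    and regular: "regular_pencil D\<^sub>A D\<^sub>B"
    and \<gamma>: "\<And>i. \<gamma> i = ev_quotient (a i) (b i)"
    and \<gamma>_not_ev: "\<And>i. i < k \<Longrightarrow> \<not> pencil_eigenvalue A B (\<gamma> i)"
    and N: "N = sum_list ns" and M: "M = sum_list ms"
  shows "\<exists>\<Omega>. generic_set (2 * n * k) \<Omega> \<and>
    (\<forall>U \<in> carrier_mat n k. \<forall>V \<in> carrier_mat n k.
      mat_rank U = k \<longrightarrow> mat_rank V = k \<longrightarrow> entries_vec U (mat_adjoint V) \<in> \<Omega> \<longrightarrow>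
      (let At = (\<lambda>\<tau>. A + \<tau> \<cdot>\<^sub>m (U * D\<^sub>A * mat_adjoint V));
           Bt = (\<lambda>\<tau>. B + \<tau> \<cdot>\<^sub>m (U * D\<^sub>B * mat_adjoint V))
       in
        (\<forall>\<tau>. \<tau> \<noteq> 0 \<longrightarrow> regular_pencil (At \<tau>) (Bt \<tau>)) \<and>
        (\<exists>\<alpha> \<beta> :: nat \<Rightarrow> ext_complex.
          \<comment> \<open>1.\<close>
          inj_on \<alpha> {..<M} \<and>
          (\<forall>i<M.
            (\<forall>\<tau>. \<tau> \<noteq> 0 \<longrightarrow> simple_eigenvalue (At \<tau>) (Bt \<tau>) (\<alpha> i)) \<and>
            (\<exists>x. \<forall>\<tau>. \<tau> \<noteq> 0 \<longrightarrow>
               right_eigenvector (At \<tau>) (Bt \<tau>) (\<alpha> i) x \<and> mat_adjoint V *\<^sub>v x = 0\<^sub>v k) \<and>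
            (\<exists>y. linear_function n (\<lambda>\<tau>. conjugate (y \<tau>)) \<and>
               (\<forall>\<tau>. \<tau> \<noteq> 0 \<longrightarrow>
                 left_eigenvector (At \<tau>) (Bt \<tau>) (\<alpha> i) (y \<tau>) \<and>
                 mat_adjoint U *\<^sub>v y \<tau> \<noteq> 0\<^sub>v k))) \<and>
          \<comment> \<open>2.\<close>
          inj_on \<beta> {..<N} \<and>
          (\<forall>i<N.
            (\<forall>\<tau>. \<tau> \<noteq> 0 \<longrightarrow> simple_eigenvalue (At \<tau>) (Bt \<tau>) (\<beta> i)) \<and>
            (\<exists>y. \<forall>\<tau>. \<tau> \<noteq> 0 \<longrightarrow>
               left_eigenvector (At \<tau>) (Bt \<tau>) (\<beta> i) y \<and> mat_adjoint U *\<^sub>v y = 0\<^sub>v k) \<and>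
            (\<exists>x. linear_function n x \<and>
               (\<forall>\<tau>. \<tau> \<noteq> 0 \<longrightarrow>
                 right_eigenvector (At \<tau>) (Bt \<tau>) (\<beta> i) (x \<tau>) \<and>
                 mat_adjoint V *\<^sub>v x \<tau> \<noteq> 0\<^sub>v k))) \<and>
          \<comment> \<open>The final remark.\<close>
          (\<forall>\<mu> \<in> \<alpha> ` {..<M} \<union> \<beta> ` {..<N}.
             \<not> pencil_eigenvalue A B \<mu> \<and> (\<forall>j<k. \<mu> \<noteq> \<gamma> j))) \<and>
        \<comment> \<open>3.\<close>
        (\<forall>i<k.
          (\<forall>\<tau>. \<tau> \<noteq> 0 \<longrightarrow>
             pencil_eigenvalue (At \<tau>) (Bt \<tau>) (\<gamma> i) \<and>
             alg_mult (At \<tau>) (Bt \<tau>) (\<gamma> i) = alg_mult D\<^sub>A D\<^sub>B (\<gamma> i)) \<and>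
          (\<forall>\<tau> \<sigma>. \<tau> \<noteq> 0 \<longrightarrow> \<sigma> \<noteq> 0 \<longrightarrow>
             left_nullspace (At \<tau>) (Bt \<tau>) (\<gamma> i) = left_nullspace (At \<sigma>) (Bt \<sigma>) (\<gamma> i) \<and>
             right_nullspace (At \<tau>) (Bt \<tau>) (\<gamma> i) = right_nullspace (At \<sigma>) (Bt \<sigma>) (\<gamma> i)) \<and>
          (\<forall>\<tau>. \<tau> \<noteq> 0 \<longrightarrow>
             right_nullspace (At \<tau>) (Bt \<tau>) (\<gamma> i) \<inter> mat_kernel (mat_adjoint V) = {0\<^sub>v n} \<and>
             left_nullspace (At \<tau>) (Bt \<tau>) (\<gamma> i) \<inter> mat_kernel (mat_adjoint U) = {0\<^sub>v n}))))"
proof -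
  obtain f g where chX: "null_chains n k A B ((!) ms) f g"
    using has_minimal_indices_imp_null_chains(1)[OF A B min_indices(1)] min_indices by auto
  obtain f' g' where chY: "null_chains n k A\<^sup>T B\<^sup>T ((!) ns) f' g'"
    using has_minimal_indices_imp_null_chains(2)[OF A B min_indices(1)] min_indices by auto
  interpret pencil_chains n k A B "(!) ms" f g "(!) ns" f' g'
    by unfold_locales (rule A B chX chY)+
  have sums: "(\<Sum>j<k. ms ! j) = M" "(\<Sum>j<k. ns ! j) = N"
    using min_indices by (simp_all add: M N sum_list_sum_nth atLeast0LessThan)
  let ?F = "Fin_ev 0"
  \<comment> \<open>The normal rank is attained at some finite point, and \<open>rho\<close> does
    not vanish there.\<close>
  have rho_nonzero: "rho ?F \<noteq> 0"
  proof -
    obtain z where "mat_rank (A - z \<cdot>\<^sub>m B) = n - k"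
      using nrank_attained[OF A B] nrank(2) by metis
    then have "poly (rho (Fin_ev z)) z \<noteq> 0"
      using rank_ge_iff_rho[OF nrank(1), of "Fin_ev z"] by simp
    then show ?thesis unfolding rho_Fin[of z] by auto
  qed
  \<comment> \<open>The roots of \<open>rho\<close> are the finite eigenvalues of the singular
    pencil; infinity belongs to this set only if some \<gamma> is infinite.\<close>
  define points where "points = Fin_ev ` {z. poly (rho ?F) z = 0} \<union> \<gamma> ` {..<k}"
  have fin_points: "finite points"
    unfolding points_def using poly_roots_finite[OF rho_nonzero] by blast
  define H where "H = (\<lambda>x. q ?F (right_factor n k x) * p ?F (left_factor n k x))"
  \<comment> \<open>The first factor forces full degree, the second excludes multiple roots, and the
    product over \<open>points\<close> keeps the roots away from the eigenvalues of the singular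
    pencil and from the \<gamma>.\<close>
  define \<Phi> where "\<Phi> = (\<lambda>x. coeff (H x) (M + N) * discriminant (M + N) (H x) *
    (\<Prod>\<mu>\<in>points. poly (q \<mu> (right_factor n k x)) (chart_point \<mu>) * poly (p \<mu> (left_factor n k x)) (chart_point \<mu>)))"
  have carr: "left_factor n k x \<in> carrier_mat n k" "right_factor n k x \<in> carrier_mat n k" for x
    by (simp_all add: left_factor_def right_factor_def)
  have coeffs: "coeffs_poly_fun (2 * n * k) H"
    unfolding H_def
    by (intro coeffs_poly_fun_mult chain_det_coeffs_poly_fun carr poly_fun_factors)
  have poly_fun_\<Phi>: "poly_fun (2 * n * k) \<Phi>"
    unfolding \<Phi>_def
  proof (intro poly_fun_mult poly_fun_prod poly_fun_discriminant[OF coeffs] chain_det_value_poly_fun carr poly_fun_factors)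
    show "poly_fun (2 * n * k) (\<lambda>x. coeff (H x) (M + N))"
      using coeffs by (simp add: coeffs_poly_fun_def)
  qed
  obtain U0 W0 where UW: "U0 \<in> carrier_mat n k" "W0 \<in> carrier_mat n k"
    and sqf: "rsquarefree (q ?F W0 * p ?F U0)" and deg: "degree (q ?F W0 * p ?F U0) = M + N"
    and avoid: "\<And>\<mu>. \<mu> \<in> points \<Longrightarrow>
      poly (q \<mu> W0) (chart_point \<mu>) \<noteq> 0 \<and> poly (p \<mu> U0) (chart_point \<mu>) \<noteq> 0"
    using generic_factors_exist[OF fin_points] unfolding sums by blast
  have nz: "\<Phi> (entries_vec U0 W0\<^sup>T) \<noteq> 0"
  proof -
    have h0: "q ?F W0 * p ?F U0 \<noteq> 0" using sqf unfolding rsquarefree_def by blast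
    then have "coeff (q ?F W0 * p ?F U0) (M + N) \<noteq> 0"
      using leading_coeff_neq_0 unfolding deg[symmetric] by blast
    moreover have "discriminant (M + N) (q ?F W0 * p ?F U0) \<noteq> 0"
      using discriminant_nonzero_iff[OF deg h0] sqf by blast
    ultimately show ?thesis
      unfolding \<Phi>_def H_def factors_entries_vec[OF UW] using fin_points avoid by simp
  qed
  have generic: "generic_set (2 * n * k) {x \<in> carrier_vec (2 * n * k). \<Phi> x \<noteq> 0}"
    by (rule generic_set_nonzero[OF poly_fun_\<Phi> entries_vec_carrier[OF UW] nz])
  have conclusion: "perturbation n k A B ((!) ms) f g ((!) ns) f' g' U W a b"
    if U: "U \<in> carrier_mat n k" and W: "W \<in> carrier_mat n k" and nz: "\<Phi> (entries_vec U W\<^sup>T) \<noteq> 0" for U W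
  proof -
    let ?h = "q ?F W * p ?F U"
    have h: "coeff ?h (M + N) \<noteq> 0" "discriminant (M + N) ?h \<noteq> 0"
      and points: "\<And>\<mu>. \<mu> \<in> points \<Longrightarrow> poly (q \<mu> W) (chart_point \<mu>) \<noteq> 0 \<and> poly (p \<mu> U) (chart_point \<mu>) \<noteq> 0"
      using nz fin_points unfolding \<Phi>_def H_def factors_entries_vec[OF U W] by simp_all
    \<comment> \<open>This bound holds for all \<open>U\<close> and \<open>W\<close>; the nonzero
      coefficient gives equality, and at exact degree \<open>discriminant\<close> decides
      square-freeness.\<close>
    have "degree ?h \<le> M + N"
      using degree_mult_le[of "q ?F W" "p ?F U"] degree_chain_det_le[OF W, of "(!) ms" f 0]
        degree_chain_det_le[OF U, of "(!) ns" f' 0] unfolding sums by linarith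
    moreover have "M + N \<le> degree ?h" using h(1) by (rule le_degree)
    ultimately have deg: "degree ?h = M + N" by simp
    have h0: "?h \<noteq> 0" using h(1) by auto
    show ?thesis
    proof
      show "rsquarefree ?h" using discriminant_nonzero_iff[OF deg h0] h(2) by blast
      show "degree ?h = (\<Sum>j<k. ms ! j) + (\<Sum>j<k. ns ! j)" unfolding sums by (rule deg)
      show "poly ?h z \<noteq> 0" if "poly (rho ?F) z = 0" for z
        using points[of "Fin_ev z"] that unfolding points_def chain_det_Fin[of _ _ _ _ z] by simp
      show "poly (rho \<mu>) (chart_point \<mu>) \<noteq> 0 \<and> poly (q \<mu> W) (chart_point \<mu>) \<noteq> 0 \<and>
          poly (p \<mu> U) (chart_point \<mu>) \<noteq> 0"
        if "j < k" "\<mu> = ev_quotient (a j) (b j)" for j \<mu>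
      proof -
        have \<mu>: "\<mu> = \<gamma> j" using that \<gamma> by simp
        have "\<not> pencil_eigenvalue A B \<mu>" unfolding \<mu> by (rule \<gamma>_not_ev[OF that(1)])
        then have "n - k \<le> mat_rank (pencil_at A B \<mu>)" by (simp add: pencil_eigenvalue_def nrank(2))
        then have "poly (rho \<mu>) (chart_point \<mu>) \<noteq> 0" using rank_ge_iff_rho[OF nrank(1)] by blast
        moreover have "\<mu> \<in> points" unfolding points_def \<mu> using that(1) by blast
        ultimately show ?thesis using points by blast
      qed
    qed (use U W regular rho_nonzero in \<open>simp_all add: D\<^sub>A D\<^sub>B\<close>)
  qed
  show ?thesis
  proof (intro exI[of _ "{x \<in> carrier_vec (2 * n * k). \<Phi> x \<noteq> 0}"] conjI ballI impI generic, goal_cases)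
    case (1 U V)
    \<comment> \<open>The coordinates are the entries of \<open>U\<close> and of the adjoint of
      \<open>V\<close>, which is \<open>W\<^sup>T\<close>; in these \<Phi> is polynomial, without
      conjugation.\<close>
    define W where "W = map_mat cnj V"
    have W: "W \<in> carrier_mat n k" using 1 by (simp add: W_def)
    have adj: "mat_adjoint V = W\<^sup>T" unfolding W_def by (rule mat_adjoint_eq)
    interpret P: perturbation n k A B "(!) ms" f g "(!) ns" f' g' U W a b
      by (rule conclusion[OF _ W]) (use 1 in \<open>simp_all add: adj\<close>)
    have regular_pencils: "\<forall>\<tau>. \<tau> \<noteq> 0 \<longrightarrow> regular_pencil (P.At \<tau>) (P.Bt \<tau>)"
      using P.regular by blast
    show ?case
      unfolding Let_def adj D\<^sub>A D\<^sub>B \<gamma>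
      by (rule conjI[OF regular_pencils], rule conjI[OF P.simple_eigenvalues[OF nrank, unfolded sums]],
          rule allI, rule impI, erule P.prescribed_eigenvalues, rule refl)
  qed
qed

end
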